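(* Consider a three-dimensional motion of a barotropic Euler--van der Waals--Korteweg (capillary) fluid with density $\rho(t,\boldsymbol x)>0$, velocity $\boldsymbol u(t,\boldsymbol x)$, volume energy $W(\rho,\nabla\rho)$ and external force potential $V(t,\boldsymbol x)$, i.e. $\rho,\boldsymbol u$ satisfy $$\frac{\partial\rho}{\partial t}+{\rm div}(\rho\,\boldsymbol u)=0,\qquad \frac{D\boldsymbol u}{Dt}+\left(\frac{\partial\boldsymbol u}{\partial\boldsymbol x}\right)^T\boldsymbol u+\nabla\left(H-\frac{|\boldsymbol u|^2}{2}\right)=\boldsymbol 0,$$ where $$H=\frac{\delta W}{\delta\rho}+V,\qquad \frac{\delta W}{\delta\rho}=\frac{\partial W}{\partial\rho}-{\rm div}\left(\frac{\partial W}{\partial\nabla\rho}\right).$$ Let $\boldsymbol\omega={\rm curl}\,\boldsymbol u$. $1^o)$ The following conservation law holds: $$\frac{\partial}{\partial t}\left(\boldsymbol u^T\boldsymbol\omega\right)+{\rm div}\left\{\left(\boldsymbol u^T\boldsymbol\omega\right)\boldsymbol u+\left(H-\frac{|\boldsymbol u|^2}{2}\right)\boldsymbol\omega\right\}=0 .$$ $2^o)$ Let $D_t$ be a material domain with boundary $S_t$. If at $t=0$ the vector field $\boldsymbol\omega$ is tangent to $S_0$, then for any time $t$ the vector field $\boldsymbol\omega$ is tangent to $S_t$, and the helicity $$\mathcal H=\iiint_{D_t}\boldsymbol u^T\boldsymbol\omega\,dD$$ keeps a constant value along the motion. Both $1^o)$ and $2^o)$ remain true if $\boldsymbol\omega$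 is replaced throughout by any of the vector fields $\boldsymbol E_i$, $i=1,2,3$, where $\boldsymbol E_i$ is the $i$-th column of $\boldsymbol F/\det\boldsymbol F$ and $\boldsymbol F$ is the deformation gradient of the motion, regarded as a function of $(t,\boldsymbol x)$.
   Context: Vectors are column vectors; $^T$ is transposition, so $\boldsymbol a^T\boldsymbol b$ is the scalar product. For a vector field $\boldsymbol v$, $\partial\boldsymbol v/\partial\boldsymbol x$ is the Jacobian matrix with entries $\partial v^i/\partial x^j$ (row $i$, column $j$); $\nabla f$ is the column vector of spatial partial derivatives of a scalar $f$. The divergence, curl and all spatial derivatives are with respect to the Eulerian coordinates $\boldsymbol x$. The material derivative is $\frac{D}{Dt}=\frac{\partial}{\partial t}+\boldsymbol u^T\nabla$, applied componentwise to vectors. $\partial W/\partial\nabla\rho$ denotes the vector of partial derivatives of $W$ with respect to the components of $\nabla\rho$. A fluid motion is $\boldsymbol x=\boldsymbol\varphi(t,\boldsymbol X)$, where at each time $\boldsymbol\varphi(t,\cdot)$ is a diffeomorphism from a three-dimensional reference configuration (Lagrangian coordinates $\boldsymbol X=(X^1,X^2,X^3)^T$) to physical space (Eulerian coordinates $\boldsymbol x$), with continuous derivatives up to second order. The velocity is $\boldsymbol u(t,\boldsymbol x)=\partial\boldsymbol\varphi(t,\boldsymbol X)/\partial t$ at $\boldsymbol X=\boldsymbol\varphi^{-1}(t,\boldsymbol x)$, and the deformation gradient is $\boldsymbol F=\partial\boldsymbol\varphi(t,\boldsymbol X)/\partial\boldsymbol X$, expressed in Eulerian coordinates through $\boldsymbol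 X=\boldsymbol\varphi^{-1}(t,\boldsymbol x)$. A material domain $D_t$ is the image under $\boldsymbol\varphi(t,\cdot)$ of a fixed domain of the reference configuration; its boundary $S_t$ is transported likewise, and $S_0$ in the claim denotes $S_t$ at $t=0$. Material domains are bounded with boundary regular enough for the divergence theorem, and all fields and the function $W$ are smooth enough (up to the boundary) that all derivatives needed exist and are continuous. A field is tangent to $S_t$ if its scalar product with the normal to $S_t$ vanishes on $S_t$. *)

theory Defs
  imports "HOL-Analysis.Analysis"
begin

section \<open>Differential operators\<close>

text \<open>Class \<open>C\<^sup>k\<close> on an open set \<open>S\<close>. The set \<open>S\<close> is meant to be open, since derivatives are
  taken with respect to full neighbourhoods.\<close>

fun Ck_on :: "nat \<Rightarrow> ('a::euclidean_space \<Rightarrow> 'b::real_normed_vector) \<Rightarrow> 'a set \<Rightarrow> bool" where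
  "Ck_on 0 f S \<longleftrightarrow> continuous_on S f"
| "Ck_on (Suc k) f S \<longleftrightarrow>
     (\<forall>x\<in>S. f differentiable (at x)) \<and>
     (\<forall>e\<in>Basis. Ck_on k (\<lambda>x. frechet_derivative f (at x) e) S)"

definition grad :: "(real^3 \<Rightarrow> real) \<Rightarrow> real^3 \<Rightarrow> real^3" where
  "grad f x = (\<chi> i. frechet_derivative f (at x) (axis i 1))"

definition divergence :: "(real^3 \<Rightarrow> real^3) \<Rightarrow> real^3 \<Rightarrow> real" where
  "divergence v x = trace (jacobian v (at x))"

definition curl :: "(real^3 \<Rightarrow> real^3) \<Rightarrow> real^3 \<Rightarrow> real^3" where
  "curl v x = (let A = jacobian v (at x) in
     vector [A $ 3 $ 2 - A $ 2 $ 3, A $ 1 $ 3 - A $ 3 $ 1, A $ 2 $ 1 - A $ 1 $ 2])"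

definition time_deriv :: "(real \<Rightarrow> real^3 \<Rightarrow> 'b::real_normed_vector) \<Rightarrow> real \<Rightarrow> real^3 \<Rightarrow> 'b" where
  "time_deriv f t x = vector_derivative (\<lambda>s. f s x) (at t)"

definition material_deriv ::
  "(real \<Rightarrow> real^3 \<Rightarrow> real^3) \<Rightarrow> (real \<Rightarrow> real^3 \<Rightarrow> real^3) \<Rightarrow> real \<Rightarrow> real^3 \<Rightarrow> real^3" where
  "material_deriv u v t x = time_deriv v t x + (\<chi> i. u t x \<bullet> grad (\<lambda>y. v t y $ i) x)"

section \<open>Motion\<close>

text \<open>Smoothness up to the boundary is expressed by two layers. The motion and the fields are smooth
  for times in an open interval \<open>T\<close> and particles in an open set \<open>N\<close>, whereas the equations of
  motion are only required for times in an interval \<open>I \<subseteq> T\<close> (possibly containing its endpoints)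
  and particles in the reference configuration \<open>B \<subseteq> N\<close>. The closure of a material domain of \<open>B\<close>
  only has to lie in \<open>N\<close>, so it may reach the boundary of \<open>B\<close>; one may also take \<open>T = I\<close> and
  \<open>N = B\<close>.\<close>

definition motion :: "real set \<Rightarrow> (real^3) set \<Rightarrow> (real \<Rightarrow> real^3 \<Rightarrow> real^3) \<Rightarrow> bool" where
  "motion T N \<phi> \<longleftrightarrow>
     open T \<and> is_interval T \<and> open N \<and>
     Ck_on 2 (\<lambda>(t, X). \<phi> t X) (T \<times> N) \<and>
     (\<forall>t\<in>T. inj_on (\<phi> t) N \<and> open (\<phi> t ` N) \<and> Ck_on 2 (inv_into N (\<phi> t)) (\<phi> t ` N))"

definition eulerian_region ::
  "real set \<Rightarrow> (real^3) set \<Rightarrow> (real \<Rightarrow> real^3 \<Rightarrow> real^3) \<Rightarrow> (real \<times> (real^3)) set" where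
  "eulerian_region T N \<phi> = (SIGMA t:T. \<phi> t ` N)"

definition velocity_of_motion ::
  "real set \<Rightarrow> (real^3) set \<Rightarrow> (real \<Rightarrow> real^3 \<Rightarrow> real^3) \<Rightarrow> (real \<Rightarrow> real^3 \<Rightarrow> real^3) \<Rightarrow> bool" where
  "velocity_of_motion T N \<phi> u \<longleftrightarrow> (\<forall>t\<in>T. \<forall>X\<in>N. u t (\<phi> t X) = time_deriv \<phi> t X)"

definition deformation_gradient ::
  "(real^3) set \<Rightarrow> (real \<Rightarrow> real^3 \<Rightarrow> real^3) \<Rightarrow> real \<Rightarrow> real^3 \<Rightarrow> real^3^3" where
  "deformation_gradient N \<phi> t x = jacobian (\<phi> t) (at (inv_into N (\<phi> t) x))"

definition E_field ::
  "(real^3) set \<Rightarrow> (real \<Rightarrow> real^3 \<Rightarrow> real^3) \<Rightarrow> 3 \<Rightarrow> real \<Rightarrow> real^3 \<Rightarrow> real^3" where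
  "E_field N \<phi> i t x =
     (let F = deformation_gradient N \<phi> t x in column i ((1 / det F) *\<^sub>R F))"

section \<open>The capillary fluid\<close>

definition variational_deriv ::
  "(real \<times> (real^3) \<Rightarrow> real) \<Rightarrow> (real^3 \<Rightarrow> real) \<Rightarrow> real^3 \<Rightarrow> real" where
  "variational_deriv W r x =
     deriv (\<lambda>s. W (s, grad r x)) (r x)
     - divergence (\<lambda>y. grad (\<lambda>p. W (r y, p)) (grad r y)) x"

definition H_of ::
  "(real \<times> (real^3) \<Rightarrow> real) \<Rightarrow> (real \<Rightarrow> real^3 \<Rightarrow> real) \<Rightarrow> (real \<Rightarrow> real^3 \<Rightarrow> real) \<Rightarrow>
   real \<Rightarrow> real^3 \<Rightarrow> real" where
  "H_of W V \<rho> t x = variational_deriv W (\<rho> t) x + V t x"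

definition mass_equation ::
  "(real \<Rightarrow> real^3 \<Rightarrow> real) \<Rightarrow> (real \<Rightarrow> real^3 \<Rightarrow> real^3) \<Rightarrow> real \<Rightarrow> real^3 \<Rightarrow> bool" where
  "mass_equation \<rho> u t x \<longleftrightarrow>
     time_deriv \<rho> t x + divergence (\<lambda>y. \<rho> t y *\<^sub>R u t y) x = 0"

definition momentum_equation ::
  "(real \<Rightarrow> real^3 \<Rightarrow> real) \<Rightarrow> (real \<Rightarrow> real^3 \<Rightarrow> real^3) \<Rightarrow> real \<Rightarrow> real^3 \<Rightarrow> bool" where
  "momentum_equation H u t x \<longleftrightarrow>
     material_deriv u u t x + transpose (jacobian (u t) (at x)) *v u t x
     + grad (\<lambda>y. H t y - (norm (u t y))\<^sup>2 / 2) x = 0"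

section \<open>Domains with piecewise smooth boundary\<close>

text \<open>Near \<open>p\<close> the set \<open>D\<close> is one side \<open>g < 0\<close> of a \<open>C\<^sup>1\<close> surface \<open>g = 0\<close>, and \<open>n = \<nabla>g(p)\<close>.
  The vector \<open>n\<close> is not normalised: it is any positive multiple of the outward unit normal.\<close>

definition outward_normal :: "(real^3) set \<Rightarrow> real^3 \<Rightarrow> real^3 \<Rightarrow> bool" where
  "outward_normal D p n \<longleftrightarrow>
     (\<exists>U g. open U \<and> p \<in> U \<and> Ck_on 1 g U \<and> (\<forall>x\<in>U. grad g x \<noteq> 0) \<and>
            D \<inter> U = {x\<in>U. g x < 0} \<and> g p = 0 \<and> n = grad g p)"

text \<open>For compact \<open>A\<close> this says that the two-dimensional Hausdorff measure of \<open>A\<close> is zero.\<close>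

definition null_area :: "(real^3) set \<Rightarrow> bool" where
  "null_area A \<longleftrightarrow>
     (\<forall>\<epsilon>>0. \<exists>C :: ((real^3) \<times> real) set.
        finite C \<and> (\<forall>(p, r)\<in>C. r > 0) \<and> A \<subseteq> (\<Union>(p, r)\<in>C. ball p r) \<and>
        (\<Sum>(p, r)\<in>C. r\<^sup>2) < \<epsilon>)"

text \<open>The standard setting for the divergence theorem: the boundary is of class \<open>C\<^sup>1\<close> except for
  a set of zero area, which allows for edges and vertices.\<close>

definition regular_domain :: "(real^3) set \<Rightarrow> bool" where
  "regular_domain D \<longleftrightarrow>
     open D \<and> bounded D \<and> null_area {p \<in> frontier D. \<nexists>n. outward_normal D p n}"

definition tangent_to_boundary :: "(real^3 \<Rightarrow> real^3) \<Rightarrow> (real^3) set \<Rightarrow> bool" where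
  "tangent_to_boundary v D \<longleftrightarrow> (\<forall>p\<in>frontier D. \<forall>n. outward_normal D p n \<longrightarrow> v p \<bullet> n = 0)"

section \<open>The two claims for a vector field \<open>w\<close>\<close>

text \<open>The differentiability conditions make the operators in the equation meaningful.\<close>

definition helicity_conservation_law ::
  "(real \<Rightarrow> real^3 \<Rightarrow> real) \<Rightarrow> (real \<Rightarrow> real^3 \<Rightarrow> real^3) \<Rightarrow> (real \<Rightarrow> real^3 \<Rightarrow> real^3) \<Rightarrow>
   real \<Rightarrow> real^3 \<Rightarrow> bool" where
  "helicity_conservation_law H u w t x \<longleftrightarrow>
     (let flux = (\<lambda>y. (u t y \<bullet> w t y) *\<^sub>R u t y + (H t y - (norm (u t y))\<^sup>2 / 2) *\<^sub>R w t y) in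
      (\<lambda>s. u s x \<bullet> w s x) differentiable (at t) \<and> flux differentiable (at x) \<and>
      time_deriv (\<lambda>s y. u s y \<bullet> w s y) t x + divergence flux x = 0)"

definition helicity ::
  "(real \<Rightarrow> real^3 \<Rightarrow> real^3) \<Rightarrow> (real \<Rightarrow> real^3 \<Rightarrow> real^3) \<Rightarrow> (real \<Rightarrow> (real^3) set) \<Rightarrow> real \<Rightarrow> real" where
  "helicity u w D t = (LINT x : D t | lborel. u t x \<bullet> w t x)"

end

theory Submission
  imports Defs
begin

text \<open>The momentum equation is Euler's equation \<open>Du/Dt = - \<nabla>H\<close>, so the vorticity satisfies
  \<open>\<partial>\<^sub>t w + (\<partial>w/\<partial>x) u + (div u) w = (\<partial>u/\<partial>x) w\<close> and \<open>div w = 0\<close>; the fields \<open>E\<^sub>i\<close> satisfy the same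
  two equations by pure kinematics. Part 1 is an algebraic consequence of these equations. For part 2,
  take the initial positions as reference coordinates, so that \<open>\<phi>\<^sub>0 = id\<close>. A linear differential
  equation along trajectories gives \<open>F w\<^sub>0 = (det F) w\<close>, which transports tangency; it also turns the
  helicity into the integral of \<open>u \<bullet> F w\<^sub>0\<close> over a fixed domain. With \<open>q = H - \<bar>u\<bar>\<^sup>2/2\<close> the time
  derivative of the integrand is \<open>- div (q w\<^sub>0)\<close>, whose integral vanishes because \<open>w\<^sub>0\<close> is tangent to the
  boundary.

  For tangent fields the divergence theorem needs no surface integrals: one tests with cutoff functions
  that vanish near the boundary. The gradients of the cutoffs near the smooth part of the boundary are
  almost orthogonal to the field, and those near the singular part are small in \<open>L\<^sup>1\<close> since the
  singular part has zero area.\<close>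

section \<open>Calculus of \<open>C\<^sup>k\<close> maps\<close>

text \<open>The data are smooth on the open layer \<open>T \<times> N\<close>, but the equations of
  motion hold only for times in \<open>I\<close> and particles in \<open>B\<close>, and the closure
  of a material domain may leave \<open>B\<close>. In part 2 the equations are therefore used only
  inside the open domain; what is needed at its boundary is kinematic or follows by continuity.
  Regularity is tight. Since \<open>u\<close> and the motion are of class C2, the transported fields
  are at best C1, and for the columns of \<open>F / det F\<close> only joint differentiability in
  \<open>(t, x)\<close> is established. Over a fixed domain, the divergence theorem meets such a
  field only as \<open>w 0\<close>, at a single time. Initial positions as reference coordinates
  also settle the sign of \<open>det F\<close>: it equals 1 at time 0 and never vanishes, whatever
  the orientation of the given reference configuration. A cutoff at scale \<open>r\<close> in space
  has a gradient of order \<open>1 / r\<close> on a volume of order \<open>r ^ 3\<close>. Its cost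
  is of order \<open>r ^ 2\<close>, exactly what \<open>null_area\<close> sums, so edges and
  vertices can be cut away without a surface measure.\<close>

abbreviation fderiv :: "('a::real_normed_vector \<Rightarrow> 'b::real_normed_vector) \<Rightarrow> 'a \<Rightarrow> 'a \<Rightarrow> 'b" where
  "fderiv f x \<equiv> frechet_derivative f (at x)"

lemma linear_euclidean_expansion:
  fixes f :: "'a::euclidean_space \<Rightarrow> 'b::real_vector"
  assumes "linear f"
  shows "f v = (\<Sum>b\<in>Basis. (v \<bullet> b) *\<^sub>R f b)"
  by (subst euclidean_representation[of v, symmetric]) (simp add: linear_sum[OF assms] linear_scale[OF assms])

lemma linear_component_expansion:
  fixes f :: "real^'n \<Rightarrow> 'b::real_vector"
  assumes "linear f"
  shows "f v = (\<Sum>k\<in>UNIV. v $ k *\<^sub>R f (axis k 1))"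
proof -
  have v: "(\<Sum>k\<in>UNIV. v $ k *\<^sub>R axis k 1) = v"
    by (simp add: vec_eq_iff axis_def if_distrib cong: if_cong)
  have "f (\<Sum>k\<in>UNIV. v $ k *\<^sub>R axis k 1) = (\<Sum>k\<in>UNIV. v $ k *\<^sub>R f (axis k 1))"
    by (simp add: linear_sum[OF assms] linear_scale[OF assms])
  then show ?thesis unfolding v .
qed

lemma Ck_on_subset: "Ck_on k f S \<Longrightarrow> S' \<subseteq> S \<Longrightarrow> Ck_on k f S'"
  by (induction k arbitrary: f) (auto intro: continuous_on_subset)

lemma Ck_on_SucD:
  assumes "Ck_on (Suc k) f S" shows "Ck_on k f S"
  using assms
proof (induction k arbitrary: f)
  case 0
  then show ?case
    by (auto intro!: continuous_at_imp_continuous_on differentiable_imp_continuous_within)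
next
  case (Suc k)
  then show ?case by simp
qed

lemma Ck_on_le: "Ck_on m f S \<Longrightarrow> k \<le> m \<Longrightarrow> Ck_on k f S"
  by (induction m) (auto simp: le_Suc_eq dest: Ck_on_SucD simp del: Ck_on.simps)

lemma Ck_on_imp_continuous_on: "Ck_on k f S \<Longrightarrow> continuous_on S f"
  using Ck_on_le[of k f S 0] by simp

lemma Ck_on_differentiable: "Ck_on k f S \<Longrightarrow> 0 < k \<Longrightarrow> x \<in> S \<Longrightarrow> f differentiable (at x)"
  by (cases k) auto

lemma Ck_on_has_derivative:
  "Ck_on k f S \<Longrightarrow> 0 < k \<Longrightarrow> x \<in> S \<Longrightarrow> (f has_derivative fderiv f x) (at x)"
  using Ck_on_differentiable frechet_derivative_works by blast

text \<open>\<open>frechet_derivative\<close> is a choice among all derivatives at the point, so it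
  suffices that both functions have the same set of derivatives there, even when this set is
  empty.\<close>

lemma frechet_derivative_cong_open:
  assumes "open S" "x \<in> S" "\<And>y. y \<in> S \<Longrightarrow> f y = g y"
  shows "fderiv f x = fderiv g x"
proof -
  have "(f has_derivative h) (at x) \<longleftrightarrow> (g has_derivative h) (at x)" for h
    using assms has_derivative_transform_within_open by metis
  then show ?thesis by (simp add: frechet_derivative_def)
qed

lemma Ck_on_cong:
  assumes "open S" "\<And>x. x \<in> S \<Longrightarrow> f x = g x"
  shows "Ck_on k f S \<longleftrightarrow> Ck_on k g S"
  using assms(2)
proof (induction k arbitrary: f g)
  case 0
  then show ?case by (auto cong: continuous_on_cong)
next
  case (Suc k)
  have "f differentiable (at x) \<longleftrightarrow> g differentiable (at x)" if "x \<in> S" for x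
    using that assms(1) Suc.prems has_derivative_transform_within_open
    unfolding differentiable_def by metis
  moreover have "Ck_on k (\<lambda>x. fderiv f x e) S
      \<longleftrightarrow> Ck_on k (\<lambda>x. fderiv g x e) S" for e
    by (rule Suc.IH) (metis frechet_derivative_cong_open assms(1) Suc.prems)
  ultimately show ?case by simp
qed

text \<open>\<open>Ck_on\<close> speaks of the chosen \<open>frechet_derivative\<close>; this rule
  lets an explicit derivative \<open>f'\<close> be exhibited instead. The basic closure properties
  of \<open>Ck_on\<close> rest on it.\<close>

lemma Ck_on_SucI:
  assumes "open S" "\<And>x. x \<in> S \<Longrightarrow> (f has_derivative f' x) (at x)"
    and "\<And>e. e \<in> Basis \<Longrightarrow> Ck_on k (\<lambda>x. f' x e) S"
  shows "Ck_on (Suc k) f S"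
proof -
  have "Ck_on k (\<lambda>x. fderiv f x e) S" if "e \<in> Basis" for e
  proof -
    have "f' x e = fderiv f x e" if "x \<in> S" for x
      by (simp add: frechet_derivative_at[OF assms(2)[OF that], symmetric])
    then show ?thesis
      by (rule Ck_on_cong[OF assms(1), THEN iffD1, OF _ assms(3)[OF that]])
  qed
  with assms(2) show ?thesis by (auto simp: differentiable_def)
qed

lemma Ck_on_const: "open S \<Longrightarrow> Ck_on k (\<lambda>x. c) S"
  by (induction k arbitrary: c) (auto intro!: Ck_on_SucI derivative_eq_intros simp del: Ck_on.simps(2))

lemma Ck_on_bounded_linear_fun: "open S \<Longrightarrow> bounded_linear f \<Longrightarrow> Ck_on k f S"
  by (cases k)
    (auto intro!: Ck_on_SucI bounded_linear_imp_has_derivative Ck_on_const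
          simp: linear_continuous_on simp del: Ck_on.simps(2))

lemma Ck_on_add:
  assumes "open S" "Ck_on k f S" "Ck_on k g S"
  shows "Ck_on k (\<lambda>x. f x + g x) S"
  using assms(2-)
proof (induction k arbitrary: f g)
  case 0
  then show ?case by (auto intro: continuous_intros)
next
  case (Suc k)
  then show ?case
    by (intro Ck_on_SucI[OF assms(1), where f' = "\<lambda>x h. fderiv f x h + fderiv g x h"])
      (auto intro!: has_derivative_add simp: frechet_derivative_works[symmetric])
qed

lemma (in bounded_linear) Ck_on:
  assumes "open S" "Ck_on k g S"
  shows "Ck_on k (\<lambda>x. f (g x)) S"
  using assms(2)
proof (induction k arbitrary: g)
  case 0
  then show ?case by (auto intro: continuous_on)
next
  case (Suc k)
  then show ?case
    by (intro Ck_on_SucI[OF assms(1), where f' = "\<lambda>x h. f (fderiv g x h)"])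
      (auto intro!: has_derivative simp: frechet_derivative_works[symmetric])
qed

lemma (in bounded_bilinear) Ck_on:
  assumes "open S" "Ck_on k f S" "Ck_on k g S"
  shows "Ck_on k (\<lambda>x. prod (f x) (g x)) S"
  using assms(2-)
proof (induction k arbitrary: f g)
  case 0
  then show ?case by (auto intro: continuous_on)
next
  case (Suc k)
  have "Ck_on k f S" "Ck_on k g S" using Suc.prems Ck_on_SucD by blast+
  with Suc show ?case
    by (intro Ck_on_SucI[OF assms(1), where f' = "\<lambda>x h. prod (f x) (fderiv g x h) +
          prod (fderiv f x h) (g x)"])
      (auto intro!: FDERIV Ck_on_add[OF assms(1)] simp: frechet_derivative_works[symmetric])
qed

lemma Ck_on_sum:
  assumes "open S" "\<And>i. i \<in> A \<Longrightarrow> Ck_on k (f i) S"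
  shows "Ck_on k (\<lambda>x. \<Sum>i\<in>A. f i x) S"
  using assms(2)
  by (induction A rule: infinite_finite_induct) (auto intro: assms(1) Ck_on_const Ck_on_add)

lemmas Ck_on_minus = bounded_linear.Ck_on[OF bounded_linear_minus[OF bounded_linear_ident]]
lemmas Ck_on_inner = bounded_bilinear.Ck_on[OF bounded_bilinear_inner]
lemmas Ck_on_mult = bounded_bilinear.Ck_on[OF bounded_bilinear_mult]
lemmas Ck_on_scaleR = bounded_bilinear.Ck_on[OF bounded_bilinear_scaleR]
lemmas Ck_on_nth = bounded_linear.Ck_on[OF bounded_linear_vec_nth]

lemma Ck_on_diff:
  assumes "open S" "Ck_on k f S" "Ck_on k g S"
  shows "Ck_on k (\<lambda>x. f x - g x) S"
  using Ck_on_add[OF assms(1,2) Ck_on_minus[OF assms(1,3)]] by simp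

text \<open>\<open>Ck_on\<close> controls derivatives along basis vectors only; linearity of the
  derivative extends this to an arbitrary fixed direction.\<close>

lemma Ck_on_frechet_derivative:
  assumes "open S" "Ck_on (Suc k) f S"
  shows "Ck_on k (\<lambda>x. fderiv f x v) S"
proof -
  have "fderiv f x v = (\<Sum>e\<in>Basis. (v \<bullet> e) *\<^sub>R fderiv f x e)" if "x \<in> S" for x
    by (rule linear_euclidean_expansion[OF has_derivative_linear[OF Ck_on_has_derivative[OF assms(2) _ that]]]) simp
  moreover have "Ck_on k (\<lambda>x. \<Sum>e\<in>Basis. (v \<bullet> e) *\<^sub>R fderiv f x e) S"
    using assms by (intro Ck_on_sum Ck_on_scaleR Ck_on_const) auto
  ultimately show ?thesis by (simp cong: Ck_on_cong[OF assms(1)])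
qed

lemma C2_on_fderiv: "open S \<Longrightarrow> Ck_on 2 f S \<Longrightarrow> Ck_on 1 (\<lambda>x. fderiv f x v) S"
  using Ck_on_frechet_derivative[of S 1 f v] by (simp add: numeral_2_eq_2)

text \<open>The chain rule is expanded in basis vectors, so that the outer derivative appears only
  in fixed directions \<open>b\<close>. The induction hypothesis then applies to each partial
  derivative of \<open>f\<close>, composed with the same \<open>g\<close>.\<close>

lemma Ck_on_compose:
  assumes "open S" "open R" "Ck_on k g S" "Ck_on k f R" "g ` S \<subseteq> R"
  shows "Ck_on k (\<lambda>x. f (g x)) S"
  using assms(3,4)
proof (induction k arbitrary: f)
  case 0
  then show ?case using continuous_on_compose2[of R f S g] assms(5) by simp
next
  case (Suc k)
  have g: "Ck_on k g S" using Suc.prems Ck_on_SucD by blast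
  let ?f' = "\<lambda>x. fderiv f x"
  let ?g' = "\<lambda>x. fderiv g x"
  show ?case
  proof (rule Ck_on_SucI[OF assms(1)])
    show "((\<lambda>x. f (g x)) has_derivative (\<lambda>h. \<Sum>b\<in>Basis. (?g' x h \<bullet> b) *\<^sub>R ?f' (g x) b)) (at x)"
      if "x \<in> S" for x
    proof -
      have f: "(f has_derivative ?f' (g x)) (at (g x))"
        using Ck_on_has_derivative[OF Suc.prems(2)] that assms(5) by auto
      have gd: "(g has_derivative ?g' x) (at x)"
        using Ck_on_has_derivative[OF Suc.prems(1)] that by auto
      show ?thesis
        by (rule has_derivative_eq_rhs[OF has_derivative_compose[OF gd f]], rule ext)
          (rule linear_euclidean_expansion[OF has_derivative_linear[OF f]])
    qed
    show "Ck_on k (\<lambda>x. \<Sum>b\<in>Basis. (?g' x e \<bullet> b) *\<^sub>R ?f' (g x) b) S" if "e \<in> Basis" for e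
      using Suc.prems g that
      by (intro Ck_on_sum Ck_on_scaleR Ck_on_inner Ck_on_const assms(1) Suc.IH) auto
  qed
qed

lemma Ck_on_Pair:
  assumes "open S" "Ck_on k f S" "Ck_on k g S"
  shows "Ck_on k (\<lambda>x. (f x, g x)) S"
proof -
  have "Ck_on k (\<lambda>x. (f x, 0) + (0, g x)) S"
    using bounded_linear.Ck_on[OF bounded_linear_Pair[OF bounded_linear_ident bounded_linear_zero] assms(1,2)]
      bounded_linear.Ck_on[OF bounded_linear_Pair[OF bounded_linear_zero bounded_linear_ident] assms(1,3)]
    by (intro Ck_on_add[OF assms(1)])
  then show ?thesis by simp
qed

lemma Ck_on_vec_lambda:
  fixes f :: "'a::euclidean_space \<Rightarrow> 'i::finite \<Rightarrow> real"
  assumes "open S" "\<And>i. Ck_on k (\<lambda>x. f x i) S"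
  shows "Ck_on k (\<lambda>x. \<chi> i. f x i) S"
proof -
  have "(\<chi> i. f x i) = (\<Sum>i\<in>UNIV. f x i *\<^sub>R axis i 1)" for x
    by (simp add: vec_eq_iff axis_def if_distrib cong: if_cong)
  moreover have "Ck_on k (\<lambda>x. \<Sum>i\<in>UNIV. f x i *\<^sub>R axis i (1::real)) S"
    by (intro Ck_on_sum Ck_on_scaleR Ck_on_const assms)
  ultimately show ?thesis by simp
qed

lemma C1_on_inverse:
  fixes f :: "'a::euclidean_space \<Rightarrow> real"
  assumes "open S" "Ck_on 1 f S" "\<And>x. x \<in> S \<Longrightarrow> f x \<noteq> 0"
  shows "Ck_on 1 (\<lambda>x. inverse (f x)) S"
  using assms(2,3) unfolding One_nat_def
  by (intro Ck_on_SucI[OF assms(1), where f' = "\<lambda>x h. - (inverse (f x) * fderiv f x h * inverse (f x))"])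
    (auto intro!: continuous_intros has_derivative_inverse Ck_on_imp_continuous_on[OF assms(2)]
          simp: frechet_derivative_works[symmetric])

section \<open>Symmetry of second derivatives\<close>

text \<open>Used in both orders of the variables on shrinking squares, this gives the symmetry.\<close>

lemma mixed_difference_mean_value:
  fixes f fa fab :: "real \<Rightarrow> real \<Rightarrow> real"
  assumes h: "0 < h"
    and fa: "\<And>s t. \<bar>s\<bar> \<le> h \<Longrightarrow> \<bar>t\<bar> \<le> h \<Longrightarrow> ((\<lambda>s. f s t) has_real_derivative fa s t) (at s)"
    and fab: "\<And>s t. \<bar>s\<bar> \<le> h \<Longrightarrow> \<bar>t\<bar> \<le> h \<Longrightarrow> ((\<lambda>t. fa s t) has_real_derivative fab s t) (at t)"
  shows "\<exists>s t. \<bar>s\<bar> \<le> h \<and> \<bar>t\<bar> \<le> h \<and> f h h - f h 0 - f 0 h + f 0 0 = h * h * fab s t"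
proof -
  obtain s where s: "0 < s" "s < h"
      "(f h h - f h 0) - (f 0 h - f 0 0) = (h - 0) * (fa s h - fa s 0)"
    using MVT2[of 0 h "\<lambda>s. f s h - f s 0" "\<lambda>s. fa s h - fa s 0"] h
    by (force intro!: DERIV_diff fa)
  obtain t where t: "0 < t" "t < h" "fa s h - fa s 0 = (h - 0) * fab s t"
    using MVT2[of 0 h "fa s" "fab s"] h s by (force intro!: fab)
  show ?thesis
    using s t by (intro exI[of _ s] exI[of _ t]) (auto simp: algebra_simps)
qed

lemma has_real_derivative_along:
  assumes "f differentiable (at (x + s *\<^sub>R a))"
  shows "((\<lambda>s. f (x + s *\<^sub>R a)) has_real_derivative fderiv f (x + s *\<^sub>R a) a) (at s)"
proof -
  let ?f' = "fderiv f (x + s *\<^sub>R a)"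
  have f: "(f has_derivative ?f') (at (x + s *\<^sub>R a))"
    using assms frechet_derivative_works by blast
  interpret bounded_linear ?f' using f has_derivative_bounded_linear by blast
  have "((\<lambda>s. x + s *\<^sub>R a) has_derivative (\<lambda>r. r *\<^sub>R a)) (at s)"
    by (auto intro!: derivative_eq_intros)
  from has_derivative_compose[OF this f] show ?thesis
    unfolding has_field_derivative_def by (rule has_derivative_eq_rhs) (auto simp: scaleR)
qed

text \<open>The second difference over a parallelogram is symmetric in \<open>a\<close> and
  \<open>b\<close>. Each order of the variables turns it into \<open>h * h\<close> times one of the
  two mixed derivatives, taken at some point of the parallelogram; continuity at \<open>x\<close>
  then identifies both limits.\<close>

lemma frechet_derivative_symmetric_real:
  fixes f :: "'a::euclidean_space \<Rightarrow> real"
  assumes S: "open S" "x \<in> S" and f: "Ck_on 2 f S"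
  shows "fderiv (\<lambda>y. fderiv f y a) x b =
         fderiv (\<lambda>y. fderiv f y b) x a"
proof -
  let ?D = "\<lambda>f v y. fderiv f y v"
  let ?p = "\<lambda>s t. x + s *\<^sub>R a + t *\<^sub>R b"
  have f1: "Ck_on 1 (?D f v) S" for v
    by (rule C2_on_fderiv[OF S(1) f])
  have f2: "continuous_on S (?D (?D f v) v')" for v v'
    using Ck_on_frechet_derivative[OF S(1), of 0 "?D f v" v'] f1 by simp
  obtain r where r: "r > 0" "ball x r \<subseteq> S" using S openE by blast
  \<comment> \<open>This bound keeps every parallelogram with coefficients up to \<open>k\<close>
    inside \<open>ball x r\<close>; the summand 1 covers the case that \<open>a\<close> and
    \<open>b\<close> both vanish.\<close>
  define k where "k = r / (2 * (norm a + norm b + 1))"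
  have k: "k > 0" using r by (simp add: k_def add_nonneg_pos)
  have inS: "?p s t \<in> S" if "\<bar>s\<bar> \<le> k" "\<bar>t\<bar> \<le> k" for s t
  proof -
    have "norm (s *\<^sub>R a + t *\<^sub>R b) \<le> k * norm a + k * norm b"
      using that by (intro order.trans[OF norm_triangle_ineq] add_mono) (auto intro!: mult_right_mono)
    also have "\<dots> < k * (2 * (norm a + norm b + 1))"
      using k by (simp add: algebra_simps add_nonneg_pos add_pos_nonneg)
    also have "\<dots> = r" by (simp add: k_def add_nonneg_pos less_imp_neq[symmetric])
    finally have "norm (s *\<^sub>R a + t *\<^sub>R b) < r" .
    moreover have "dist x (?p s t) = norm (s *\<^sub>R a + t *\<^sub>R b)"
      by (metis add.assoc dist_add_cancel dist_0_norm add.right_neutral)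
    ultimately show ?thesis using r(2) by auto
  qed
  have diff: "\<exists>s t. \<bar>s\<bar> \<le> h \<and> \<bar>t\<bar> \<le> h \<and>
      f (x + h *\<^sub>R a + h *\<^sub>R b) - f (x + h *\<^sub>R a) - f (x + h *\<^sub>R b) + f x
      = h * h * ?D (?D f a) b (x + s *\<^sub>R a + t *\<^sub>R b)"
    if h: "0 < h" and inS: "\<And>s t. \<bar>s\<bar> \<le> h \<Longrightarrow> \<bar>t\<bar> \<le> h \<Longrightarrow> x + s *\<^sub>R a + t *\<^sub>R b \<in> S" for a b h
  proof -
    have "((\<lambda>s. f (x + s *\<^sub>R a + t *\<^sub>R b)) has_real_derivative ?D f a (x + s *\<^sub>R a + t *\<^sub>R b)) (at s)"
      "((\<lambda>t. ?D f a (x + s *\<^sub>R a + t *\<^sub>R b)) has_real_derivative ?D (?D f a) b (x + s *\<^sub>R a + t *\<^sub>R b)) (at t)"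
      if st: "\<bar>s\<bar> \<le> h" "\<bar>t\<bar> \<le> h" for s t
      using has_real_derivative_along[of f "x + t *\<^sub>R b" s a] Ck_on_differentiable[OF f _ inS[OF st]]
        has_real_derivative_along[of "?D f a" "x + s *\<^sub>R a" t b] Ck_on_differentiable[OF f1 _ inS[OF st]]
      by (simp_all add: algebra_simps)
    from mixed_difference_mean_value[OF h this] show ?thesis by simp
  qed
  have key: "\<exists>s t. \<bar>s\<bar> \<le> h \<and> \<bar>t\<bar> \<le> h \<and>
      f (?p h h) - f (?p h 0) - f (?p 0 h) + f (?p 0 0) = h * h * ?D (?D f a) b (?p s t)"
    "\<exists>s t. \<bar>s\<bar> \<le> h \<and> \<bar>t\<bar> \<le> h \<and>
      f (?p h h) - f (?p h 0) - f (?p 0 h) + f (?p 0 0) = h * h * ?D (?D f b) a (?p s t)"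
    if h: "0 < h" "h \<le> k" for h
  proof -
    show "\<exists>s t. \<bar>s\<bar> \<le> h \<and> \<bar>t\<bar> \<le> h \<and>
      f (?p h h) - f (?p h 0) - f (?p 0 h) + f (?p 0 0) = h * h * ?D (?D f a) b (?p s t)"
      using diff[OF h(1), of a b] inS h(2) by simp
    have "x + s *\<^sub>R b + t *\<^sub>R a \<in> S" if "\<bar>s\<bar> \<le> h" "\<bar>t\<bar> \<le> h" for s t
      using inS[of t s] that h(2) by (simp add: ac_simps)
    from diff[OF h(1) this] obtain t s where "\<bar>t\<bar> \<le> h" "\<bar>s\<bar> \<le> h"
      "f (x + h *\<^sub>R b + h *\<^sub>R a) - f (x + h *\<^sub>R b) - f (x + h *\<^sub>R a) + f x
        = h * h * ?D (?D f b) a (x + t *\<^sub>R b + s *\<^sub>R a)"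
      by blast
    then show "\<exists>s t. \<bar>s\<bar> \<le> h \<and> \<bar>t\<bar> \<le> h \<and>
      f (?p h h) - f (?p h 0) - f (?p 0 h) + f (?p 0 0) = h * h * ?D (?D f b) a (?p s t)"
      by (intro exI[of _ s] exI[of _ t]) (simp add: ac_simps)
  qed
  define h where "h n = k / real (Suc n)" for n
  have h: "0 < h n" "h n \<le> k" for n
    using k by (auto simp: h_def field_simps)
  have h0: "h \<longlonglongrightarrow> 0"
    unfolding h_def by (rule LIMSEQ_Suc[OF lim_const_over_n])
  obtain s t where st: "\<And>n. \<bar>s n\<bar> \<le> h n" "\<And>n. \<bar>t n\<bar> \<le> h n"
     "\<And>n. f (?p (h n) (h n)) - f (?p (h n) 0) - f (?p 0 (h n)) + f (?p 0 0)
         = h n * h n * ?D (?D f a) b (?p (s n) (t n))"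
    using key(1)[OF h] by metis
  obtain s' t' where st': "\<And>n. \<bar>s' n\<bar> \<le> h n" "\<And>n. \<bar>t' n\<bar> \<le> h n"
     "\<And>n. f (?p (h n) (h n)) - f (?p (h n) 0) - f (?p 0 (h n)) + f (?p 0 0)
         = h n * h n * ?D (?D f b) a (?p (s' n) (t' n))"
    using key(2)[OF h] by metis
  have lim: "(\<lambda>n. ?D (?D f v) v' (?p (s n) (t n))) \<longlonglongrightarrow> ?D (?D f v) v' x"
    if "\<And>n. \<bar>s n\<bar> \<le> h n" "\<And>n. \<bar>t n\<bar> \<le> h n" for s t v v'
  proof -
    have "s \<longlonglongrightarrow> 0" "t \<longlonglongrightarrow> 0"
      using that h0 by (auto intro!: Lim_null_comparison[OF _ h0])
    then have "(\<lambda>n. ?p (s n) (t n)) \<longlonglongrightarrow> x + 0 *\<^sub>R a + 0 *\<^sub>R b"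
      by (intro tendsto_intros)
    moreover have "isCont (?D (?D f v) v') x"
      using f2 S continuous_on_eq_continuous_at by blast
    ultimately show ?thesis using isCont_tendsto_compose by force
  qed
  have "?D (?D f a) b (?p (s n) (t n)) = ?D (?D f b) a (?p (s' n) (t' n))" for n
  proof -
    have "h n * h n * ?D (?D f a) b (?p (s n) (t n)) = h n * h n * ?D (?D f b) a (?p (s' n) (t' n))"
      using st(3) st'(3) by metis
    then show ?thesis using h(1)[of n] by simp
  qed
  with lim[OF st(1,2), of a b] lim[OF st'(1,2), of b a] show ?thesis
    by (metis (no_types, lifting) LIMSEQ_unique ext)
qed

lemma frechet_derivative_nth:
  fixes f :: "'a::real_normed_vector \<Rightarrow> real^'n"
  assumes "f differentiable (at x)"
  shows "fderiv (\<lambda>y. f y $ i) x v = fderiv f x v $ i"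
proof -
  have "(f has_derivative fderiv f x) (at x)"
    using assms frechet_derivative_works by blast
  then have "((\<lambda>y. f y $ i) has_derivative (\<lambda>v. fderiv f x v $ i)) (at x)"
    by (rule bounded_linear.has_derivative[OF bounded_linear_vec_nth])
  then show ?thesis by (metis frechet_derivative_at)
qed

lemma frechet_derivative_symmetric:
  fixes f :: "'a::euclidean_space \<Rightarrow> real^'n"
  assumes S: "open S" "x \<in> S" and f: "Ck_on 2 f S"
  shows "fderiv (\<lambda>y. fderiv f y a) x b =
         fderiv (\<lambda>y. fderiv f y b) x a"
proof -
  have f1: "Ck_on 1 (\<lambda>y. fderiv f y v) S" for v
    by (rule C2_on_fderiv[OF S(1) f])
  have "fderiv (\<lambda>y. fderiv f y v) x v' $ i =
     fderiv (\<lambda>y. fderiv (\<lambda>y. f y $ i) y v) x v'" for v v' i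
  proof -
    have "fderiv (\<lambda>y. fderiv f y v) x v' $ i =
      fderiv (\<lambda>y. fderiv f y v $ i) x v'"
      using Ck_on_differentiable[OF f1 _ S(2)] by (simp add: frechet_derivative_nth)
    also have "\<dots> = fderiv (\<lambda>y. fderiv (\<lambda>y. f y $ i) y v) x v'"
      using Ck_on_differentiable[OF f]
      by (subst frechet_derivative_cong_open[OF S]) (auto simp: frechet_derivative_nth)
    finally show ?thesis .
  qed
  then show ?thesis
    using frechet_derivative_symmetric_real[OF S Ck_on_nth[OF S(1) f]] by (simp add: vec_eq_iff)
qed

section \<open>The divergence theorem for tangent fields\<close>

text \<open>The difference quotients of \<open>k\<close> in direction \<open>e\<close> have integral
  zero by translation invariance. They are dominated and converge to \<open>k' x e\<close>, so the
  limit has integral zero too. This is the only integration by parts in the proof.\<close>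

lemma integral_directional_derivative_eq_0:
  fixes k :: "'a::euclidean_space \<Rightarrow> real"
  assumes deriv: "\<And>x. (k has_derivative k' x) (at x)"
    and cont: "continuous_on UNIV (\<lambda>x. k' x e)"
    and K: "compact K" "\<And>x. x \<notin> K \<Longrightarrow> k x = 0"
  shows "integrable lborel (\<lambda>x. k' x e)" "(LINT x|lborel. k' x e) = 0"
proof -
  have k'0: "k' x e = 0" if "x \<notin> K" for x
  proof -
    have "((\<lambda>x. 0) has_derivative k' x) (at x)"
      by (rule has_derivative_transform_within_open[OF deriv, where s = "- K"])
        (use that K(2) compact_imp_closed[OF K(1)] in auto)
    then have "k' x = (\<lambda>h. 0)"
      using has_derivative_unique has_derivative_const by blast
    then show ?thesis by simp
  qed
  have contk: "continuous_on UNIV k"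
    by (intro continuous_at_imp_continuous_on ballI has_derivative_continuous[OF deriv])
  have int: "integrable lborel f" if "continuous_on UNIV f" "\<And>x. x \<notin> K \<Longrightarrow> f x = 0" for f :: "'a \<Rightarrow> real"
  proof -
    have "(\<lambda>x. indicator K x *\<^sub>R f x) = f"
      using that by (auto simp: indicator_def fun_eq_iff)
    then show ?thesis
      using borel_integrable_compact[OF K(1) continuous_on_subset[OF that(1) subset_UNIV]] by simp
  qed
  show "integrable lborel (\<lambda>x. k' x e)"
    using int[OF cont k'0] .
  have intk: "integrable lborel k" using int[OF contk K(2)] .
  \<comment> \<open>Steps of length at most 1 keep the supports of all quotients in the one ball of
    radius \<open>R + norm e\<close>, which carries the dominating function.\<close>
  define q where "q n x = (k (x + (1 / Suc n) *\<^sub>R e) - k x) * Suc n" for n x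
  have "bounded ((\<lambda>x. k' x e) ` K)"
    by (rule compact_imp_bounded compact_continuous_image continuous_on_subset[OF cont] K subset_UNIV)+
  then obtain M where M: "\<And>x. x \<in> K \<Longrightarrow> \<bar>k' x e\<bar> \<le> M" "M > 0"
    unfolding bounded_pos by (auto simp: real_norm_def)
  have M: "\<bar>k' x e\<bar> \<le> M" for x
    using M k'0[of x] by (cases "x \<in> K") auto
  obtain R where R: "\<And>x. x \<in> K \<Longrightarrow> norm x \<le> R"
    using compact_imp_bounded[OF K(1)] unfolding bounded_iff by blast
  have line: "((\<lambda>s. k (x + s *\<^sub>R e)) has_real_derivative k' (x + s *\<^sub>R e) e) (at s)" for x s
    using has_real_derivative_along[of k x s e] deriv[of "x + s *\<^sub>R e"]
      frechet_derivative_at[OF deriv[of "x + s *\<^sub>R e"]]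
    by (simp add: differentiableI)
  have q_bound: "norm (q n x) \<le> M * indicator (cball 0 (R + norm e)) x" for n x
  proof (cases "x \<in> cball 0 (R + norm e)")
    case True
    obtain z where z: "k (x + (1 / Suc n) *\<^sub>R e) - k (x + 0 *\<^sub>R e) = (1 / Suc n - 0) * k' (x + z *\<^sub>R e) e"
      using MVT2[of 0 "1 / Suc n" "\<lambda>s. k (x + s *\<^sub>R e)" "\<lambda>s. k' (x + s *\<^sub>R e) e"] line by auto
    then have "q n x = k' (x + z *\<^sub>R e) e"
      unfolding q_def by simp
    with M True show ?thesis by simp
  next
    case False
    have "norm (x + (1 / Suc n) *\<^sub>R e) > R"
    proof -
      have "norm x \<le> norm (x + (1 / Suc n) *\<^sub>R e) + norm ((1 / Suc n) *\<^sub>R e)"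
        by (metis add_diff_cancel_right' norm_triangle_ineq4)
      moreover have "norm ((1 / Suc n) *\<^sub>R e) \<le> norm e"
        by (simp add: divide_le_eq mult_left_le_one_le mult_le_cancel_left1)
      ultimately show ?thesis using False by simp
    qed
    moreover have "norm x > R"
    proof -
      have "norm x > R + norm e" using False by simp
      then show ?thesis using norm_ge_zero[of e] by linarith
    qed
    ultimately have "k (x + (1 / Suc n) *\<^sub>R e) = 0" "k x = 0"
      using R K(2) by (meson not_le)+
    with False show ?thesis by (simp add: q_def)
  qed
  have q_lim: "(\<lambda>n. q n x) \<longlonglongrightarrow> k' x e" for x
  proof -
    have "((\<lambda>h. (k (x + h *\<^sub>R e) - k x) / h) \<longlongrightarrow> k' x e) (at 0)"
      using line[of x 0] by (simp add: DERIV_def)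
    moreover have "filterlim (\<lambda>n. 1 / real (Suc n)) (at 0) sequentially"
      using LIMSEQ_Suc[OF lim_const_over_n[of 1]] by (simp add: filterlim_at)
    ultimately have "(\<lambda>n. (k (x + (1 / Suc n) *\<^sub>R e) - k x) / (1 / Suc n)) \<longlonglongrightarrow> k' x e"
      by (rule filterlim_compose)
    then show ?thesis by (simp add: q_def)
  qed
  \<comment> \<open>Lebesgue measure is invariant under the shift by \<open>?c\<close>, so the
    shifted and the unshifted integral of \<open>k\<close> cancel.\<close>
  have intq: "integral\<^sup>L lborel (q n) = 0" for n
  proof -
    let ?c = "(1 / Suc n) *\<^sub>R e"
    have [measurable]: "k \<in> borel_measurable borel"
      by (rule borel_measurable_continuous_onI[OF contk])
    have "integral\<^sup>L lborel k = integral\<^sup>L (distr lborel borel ((+) ?c)) k"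
      by (simp only: lborel_distr_plus)
    also have "\<dots> = (LINT x|lborel. k (?c + x))"
      by (subst integral_distr) auto
    finally have eq: "(LINT x|lborel. k (x + ?c)) = integral\<^sup>L lborel k"
      by (simp add: add.commute)
    have "integrable (distr lborel borel ((+) ?c)) k"
      using intk by (simp only: lborel_distr_plus)
    then have "integrable lborel (\<lambda>x. k (?c + x))"
      by (subst (asm) integrable_distr_eq) auto
    then have "integrable lborel (\<lambda>x. k (x + ?c))"
      by (simp add: add.commute)
    with eq intk show ?thesis by (simp add: q_def[abs_def])
  qed
  have "(\<lambda>n. integral\<^sup>L lborel (q n)) \<longlonglongrightarrow> (LINT x|lborel. k' x e)"
  proof (rule integral_dominated_convergence[where w = "\<lambda>x. M * indicator (cball 0 (R + norm e)) x"])
    show "(\<lambda>x. k' x e) \<in> borel_measurable lborel"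
      using borel_measurable_continuous_onI[OF cont] by simp
    have "continuous_on UNIV (q n)" for n
      unfolding q_def by (intro continuous_intros continuous_on_compose2[OF contk]) auto
    then show "q n \<in> borel_measurable lborel" for n
      using borel_measurable_continuous_onI by fastforce
    show "integrable lborel (\<lambda>x. M * indicator (cball 0 (R + norm e)) x :: real)"
      by (intro integrable_mult_right integrable_real_indicator emeasure_bounded_finite) auto
  qed (use q_lim q_bound in auto)
  then show "(LINT x|lborel. k' x e) = 0"
    by (simp add: intq LIMSEQ_const_iff)
qed

section \<open>A C1 step function on the line\<close>

lemma has_real_derivative_0_quadratic:
  fixes f :: "real \<Rightarrow> real"
  assumes "\<And>y. \<bar>f y - f x\<bar> \<le> C * (y - x)\<^sup>2"
  shows "(f has_real_derivative 0) (at x)"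
proof -
  have "((\<lambda>h. (f (x + h) - f x) / h) \<longlongrightarrow> 0) (at 0)"
  proof (rule Lim_null_comparison)
    have "norm ((f (x + h) - f x) / h) \<le> C * \<bar>h\<bar>" if "h \<noteq> 0" for h
      using assms[of "x + h"] that by (simp add: divide_le_eq power2_eq_square mult.assoc)
    then show "\<forall>\<^sub>F h in at 0. norm ((f (x + h) - f x) / h) \<le> C * \<bar>h\<bar>"
      by (simp add: eventually_at_filter)
    show "((\<lambda>h. C * \<bar>h\<bar>) \<longlongrightarrow> 0) (at 0)"
      by (auto intro!: tendsto_eq_intros)
  qed
  then show ?thesis by (simp add: DERIV_def)
qed

text \<open>The Hermite cubic \<open>3 m^2 - 2 m^3\<close> of the argument clamped to the unit
  interval. Its derivative \<open>6 m (1 - m)\<close> vanishes at both ends, which makes the clamped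
  function C1; cutoffs need no more.\<close>

definition smoothstep :: "real \<Rightarrow> real" where
  "smoothstep s = (let m = max 0 (min 1 s) in m\<^sup>2 * (3 - 2 * m))"

definition smoothstep' :: "real \<Rightarrow> real" where
  "smoothstep' s = (let m = max 0 (min 1 s) in 6 * m * (1 - m))"

lemma smoothstep_le_0 [simp]: "s \<le> 0 \<Longrightarrow> smoothstep s = 0" "s \<le> 0 \<Longrightarrow> smoothstep' s = 0"
  and smoothstep_ge_1 [simp]: "1 \<le> s \<Longrightarrow> smoothstep s = 1" "1 \<le> s \<Longrightarrow> smoothstep' s = 0"
  by (simp_all add: smoothstep_def smoothstep'_def)

lemma smoothstep_unit: "0 \<le> s \<Longrightarrow> s \<le> 1 \<Longrightarrow> smoothstep s = s\<^sup>2 * (3 - 2 * s)"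
  by (simp add: smoothstep_def Let_def)

lemma one_minus_smoothstep: "0 \<le> s \<Longrightarrow> s \<le> 1 \<Longrightarrow> 1 - smoothstep s = (1 - s)\<^sup>2 * (1 + 2 * s)"
  by (simp add: smoothstep_unit algebra_simps power2_eq_square)

lemma smoothstep_bounds: "0 \<le> smoothstep s" "smoothstep s \<le> 1" "0 \<le> smoothstep' s" "smoothstep' s \<le> 2"
proof -
  consider "s \<le> 0" | "0 \<le> s" "s \<le> 1" | "1 \<le> s" by linarith
  note c = this
  show "0 \<le> smoothstep s"
    by (rule c) (auto simp: smoothstep_unit)
  have "0 \<le> 1 - smoothstep s"
    by (rule c) (auto simp: one_minus_smoothstep simp del: diff_ge_0_iff_ge)
  then show "smoothstep s \<le> 1" by simp
  show "0 \<le> smoothstep' s" by (simp add: smoothstep'_def Let_def)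
  define m where "m = max 0 (min 1 s)"
  \<comment> \<open>Completing the square, \<open>6 m (1 - m)\<close> is
    \<open>3/2 - 6 (m - 1/2)^2\<close>; the bound 2 is a rounded value of the maximum
    \<open>3/2\<close>.\<close>
  have "0 \<le> (m - 1/2)\<^sup>2" by simp
  then have "6 * m * (1 - m) \<le> 2" by (simp add: power2_eq_square algebra_simps)
  then show "smoothstep' s \<le> 2" by (simp add: smoothstep'_def Let_def m_def)
qed

lemma continuous_on_smoothstep' [continuous_intros]:
  "continuous_on S f \<Longrightarrow> continuous_on S (\<lambda>x. smoothstep' (f x))"
  unfolding smoothstep'_def Let_def by (intro continuous_intros)

lemma continuous_on_smoothstep [continuous_intros]:
  "continuous_on S f \<Longrightarrow> continuous_on S (\<lambda>x. smoothstep (f x))"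
  unfolding smoothstep_def Let_def by (intro continuous_intros)

lemma DERIV_smoothstep: "(smoothstep has_real_derivative smoothstep' s) (at s)"
proof -
  consider "s < 0" | "s = 0" | "0 < s" "s < 1" | "s = 1" | "1 < s" by linarith
  then show ?thesis
  proof cases
    case 1
    have "(smoothstep has_real_derivative 0) (at s)"
      by (rule DERIV_cong_ev[THEN iffD2, OF refl _ refl DERIV_const[of 0]])
        (use 1 in \<open>auto simp: eventually_nhds intro!: exI[of _ "{..<0}"]\<close>)
    with 1 show ?thesis by simp
  next
    case 2
    \<comment> \<open>At the two joints a quadratic bound on both sides yields derivative zero
      without one-sided derivatives.\<close>
    have "\<bar>smoothstep y - smoothstep 0\<bar> \<le> 3 * (y - 0)\<^sup>2" for y
    proof -
      define m where "m = max 0 (min 1 y)"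
      have "m\<^sup>2 * (3 - 2 * m) \<le> m\<^sup>2 * 3"
        by (intro mult_left_mono) (auto simp: m_def)
      also have "\<dots> \<le> y\<^sup>2 * 3"
        by (intro mult_right_mono) (auto simp: m_def abs_le_square_iff[symmetric])
      finally show ?thesis
        using smoothstep_bounds(1)[of y] by (simp add: smoothstep_def Let_def m_def)
    qed
    with has_real_derivative_0_quadratic 2 show ?thesis by fastforce
  next
    case 3
    have "((\<lambda>s. s\<^sup>2 * (3 - 2 * s)) has_real_derivative 6 * s * (1 - s)) (at s)"
      by (auto intro!: derivative_eq_intros simp: algebra_simps power2_eq_square)
    then have "(smoothstep has_real_derivative 6 * s * (1 - s)) (at s)"
      by (rule has_field_derivative_transform_within_open[where S = "{0<..<1}"])
        (use 3 in \<open>auto simp: smoothstep_unit\<close>)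
    with 3 show ?thesis by (simp add: smoothstep'_def Let_def)
  next
    case 4
    have "\<bar>smoothstep y - smoothstep 1\<bar> \<le> 3 * (y - 1)\<^sup>2" for y
    proof -
      define m where "m = max 0 (min 1 y)"
      have m: "0 \<le> m" "m \<le> 1" by (auto simp: m_def)
      have "smoothstep y = smoothstep m" using m by (simp add: smoothstep_def m_def Let_def)
      then have "\<bar>smoothstep y - smoothstep 1\<bar> = (1 - m)\<^sup>2 * (1 + 2 * m)"
        using one_minus_smoothstep[OF m] smoothstep_bounds(2)[of m] by simp
      also have "\<dots> \<le> (1 - m)\<^sup>2 * 3"
        by (intro mult_left_mono) (use m in auto)
      also have "\<dots> \<le> (y - 1)\<^sup>2 * 3"
        by (intro mult_right_mono) (auto simp: m_def abs_le_square_iff[symmetric])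
      finally show ?thesis by simp
    qed
    with has_real_derivative_0_quadratic 4 show ?thesis by fastforce
  next
    case 5
    have "(smoothstep has_real_derivative 0) (at s)"
      by (rule DERIV_cong_ev[THEN iffD2, OF refl _ refl DERIV_const[of 1]])
        (use 5 in \<open>auto simp: eventually_nhds intro!: exI[of _ "{1<..}"]\<close>)
    with 5 show ?thesis by simp
  qed
qed

lemma has_derivative_smoothstep:
  assumes "(f has_derivative (\<lambda>h. f' \<bullet> h)) (at x)"
  shows "((\<lambda>x. smoothstep (f x)) has_derivative (\<lambda>h. (smoothstep' (f x) *\<^sub>R f') \<bullet> h)) (at x)"
  using has_derivative_compose[OF assms DERIV_smoothstep[unfolded has_field_derivative_def]] by simp

text \<open>A \<open>C\<^sup>1\<close> function on \<open>D\<close> that vanishes on \<open>D \<inter> A\<close>, whose derivative along \<open>f\<close> and whose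
  distance from \<open>1\<close> are small in the mean. Testing with such functions for \<open>A\<close> a neighbourhood
  of the boundary replaces the boundary integral.\<close>

definition cutoff :: "(real^3) set \<Rightarrow> (real^3 \<Rightarrow> real^3) \<Rightarrow> (real^3) set \<Rightarrow> ennreal \<Rightarrow> bool" where
  "cutoff D f A c \<longleftrightarrow>
     (\<exists>k G. (\<forall>x\<in>D. (k has_derivative (\<lambda>h. G x \<bullet> h)) (at x) \<and> 0 \<le> k x \<and> k x \<le> 1) \<and>
        continuous_on D G \<and> (\<forall>x\<in>D \<inter> A. k x = 0) \<and>
        (\<integral>\<^sup>+x\<in>D. ennreal (\<bar>G x \<bullet> f x\<bar> + (1 - k x)) \<partial>lborel) \<le> c)"

lemma cutoffI:
  assumes "\<And>x. x \<in> D \<Longrightarrow> (k has_derivative (\<lambda>h. G x \<bullet> h)) (at x)"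
    and "\<And>x. x \<in> D \<Longrightarrow> 0 \<le> k x" "\<And>x. x \<in> D \<Longrightarrow> k x \<le> 1" "continuous_on D G"
    and "\<And>x. x \<in> D \<Longrightarrow> x \<in> A \<Longrightarrow> k x = 0"
    and "(\<integral>\<^sup>+x\<in>D. ennreal (\<bar>G x \<bullet> f x\<bar> + (1 - k x)) \<partial>lborel) \<le> c"
  shows "cutoff D f A c"
  unfolding cutoff_def using assms by (intro exI[of _ k] exI[of _ G]) blast

section \<open>Combination of cutoffs, and cutoffs near the singular part of the boundary\<close>

lemma cutoff_cost_le:
  assumes bound: "\<And>x. x \<in> D \<Longrightarrow> c x \<le> K * indicator S x" and S: "S \<in> sets lborel"
  shows "(\<integral>\<^sup>+x\<in>D. ennreal (c x) \<partial>lborel) \<le> ennreal K * emeasure lborel S"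
proof -
  have "ennreal (c x) * indicator D x \<le> ennreal K * indicator S x" for x
    using ennreal_leI[OF bound, of x] by (auto simp: indicator_def split: if_splits)
  then have "(\<integral>\<^sup>+x\<in>D. ennreal (c x) \<partial>lborel) \<le> (\<integral>\<^sup>+x. ennreal K * indicator S x \<partial>lborel)"
    by (intro nn_integral_mono)
  also have "\<dots> = ennreal K * emeasure lborel S" by (rule nn_integral_cmult_indicator[OF S])
  finally show ?thesis .
qed

lemma cutoff_mono: "cutoff D f A c \<Longrightarrow> A' \<subseteq> A \<Longrightarrow> c \<le> c' \<Longrightarrow> cutoff D f A' c'"
  unfolding cutoff_def by (elim exE) (intro exI, fastforce intro: order.trans)

lemma cutoff_empty: "cutoff D f {} 0"
  unfolding cutoff_def
  by (intro exI[of _ "\<lambda>x. 1::real"] exI[of _ "\<lambda>x. 0::real^3"])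
    (auto intro!: has_derivative_eq_rhs[OF has_derivative_const] simp: fun_eq_iff)

lemma borel_measurable_indicator_times:
  assumes "open D" "continuous_on D h"
  shows "(\<lambda>x. ennreal (h x) * indicator D x) \<in> borel_measurable lborel"
proof -
  have "(\<lambda>x. indicator D x *\<^sub>R h x) \<in> borel_measurable borel"
    using assms by (intro borel_measurable_continuous_on_indicator) auto
  then have "(\<lambda>x. ennreal (indicator D x *\<^sub>R h x)) \<in> borel_measurable lborel"
    by simp
  also have "(\<lambda>x. ennreal (indicator D x *\<^sub>R h x)) = (\<lambda>x. ennreal (h x) * indicator D x)"
    by (auto simp: indicator_def)
  finally show ?thesis .
qed

text \<open>The product \<open>k1 * k2\<close> vanishes where either factor does. Its cost is at
  most the sum of the costs: in the product rule each gradient is multiplied by a factor at most 1,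
  and \<open>1 - k1 * k2\<close> differs from \<open>(1 - k1) + (1 - k2)\<close> by the nonnegative
  amount \<open>(1 - k1) * (1 - k2)\<close>.\<close>

lemma cutoff_Un:
  assumes D: "open D" and f: "continuous_on D f"
    and 1: "cutoff D f A1 c1" and 2: "cutoff D f A2 c2"
  shows "cutoff D f (A1 \<union> A2) (c1 + c2)"
proof -
  obtain k1 G1 where 1: "\<And>x. x \<in> D \<Longrightarrow> (k1 has_derivative (\<lambda>h. G1 x \<bullet> h)) (at x)"
      "\<And>x. x \<in> D \<Longrightarrow> 0 \<le> k1 x" "\<And>x. x \<in> D \<Longrightarrow> k1 x \<le> 1" "continuous_on D G1"
      "\<And>x. x \<in> D \<Longrightarrow> x \<in> A1 \<Longrightarrow> k1 x = 0"
      "(\<integral>\<^sup>+x\<in>D. ennreal (\<bar>G1 x \<bullet> f x\<bar> + (1 - k1 x)) \<partial>lborel) \<le> c1"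
    using 1 unfolding cutoff_def by auto
  obtain k2 G2 where 2: "\<And>x. x \<in> D \<Longrightarrow> (k2 has_derivative (\<lambda>h. G2 x \<bullet> h)) (at x)"
      "\<And>x. x \<in> D \<Longrightarrow> 0 \<le> k2 x" "\<And>x. x \<in> D \<Longrightarrow> k2 x \<le> 1" "continuous_on D G2"
      "\<And>x. x \<in> D \<Longrightarrow> x \<in> A2 \<Longrightarrow> k2 x = 0"
      "(\<integral>\<^sup>+x\<in>D. ennreal (\<bar>G2 x \<bullet> f x\<bar> + (1 - k2 x)) \<partial>lborel) \<le> c2"
    using 2 unfolding cutoff_def by auto
  have c1: "continuous_on D k1" and c2: "continuous_on D k2"
    by (auto intro!: continuous_at_imp_continuous_on has_derivative_continuous[OF 1(1)]
        has_derivative_continuous[OF 2(1)])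
  let ?G = "\<lambda>x. k1 x *\<^sub>R G2 x + k2 x *\<^sub>R G1 x"
  have d: "((\<lambda>x. k1 x * k2 x) has_derivative (\<lambda>h. ?G x \<bullet> h)) (at x)" if "x \<in> D" for x
    by (rule has_derivative_eq_rhs[OF has_derivative_mult[OF 1(1)[OF that] 2(1)[OF that]]])
      (simp add: fun_eq_iff algebra_simps inner_add_left)
  have le: "\<bar>?G x \<bullet> f x\<bar> + (1 - k1 x * k2 x)
      \<le> (\<bar>G1 x \<bullet> f x\<bar> + (1 - k1 x)) + (\<bar>G2 x \<bullet> f x\<bar> + (1 - k2 x))" if x: "x \<in> D" for x
  proof -
    have "\<bar>?G x \<bullet> f x\<bar> \<le> k1 x * \<bar>G2 x \<bullet> f x\<bar> + k2 x * \<bar>G1 x \<bullet> f x\<bar>"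
      using 1(2)[OF x] 2(2)[OF x] by (simp add: inner_add_left abs_mult order.trans[OF abs_triangle_ineq])
    also have "\<dots> \<le> 1 * \<bar>G2 x \<bullet> f x\<bar> + 1 * \<bar>G1 x \<bullet> f x\<bar>"
      using 1(3)[OF x] 2(3)[OF x] by (intro add_mono mult_right_mono) auto
    moreover have "0 \<le> (1 - k1 x) * (1 - k2 x)"
      using 1(3)[OF x] 2(3)[OF x] by simp
    ultimately show ?thesis by (simp add: algebra_simps)
  qed
  let ?k1 = "\<lambda>x. \<bar>G1 x \<bullet> f x\<bar> + (1 - k1 x)" and ?k2 = "\<lambda>x. \<bar>G2 x \<bullet> f x\<bar> + (1 - k2 x)"
  have "(\<integral>\<^sup>+x\<in>D. ennreal (\<bar>?G x \<bullet> f x\<bar> + (1 - k1 x * k2 x)) \<partial>lborel)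
      \<le> (\<integral>\<^sup>+x. ennreal (?k1 x) * indicator D x + ennreal (?k2 x) * indicator D x \<partial>lborel)"
  proof (intro nn_integral_mono)
    fix x
    show "ennreal (\<bar>?G x \<bullet> f x\<bar> + (1 - k1 x * k2 x)) * indicator D x
        \<le> ennreal (?k1 x) * indicator D x + ennreal (?k2 x) * indicator D x"
    proof (cases "x \<in> D")
      case True
      with 1(3) 2(3) have "0 \<le> ?k1 x" "0 \<le> ?k2 x" by (simp_all add: add_nonneg_nonneg)
      then show ?thesis using le[OF True] True
        by (simp add: ennreal_plus[symmetric] ennreal_leI del: ennreal_plus)
    qed simp
  qed
  also have "\<dots> = (\<integral>\<^sup>+x\<in>D. ennreal (?k1 x) \<partial>lborel) + (\<integral>\<^sup>+x\<in>D. ennreal (?k2 x) \<partial>lborel)"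
    by (intro nn_integral_add borel_measurable_indicator_times[OF D] continuous_intros 1(4) 2(4) f c1 c2)
  also have "\<dots> \<le> c1 + c2"
    by (intro add_mono 1(6) 2(6))
  finally have "(\<integral>\<^sup>+x\<in>D. ennreal (\<bar>?G x \<bullet> f x\<bar> + (1 - k1 x * k2 x)) \<partial>lborel) \<le> c1 + c2" .
  moreover have "continuous_on D ?G"
    by (intro continuous_intros c1 c2 1(4) 2(4))
  ultimately show ?thesis
    unfolding cutoff_def
    by (intro exI[of _ "\<lambda>x. k1 x * k2 x"] exI[of _ ?G])
      (use d 1(2,3,5) 2(2,3,5) in \<open>auto intro: mult_le_one\<close>)
qed

lemma cutoff_UN:
  assumes "open D" "continuous_on D f" "finite C" "\<And>i. i \<in> C \<Longrightarrow> cutoff D f (A i) (c i)"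
  shows "cutoff D f (\<Union>i\<in>C. A i) (\<Sum>i\<in>C. c i)"
  using assms(3,4)
  by (induction C rule: finite_induct) (auto intro: cutoff_empty cutoff_Un assms(1,2))

text \<open>The argument fed to \<open>smoothstep\<close> in radial cutoffs. It is at most 0 on
  \<open>ball p r\<close> and at least 1 off \<open>ball p (2 * r)\<close>; squaring the norm keeps
  it differentiable at the centre.\<close>

lemma has_derivative_scaled_square_norm:
  fixes p :: "'a::real_inner"
  shows "((\<lambda>x. (norm (x - p))\<^sup>2 / r\<^sup>2 - 1) has_derivative (\<lambda>h. ((2 / r\<^sup>2) *\<^sub>R (x - p)) \<bullet> h)) (at x)"
proof -
  have "((\<lambda>x. c * ((x - p) \<bullet> (x - p)) - 1) has_derivative
      (\<lambda>h. c * ((x - p) \<bullet> h + h \<bullet> (x - p)))) (at x)" for c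
    by (auto intro!: derivative_eq_intros)
  from this[of "1 / r\<^sup>2"] show ?thesis
    by (simp add: power2_norm_eq_inner inner_commute)
qed

lemma square_norm_diff_ball:
  fixes x :: "'a::real_normed_vector"
  assumes "0 < r"
  shows "x \<in> ball p r \<Longrightarrow> (norm (x - p))\<^sup>2 / r\<^sup>2 - 1 \<le> 0"
    and "x \<notin> ball p (2 * r) \<Longrightarrow> 4 * r\<^sup>2 \<le> (norm (x - p))\<^sup>2"
proof -
  assume "x \<in> ball p r"
  then have "(norm (x - p))\<^sup>2 \<le> r\<^sup>2"
    using assms by (intro power_mono) (auto simp: dist_norm norm_minus_commute)
  then show "(norm (x - p))\<^sup>2 / r\<^sup>2 - 1 \<le> 0" using assms by simp
next
  assume "x \<notin> ball p (2 * r)"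
  then have "(2 * r)\<^sup>2 \<le> (norm (x - p))\<^sup>2"
    using assms by (intro power_mono) (auto simp: dist_norm norm_minus_commute)
  then show "4 * r\<^sup>2 \<le> (norm (x - p))\<^sup>2" by (simp add: power_mult_distrib)
qed

lemma smoothstep_gradient_bound:
  fixes x :: "'a::real_inner"
  assumes "x \<in> ball p (2 * r)" "0 < r" "norm v \<le> M" "0 \<le> M"
  shows "\<bar>(smoothstep' s *\<^sub>R (2 / r\<^sup>2) *\<^sub>R (x - p)) \<bullet> v\<bar> \<le> 8 * M / r"
proof -
  let ?G = "smoothstep' s *\<^sub>R (2 / r\<^sup>2) *\<^sub>R (x - p)"
  have "\<bar>?G \<bullet> v\<bar> \<le> norm ?G * norm v" by (rule Cauchy_Schwarz_ineq2)
  also have "norm ?G = smoothstep' s * ((2 / r\<^sup>2) * norm (x - p))"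
    using smoothstep_bounds(3) by simp
  also have "\<dots> * norm v \<le> (2 * ((2 / r\<^sup>2) * (2 * r))) * M"
    using assms smoothstep_bounds(3,4)
    by (intro mult_mono) (auto simp: dist_norm norm_minus_commute)
  also have "\<dots> = 8 * M / r" using assms(2) by (simp add: power2_eq_square field_simps)
  finally show ?thesis .
qed

text \<open>The gradient is at most \<open>8 * M / r\<close> along \<open>f\<close> and lives on a
  ball of volume \<open>8 * r ^ 3 * unit_ball_vol 3\<close>. The product is of order
  \<open>r\<^sup>2\<close>, and \<open>r \<le> 1\<close> absorbs the cubic contribution of
  \<open>1 - k\<close>.\<close>

lemma cutoff_ball:
  assumes M: "\<And>x. x \<in> D \<Longrightarrow> norm (f x) \<le> M" "0 \<le> M" and r: "0 < r" "r \<le> 1"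
  shows "cutoff D f (ball p r) (ennreal ((unit_ball_vol 3 * (64 * M + 8)) * r\<^sup>2))"
proof -
  let ?q = "\<lambda>x. (norm (x - p))\<^sup>2 / r\<^sup>2 - 1"
  let ?k = "\<lambda>x. smoothstep (?q x)"
  let ?G = "\<lambda>x. smoothstep' (?q x) *\<^sub>R (2 / r\<^sup>2) *\<^sub>R (x - p)"
  note q = has_derivative_scaled_square_norm[of p r]
  have d: "(?k has_derivative (\<lambda>h. ?G x \<bullet> h)) (at x)" for x
    using has_derivative_smoothstep[OF q] by simp
  have zero: "?k x = 0" if "x \<in> ball p r" for x
    using square_norm_diff_ball(1)[OF r(1) that] by simp
  have far: "1 \<le> ?q x" if "x \<notin> ball p (2 * r)" for x
  proof -
    have "4 \<le> (norm (x - p))\<^sup>2 / r\<^sup>2"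
      using square_norm_diff_ball(2)[OF r(1) that] r by (simp add: le_divide_eq)
    then show ?thesis by simp
  qed
  have bound: "\<bar>?G x \<bullet> f x\<bar> + (1 - ?k x) \<le> (8 * M / r + 1) * indicator (ball p (2 * r)) x"
    if "x \<in> D" for x
  proof (cases "x \<in> ball p (2 * r)")
    case True
    show ?thesis
      using smoothstep_gradient_bound[OF True r(1) M(1)[OF that] M(2), of "?q x"] True
        smoothstep_bounds(1)[of "?q x"] by simp
  next
    case False
    then show ?thesis using far by simp
  qed
  have "(\<integral>\<^sup>+x\<in>D. ennreal (\<bar>?G x \<bullet> f x\<bar> + (1 - ?k x)) \<partial>lborel)
    \<le> ennreal (8 * M / r + 1) * emeasure lborel (ball p (2 * r))"
    by (rule cutoff_cost_le[OF bound]) simp_all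
  also have "\<dots> = ennreal ((8 * M / r + 1) * (unit_ball_vol 3 * (2 * r) ^ 3))"
    using r M by (subst emeasure_ball) (auto simp: ennreal_mult)
  also have "\<dots> \<le> ennreal ((unit_ball_vol 3 * (64 * M + 8)) * r\<^sup>2)"
  proof (rule ennreal_leI)
    have "(8 * M / r + 1) * (unit_ball_vol 3 * (2 * r) ^ 3) =
        unit_ball_vol 3 * (64 * M + 8 * r) * r\<^sup>2"
      using r by (simp add: field_simps power2_eq_square power3_eq_cube)
    also have "\<dots> \<le> unit_ball_vol 3 * (64 * M + 8) * r\<^sup>2"
      using r unit_ball_vol_nonneg[of 3] by (intro mult_right_mono mult_left_mono) auto
    finally show "(8 * M / r + 1) * (unit_ball_vol 3 * (2 * r) ^ 3) \<le> \<dots>" .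
  qed
  finally have cost: "(\<integral>\<^sup>+x\<in>D. ennreal (\<bar>?G x \<bullet> f x\<bar> + (1 - ?k x)) \<partial>lborel)
    \<le> ennreal ((unit_ball_vol 3 * (64 * M + 8)) * r\<^sup>2)" .
  have cont: "continuous_on D ?G"
    using r by (intro continuous_intros) auto
  show ?thesis
    by (rule cutoffI[of D ?k ?G]) (rule d zero smoothstep_bounds(1,2) cost cont | assumption)+
qed

lemma cutoff_null_area:
  assumes D: "open D" "continuous_on D f" and M: "\<And>x. x \<in> D \<Longrightarrow> norm (f x) \<le> M" "0 \<le> M"
    and A: "null_area A" and \<epsilon>: "0 < \<epsilon>"
  shows "\<exists>Y. open Y \<and> A \<subseteq> Y \<and> cutoff D f Y (ennreal \<epsilon>)"
proof -
  \<comment> \<open>The constant of \<open>cutoff_ball\<close>, increased by 1 so that dividing by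
    it is safe.\<close>
  define L where "L = unit_ball_vol 3 * (64 * M + 8) + 1"
  have L: "0 < L" using M unit_ball_vol_nonneg[of 3] by (simp add: L_def add_nonneg_pos)
  \<comment> \<open>The bound 1 on the sum of squares forces every radius to be at most 1, as
    \<open>cutoff_ball\<close> requires; the other bound controls the total cost.\<close>
  obtain C :: "((real^3) \<times> real) set" where C: "finite C" "\<forall>(p, r)\<in>C. r > 0"
      "A \<subseteq> (\<Union>(p, r)\<in>C. ball p r)" "(\<Sum>(p, r)\<in>C. r\<^sup>2) < min 1 (\<epsilon> / L)"
    using A[unfolded null_area_def, rule_format, of "min 1 (\<epsilon> / L)"] \<epsilon> L by auto
  have "cutoff D f (ball (fst i) (snd i)) (ennreal (L * (snd i)\<^sup>2))" if i: "i \<in> C" for i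
  proof -
    have "(snd i)\<^sup>2 \<le> (\<Sum>(p, r)\<in>C. r\<^sup>2)"
      using member_le_sum[of i C "\<lambda>(p, r). r\<^sup>2"] C(1) i by (auto simp: case_prod_beta)
    also have "\<dots> \<le> 1\<^sup>2" using C(4) by simp
    finally have "snd i \<le> 1" by (rule power2_le_imp_le) simp
    moreover have "0 < snd i" using C(2) i by auto
    ultimately show ?thesis
      by (intro cutoff_mono[OF cutoff_ball[OF M]] ennreal_leI mult_right_mono) (auto simp: L_def)
  qed
  then have "cutoff D f (\<Union>i\<in>C. ball (fst i) (snd i)) (\<Sum>i\<in>C. ennreal (L * (snd i)\<^sup>2))"
    by (rule cutoff_UN[OF D C(1)])
  moreover have "(\<Sum>i\<in>C. ennreal (L * (snd i)\<^sup>2)) \<le> ennreal \<epsilon>"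
  proof -
    have "(\<Sum>i\<in>C. ennreal (L * (snd i)\<^sup>2)) = ennreal (L * (\<Sum>(p, r)\<in>C. r\<^sup>2))"
      using L by (simp add: sum_ennreal sum_distrib_left case_prod_beta)
    also have "\<dots> \<le> ennreal (L * (\<epsilon> / L))"
      using L C(4) by (intro ennreal_leI mult_left_mono) auto
    finally show ?thesis using L by simp
  qed
  moreover have "A \<subseteq> (\<Union>i\<in>C. ball (fst i) (snd i))"
    using C(3) by (auto simp: case_prod_beta)
  moreover have "open (\<Union>i\<in>C. ball (fst i) (snd i))" by auto
  ultimately show ?thesis
    by (intro exI[of _ "\<Union>i\<in>C. ball (fst i) (snd i)"]) (auto elim: cutoff_mono)
qed

section \<open>Volume of a strip between two level surfaces\<close>

lemma has_derivative_vec_lambda: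
  fixes f :: "'a::real_normed_vector \<Rightarrow> 'i::finite \<Rightarrow> real"
  assumes "\<And>i. ((\<lambda>x. f x i) has_derivative (\<lambda>h. f' h i)) (at x within S)"
  shows "((\<lambda>x. \<chi> i. f x i) has_derivative (\<lambda>h. \<chi> i. f' h i)) (at x within S)"
  by (subst has_derivative_componentwise_within)
    (use assms in \<open>auto simp: Basis_vec_def inner_axis\<close>)

lemma det_replaced_row:
  fixes a :: "real^3"
  shows "det (\<chi> j. if j = i then a else axis j 1) = a $ i"
  using exhaust_3[of i] by (elim disjE) (simp_all add: det_3 axis_def)

text \<open>The map that replaces the \<open>i\<close>-th coordinate by \<open>g\<close> is injective with Jacobian
  \<open>\<partial>\<^sub>i g\<close>, so it maps the strip into a box of height \<open>b - a\<close> at a controlled cost.\<close>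

lemma emeasure_strip_le:
  fixes g :: "real^3 \<Rightarrow> real"
  assumes g: "\<And>x. x \<in> ball p r \<Longrightarrow> (g has_derivative (\<lambda>h. G x \<bullet> h)) (at x)"
    and c: "\<And>x. x \<in> ball p r \<Longrightarrow> c \<le> \<bar>G x $ i\<bar>" "0 < c" and ab: "a \<le> b" and r: "0 < r"
  shows "emeasure lborel (ball p r \<inter> g -` {a<..<b}) \<le> ennreal ((b - a) * (2 * r)\<^sup>2 / c)"
proof -
  define S where "S = ball p r \<inter> g -` {a<..<b}"
  have contg: "continuous_on (ball p r) g"
    by (intro continuous_at_imp_continuous_on ballI has_derivative_continuous[OF g])
  have S: "open S" "S \<subseteq> ball p r"
    unfolding S_def by (auto intro!: continuous_open_preimage contg)
  define f where "f x = (\<chi> j. if j = i then g x else x $ j)" for x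
  define f' where "f' x h = (\<chi> j. (if j = i then G x else axis j 1) \<bullet> h)" for x h :: "real^3"
  have f: "(f has_derivative f' x) (at x)" if "x \<in> ball p r" for x
    unfolding f_def f'_def
  proof (rule has_derivative_vec_lambda)
    show "((\<lambda>x. if j = i then g x else x $ j) has_derivative
        (\<lambda>h. (if j = i then G x else axis j 1) \<bullet> h)) (at x)" for j
      using g[OF that] by (auto simp: inner_axis' intro!: bounded_linear_imp_has_derivative bounded_linear_vec_nth)
  qed
  \<comment> \<open>Two points with the same image differ only in the \<open>i\<close>-th coordinate
    and have equal \<open>g\<close>. The mean value theorem on the segment between them, which stays
    in the convex ball, would give a zero of the \<open>i\<close>-th partial derivative.\<close>
  have inj: "inj_on f (ball p r)"
  proof (rule inj_onI, rule ccontr)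
    fix x y assume xy: "x \<in> ball p r" "y \<in> ball p r" "f x = f y" "x \<noteq> y"
    have seg: "x + t *\<^sub>R (y - x) \<in> ball p r" if "0 \<le> t" "t \<le> 1" for t
      using that xy(1,2) convexD_alt[of "ball p r" x y t] by (simp add: algebra_simps)
    have fj: "f x $ j = f y $ j" for j using xy(3) by simp
    have yx: "y - x = (y $ i - x $ i) *\<^sub>R axis i 1"
      unfolding vec_eq_iff
    proof
      show "(y - x) $ j = ((y $ i - x $ i) *\<^sub>R axis i 1) $ j" for j
        using fj[of j] by (auto simp: f_def axis_def)
    qed
    have gd: "((\<lambda>t. g (x + t *\<^sub>R (y - x))) has_real_derivative G (x + t *\<^sub>R (y - x)) \<bullet> (y - x)) (at t)"
      if t: "0 \<le> t" "t \<le> 1" for t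
      using has_real_derivative_along[of g x t "y - x"] g[OF seg[OF t]]
        frechet_derivative_at[OF g[OF seg[OF t]], symmetric]
      by (simp add: differentiableI)
    obtain t where t: "0 < t" "t < 1"
        "g (x + 1 *\<^sub>R (y - x)) - g (x + 0 *\<^sub>R (y - x)) = (1 - 0) * (G (x + t *\<^sub>R (y - x)) \<bullet> (y - x))"
      using MVT2[of 0 1 "\<lambda>t. g (x + t *\<^sub>R (y - x))" "\<lambda>t. G (x + t *\<^sub>R (y - x)) \<bullet> (y - x)"] gd by auto
    have "g x = g y" using fj[of i] by (simp add: f_def)
    with t have "G (x + t *\<^sub>R (y - x)) \<bullet> (y - x) = 0" by simp
    then have "(y $ i - x $ i) * G (x + t *\<^sub>R (y - x)) $ i = 0"
      by (subst (asm) (2) yx) (simp add: inner_axis)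
    moreover have "y $ i - x $ i \<noteq> 0"
      using xy(4) yx by (metis eq_iff_diff_eq_0 scale_zero_left)
    ultimately show False
      using c(1)[OF seg[of t]] c(2) t by auto
  qed
  have det: "det (matrix (f' x)) = G x $ i" for x
  proof -
    have "matrix (f' x) = (\<chi> j. if j = i then G x else axis j 1)"
      by (simp add: matrix_def f'_def vec_eq_iff inner_axis)
    then show ?thesis by (simp add: det_replaced_row)
  qed
  \<comment> \<open>Direction \<open>i\<close> carries the range of \<open>g\<close>; each of the
    two other directions carries the width \<open>2 * r\<close> of the ball.\<close>
  let ?l = "\<chi> j. if j = i then a else p $ j - r" and ?u = "\<chi> j. if j = i then b else p $ j + r"
  have sub: "f ` S \<subseteq> cbox ?l ?u"
  proof clarify
    fix x assume x: "x \<in> S"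
    have "\<bar>x $ j - p $ j\<bar> < r" for j
      using component_le_norm_cart[of "x - p" j] x S by (auto simp: dist_norm norm_minus_commute)
    then have "p $ j - r \<le> x $ j" "x $ j \<le> p $ j + r" for j
      by (smt (verit))+
    with x show "f x \<in> cbox ?l ?u"
      by (auto simp: mem_box_cart f_def S_def less_imp_le)
  qed
  have "open (f ` S)"
  proof (rule invariance_of_domain)
    show "continuous_on S f"
      using S(2) by (intro continuous_at_imp_continuous_on ballI has_derivative_continuous[OF f]) auto
  qed (use S inj inj_on_subset in auto)
  then have fS: "f ` S \<in> lmeasurable"
    using sub bounded_subset[OF bounded_cbox] by (intro bounded_set_imp_lmeasurable) auto
  have Sm: "S \<in> lmeasurable"
    using S bounded_subset[OF bounded_ball] by (intro bounded_set_imp_lmeasurable) auto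
  have der: "\<And>x. x \<in> S \<Longrightarrow> (f has_derivative f' x) (at x within S)"
    using f S(2) has_derivative_at_withinI by blast
  have injS: "inj_on f S" using inj S(2) inj_on_subset by blast
  have int: "(\<lambda>x. \<bar>det (matrix (f' x))\<bar>) integrable_on S"
    using measurable_differentiable_image_eq[OF fmeasurableD[OF Sm] der injS] fS by simp
  \<comment> \<open>The lower bound \<open>c\<close> of the Jacobian converts the volume of the
    strip into that of its image, and the box bounds the latter.\<close>
  have "c * measure lebesgue S = integral S (\<lambda>x. c)"
    using Sm by (simp add: lmeasure_integral integral_mult_right[symmetric] del: integral_mult_right)
  also have "\<dots> \<le> integral S (\<lambda>x. \<bar>det (matrix (f' x))\<bar>)"
    using int Sm c(1) S(2) by (intro integral_le integrable_on_const) (auto simp: det)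
  also have "\<dots> = measure lebesgue (f ` S)"
    by (rule measure_differentiable_image_eq[OF fmeasurableD[OF Sm] der injS int, symmetric])
  also have "\<dots> \<le> measure lebesgue (cbox ?l ?u)"
    using sub fS by (intro measure_mono_fmeasurable) auto
  also have "\<dots> = (\<Prod>j\<in>UNIV. ?u $ j - ?l $ j)"
  proof -
    have "cbox ?l ?u \<noteq> {}" using ab r by (auto simp: interval_ne_empty_cart)
    then show ?thesis by (simp add: content_cbox_cart)
  qed
  also have "\<dots> = (b - a) * (2 * r)\<^sup>2"
  proof -
    have "(\<Prod>j\<in>UNIV. h j) = h 1 * h 2 * h 3" for h :: "3 \<Rightarrow> real"
      unfolding UNIV_3 by (simp add: ac_simps)
    then show ?thesis
      using exhaust_3[of i] by (elim disjE) (simp_all add: power2_eq_square mult.assoc)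
  qed
  finally have "measure lebesgue S \<le> (b - a) * (2 * r)\<^sup>2 / c"
    using c(2) by (simp add: le_divide_eq mult.commute)
  then have "ennreal (measure lebesgue S) \<le> ennreal ((b - a) * (2 * r)\<^sup>2 / c)"
    by (rule ennreal_leI)
  moreover have "emeasure lborel S = ennreal (measure lebesgue S)"
    using S emeasure_bounded_finite[OF bounded_subset[OF bounded_ball S(2)]]
    by (simp add: emeasure_eq_ennreal_measure less_top[symmetric])
  ultimately show ?thesis by (simp add: S_def)
qed

section \<open>Cutoffs near the smooth part of the boundary\<close>

lemma level_nonpos_on_closure:
  fixes g :: "real^3 \<Rightarrow> real"
  assumes "open U" "Ck_on 1 g U" "D \<inter> U = {x\<in>U. g x < 0}" "x \<in> U" "x \<in> closure D"
  shows "g x \<le> 0"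
proof (rule ccontr)
  assume "\<not> g x \<le> 0"
  have "open (U \<inter> g -` {0<..})"
    by (intro continuous_open_preimage Ck_on_imp_continuous_on[OF assms(2)] assms(1) open_greaterThan)
  moreover have "x \<in> U \<inter> g -` {0<..}" using assms(4) \<open>\<not> g x \<le> 0\<close> by auto
  ultimately have "D \<inter> (U \<inter> g -` {0<..}) \<noteq> {}"
    using assms(5) open_Int_closure_eq_empty[of "U \<inter> g -` {0<..}" D] by blast
  then obtain y where y: "y \<in> D \<inter> U" "0 < g y" by auto
  from y(1) have "g y < 0" unfolding assms(3) by simp
  with y(2) show False by simp
qed

lemma grad_has_derivative:
  assumes "g differentiable (at x)"
  shows "(g has_derivative (\<lambda>h. grad g x \<bullet> h)) (at x)"
proof -
  have g: "(g has_derivative fderiv g x) (at x)"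
    using assms frechet_derivative_works by blast
  have eq: "fderiv g x h = grad g x \<bullet> h" for h
    using linear_component_expansion[OF has_derivative_linear[OF g], of h]
    by (simp add: grad_def inner_vec_def mult.commute)
  show ?thesis by (rule has_derivative_eq_rhs[OF g ext]) (rule eq)
qed

lemma Ck_on_grad: "open U \<Longrightarrow> Ck_on (Suc k) g U \<Longrightarrow> Ck_on k (grad g) U"
  unfolding grad_def[abs_def] by (intro Ck_on_vec_lambda Ck_on_frechet_derivative)

text \<open>The cutoff is \<open>1 - \<theta> a\<close>, with \<open>\<theta>\<close> radial around
  \<open>p\<close> and \<open>a\<close> a function of \<open>g / \<delta>\<close>. Its steep part is
  a multiple of \<open>grad g\<close> of order \<open>1 / \<delta>\<close>, but the strip that
  carries it has volume of order \<open>\<delta>\<close>, and there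
  \<open>grad g x \<bullet> f x\<close> is small because tangency makes it vanish on the boundary.
  The radius \<open>r\<close> is fixed before \<open>\<epsilon>\<close>, so that finitely many balls
  can later be selected independently of the accuracy.\<close>

lemma cutoff_outward_normal:
  assumes D: "open D" and f: "continuous_on (closure D) f" and M: "\<And>x. x \<in> D \<Longrightarrow> norm (f x) \<le> M" "0 \<le> M"
    and tan: "tangent_to_boundary f D" and n: "outward_normal D p n"
  shows "\<exists>r>0. \<forall>\<epsilon>>0. \<exists>Y. open Y \<and> frontier D \<inter> ball p r \<subseteq> Y \<and> cutoff D f Y (ennreal \<epsilon>)"
proof -
  obtain U g where U: "open U" "p \<in> U" "Ck_on 1 g U" "\<And>x. x \<in> U \<Longrightarrow> grad g x \<noteq> 0"
      "D \<inter> U = {x\<in>U. g x < 0}" "g p = 0"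
    using n unfolding outward_normal_def by auto
  have gd: "(g has_derivative (\<lambda>h. grad g x \<bullet> h)) (at x)" if "x \<in> U" for x
    using grad_has_derivative Ck_on_differentiable[OF U(3) _ that] by simp
  have DU: "x \<in> D \<longleftrightarrow> g x < 0" if "x \<in> U" for x
    using U(5) that by blast
  have gradc: "continuous_on U (grad g)"
    using Ck_on_grad[OF U(1), of 0 g] U(3) by simp
  \<comment> \<open>A coordinate in which \<open>g\<close> is strictly monotone near
    \<open>p\<close>, as the strip estimate requires.\<close>
  obtain i where i: "grad g p $ i \<noteq> 0" using U(4)[OF U(2)] by (auto simp: vec_eq_iff)
  define c where "c = \<bar>grad g p $ i\<bar> / 2"
  have c: "0 < c" using i by (simp add: c_def)
  have "open (U \<inter> (\<lambda>x. \<bar>grad g x $ i\<bar>) -` {c<..})"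
    by (intro continuous_open_preimage U continuous_intros gradc)
  moreover have "p \<in> U \<inter> (\<lambda>x. \<bar>grad g x $ i\<bar>) -` {c<..}" using U(2) i by (simp add: c_def)
  ultimately obtain R where R: "0 < R" "cball p R \<subseteq> U \<inter> (\<lambda>x. \<bar>grad g x $ i\<bar>) -` {c<..}"
    using open_contains_cball by blast
  \<comment> \<open>Halving leaves room for the transition zone of the radial cutoff between
    \<open>r\<close> and \<open>2 * r\<close>.\<close>
  define r where "r = R / 2"
  have r: "0 < r" and RU: "cball p (2 * r) \<subseteq> U" and Rc: "\<And>x. x \<in> cball p (2 * r) \<Longrightarrow> c < \<bar>grad g x $ i\<bar>"
    using R by (auto simp: r_def)
  have "\<exists>Y. open Y \<and> frontier D \<inter> ball p r \<subseteq> Y \<and> cutoff D f Y (ennreal \<epsilon>)" if \<epsilon>: "0 < \<epsilon>" for \<epsilon>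
  proof -
    \<comment> \<open>Chosen so that \<open>64 * r\<^sup>2 * \<eta>\<close>, the share of the steep
      part in the final estimate, equals \<open>\<epsilon> * c / 4\<close>.\<close>
    define \<eta> where "\<eta> = \<epsilon> * c / (256 * r\<^sup>2)"
    have \<eta>: "0 < \<eta>" using \<epsilon> c r by (simp add: \<eta>_def)
    have "\<exists>\<delta>0>0. \<forall>x\<in>D \<inter> cball p (2 * r). - (2 * \<delta>0) < g x \<longrightarrow> \<bar>grad g x \<bullet> f x\<bar> < \<eta>"
    proof -
      \<comment> \<open>The compact set where \<open>f\<close> is far from orthogonal to
        \<open>grad g\<close>. Tangency keeps it off the level \<open>g = 0\<close>, so
        \<open>g\<close> has a negative maximum on it; every point of \<open>D\<close> in the ball
        with a larger value of \<open>g\<close> is good.\<close>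
      define C where "C = (closure D \<inter> cball p (2 * r)) \<inter> (\<lambda>x. \<bar>grad g x \<bullet> f x\<bar>) -` {\<eta>..}"
      have "closed C"
        unfolding C_def
        by (intro continuous_closed_preimage continuous_intros
            continuous_on_subset[OF gradc] continuous_on_subset[OF f]) (use RU in auto)
      then have C: "compact C"
        by (rule compact_Int_closed[OF compact_cball[of p "2 * r"], THEN back_subst[of compact]])
          (auto simp: C_def)
      have neg: "g x < 0" if x: "x \<in> C" for x
      proof -
        have xU: "x \<in> U" and xD: "x \<in> closure D" using x RU by (auto simp: C_def)
        have "g x \<noteq> 0"
        proof
          assume g0: "g x = 0"
          with DU[OF xU] have "x \<notin> D" by simp
          with xD D have "x \<in> frontier D" by (simp add: frontier_def interior_open)
          moreover have "outward_normal D x (grad g x)"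
            unfolding outward_normal_def using U g0 xU by (intro exI[of _ U] exI[of _ g]) auto
          ultimately have "f x \<bullet> grad g x = 0" using tan unfolding tangent_to_boundary_def by blast
          with x \<eta> show False by (simp add: C_def inner_commute)
        qed
        with level_nonpos_on_closure[OF U(1,3,5) xU xD] show ?thesis by simp
      qed
      have nC: "\<bar>grad g x \<bullet> f x\<bar> < \<eta>" if "x \<in> D" "x \<in> cball p (2 * r)" "x \<notin> C" for x
        using that subsetD[OF closure_subset that(1)] by (simp add: C_def)
      show ?thesis
      proof (cases "C = {}")
        case True
        then show ?thesis
          by (intro exI[of _ 1]) (auto intro: nC)
      next
        case False
        have "continuous_on C g"
          by (rule continuous_on_subset[OF Ck_on_imp_continuous_on[OF U(3)]]) (use RU in \<open>auto simp: C_def\<close>)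
        with continuous_attains_sup[OF C False] obtain x0 where x0: "x0 \<in> C" "\<And>x. x \<in> C \<Longrightarrow> g x \<le> g x0"
          by blast
        show ?thesis
        proof (intro exI[of _ "- g x0 / 2"] conjI ballI impI)
          \<comment> \<open>With this \<open>\<delta>0\<close> the condition
            \<open>- (2 * \<delta>0) < g x\<close> reads \<open>g x0 < g x\<close> and thus excludes
            \<open>C\<close>.\<close>
          show "0 < - g x0 / 2" using neg[OF x0(1)] by simp
          fix x assume "x \<in> D \<inter> cball p (2 * r)" "- (2 * (- g x0 / 2)) < g x"
          then have "x \<notin> C" using x0(2)[of x] by auto
          with \<open>x \<in> D \<inter> cball p (2 * r)\<close> show "\<bar>grad g x \<bullet> f x\<bar> < \<eta>"
            by (auto intro: nC)
        qed
      qed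
    qed
    then obtain \<delta>0 where \<delta>0: "0 < \<delta>0"
      "\<And>x. x \<in> D \<Longrightarrow> x \<in> cball p (2 * r) \<Longrightarrow> - (2 * \<delta>0) < g x \<Longrightarrow> \<bar>grad g x \<bullet> f x\<bar> < \<eta>" by blast
    \<comment> \<open>The second bound makes the remaining terms of the cost, namely the radial
      gradient and \<open>1 - k\<close>, at most \<open>\<epsilon> * c / 2\<close> in the final
      estimate.\<close>
    define \<delta> where "\<delta> = min \<delta>0 (\<epsilon> * c / (64 * r\<^sup>2 * (8 * M / r + 1)))"
    have pos: "0 < 8 * M / r + 1" using M r by (simp add: add_nonneg_pos)
    have \<delta>: "0 < \<delta>" "\<delta> \<le> \<delta>0" "\<delta> * (64 * r\<^sup>2 * (8 * M / r + 1)) \<le> \<epsilon> * c"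
    proof -
      have m: "0 < 64 * r\<^sup>2 * (8 * M / r + 1)" using pos r by (intro mult_pos_pos) auto
      then show "0 < \<delta>" using \<delta>0(1) \<epsilon> c by (auto simp: \<delta>_def)
      have "\<delta> \<le> \<epsilon> * c / (64 * r\<^sup>2 * (8 * M / r + 1))" by (simp add: \<delta>_def)
      with m show "\<delta> * (64 * r\<^sup>2 * (8 * M / r + 1)) \<le> \<epsilon> * c" by (simp only: pos_le_divide_eq)
      show "\<delta> \<le> \<delta>0" by (simp add: \<delta>_def)
    qed
    let ?q = "\<lambda>x. (norm (x - p))\<^sup>2 / r\<^sup>2 - 1" and ?s = "\<lambda>x. - g x / \<delta> - 1"
    let ?\<theta> = "\<lambda>x. 1 - smoothstep (?q x)" and ?a = "\<lambda>x. 1 - smoothstep (?s x)"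
    let ?G\<theta> = "\<lambda>x. - (smoothstep' (?q x) *\<^sub>R (2 / r\<^sup>2) *\<^sub>R (x - p))"
    let ?Ga = "\<lambda>x. (smoothstep' (?s x) / \<delta>) *\<^sub>R grad g x"
    let ?G0 = "\<lambda>x. - (?a x *\<^sub>R ?G\<theta> x + ?\<theta> x *\<^sub>R ?Ga x)"
    \<comment> \<open>The formula with \<open>g\<close> is meaningful only inside \<open>U\<close>,
      which contains \<open>cball p (2 * r)\<close>; outside the ball the cutoff is continued by
      1.\<close>
    define k where "k x = (if x \<in> ball p (2 * r) then 1 - ?\<theta> x * ?a x else 1)" for x
    define G where "G x = (if x \<in> ball p (2 * r) then ?G0 x else 0)" for x
    note q = has_derivative_scaled_square_norm[of p r]
    have d\<theta>: "(?\<theta> has_derivative (\<lambda>h. ?G\<theta> x \<bullet> h)) (at x)" for x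
      by (rule has_derivative_eq_rhs[OF has_derivative_diff[OF has_derivative_const has_derivative_smoothstep[OF q]]])
        (simp add: fun_eq_iff)
    have ds: "(?s has_derivative (\<lambda>h. (- (1 / \<delta>) *\<^sub>R grad g x) \<bullet> h)) (at x)" if "x \<in> U" for x
      using \<delta>(1) by (auto intro!: derivative_eq_intros gd[OF that])
    have da: "(?a has_derivative (\<lambda>h. ?Ga x \<bullet> h)) (at x)" if "x \<in> U" for x
      by (rule has_derivative_eq_rhs[OF has_derivative_diff[OF has_derivative_const has_derivative_smoothstep[OF ds[OF that]]]])
        (simp add: fun_eq_iff)
    have d0: "((\<lambda>x. 1 - ?\<theta> x * ?a x) has_derivative (\<lambda>h. ?G0 x \<bullet> h)) (at x)" if "x \<in> U" for x
      by (rule has_derivative_eq_rhs[OF has_derivative_diff[OF has_derivative_const has_derivative_mult[OF d\<theta> da[OF that]]]])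
        (simp add: fun_eq_iff inner_add_left algebra_simps)
    \<comment> \<open>On this open set the radial factor is already constant, since its argument is
      at least 1. It overlaps the ball of radius \<open>2 * r\<close> and covers its complement, so
      \<open>k\<close> is C1 across the sphere where its definition changes.\<close>
    define Far where "Far = {x. 2 * r\<^sup>2 < (norm (x - p))\<^sup>2}"
    have Far: "open Far" "- ball p (2 * r) \<subseteq> Far"
    proof -
      show "open Far" unfolding Far_def by (intro open_Collect_less continuous_intros)
      show "- ball p (2 * r) \<subseteq> Far"
      proof
        fix x assume "x \<in> - ball p (2 * r)"
        then have "4 * r\<^sup>2 \<le> (norm (x - p))\<^sup>2" using square_norm_diff_ball(2)[OF r] by simp
        moreover have "2 * r\<^sup>2 < 4 * r\<^sup>2" using r by simp
        ultimately show "x \<in> Far" unfolding Far_def mem_Collect_eq by linarith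
      qed
    qed
    have far: "?\<theta> x = 0" "smoothstep' (?q x) = 0" if "x \<in> Far" for x
    proof -
      have "1 \<le> ?q x" using that r by (simp add: Far_def le_divide_eq)
      then show "?\<theta> x = 0" "smoothstep' (?q x) = 0" by simp_all
    qed
    have kFar: "k x = 1" and GFar: "G x = 0" if "x \<in> Far" for x
      using far[OF that] by (auto simp: k_def G_def)
    have dk: "(k has_derivative (\<lambda>h. G x \<bullet> h)) (at x)" for x
    proof (cases "x \<in> ball p (2 * r)")
      case True
      then have "x \<in> U" using RU by auto
      from d0[OF this] show ?thesis
        by (rule has_derivative_transform_within_open[where s = "ball p (2 * r)", THEN has_derivative_eq_rhs])
          (use True in \<open>auto simp: k_def G_def\<close>)
    next
      case False
      then have x: "x \<in> Far" using Far(2) by auto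
      have "(k has_derivative (\<lambda>h. 0)) (at x)"
        by (rule has_derivative_transform_within_open[OF has_derivative_const[of 1] Far(1) x]) (simp add: kFar)
      then show ?thesis using GFar[OF x] by simp
    qed
    have contG: "continuous_on D G"
    proof -
      have "continuous_on (ball p (2 * r)) ?G0"
        using \<delta>(1) r RU
        by (intro continuous_intros continuous_on_subset[OF gradc]
            continuous_on_subset[OF Ck_on_imp_continuous_on[OF U(3)]]) auto
      then have "continuous_on (ball p (2 * r)) G"
        by (rule continuous_on_eq) (simp add: G_def)
      moreover have "continuous_on Far G"
        by (rule continuous_on_eq[OF continuous_on_const[of _ 0]]) (simp add: GFar)
      ultimately have "continuous_on (ball p (2 * r) \<union> Far) G"
        by (intro continuous_on_open_Un Far) auto
      then show ?thesis by (rule continuous_on_subset) (use Far(2) in auto)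
    qed
    have k01: "0 \<le> k x" "k x \<le> 1" for x
    proof -
      have "0 \<le> ?\<theta> x * ?a x" "?\<theta> x * ?a x \<le> 1"
        using smoothstep_bounds(1,2) by (auto intro!: mult_nonneg_nonneg mult_le_one)
      then show "0 \<le> k x" "k x \<le> 1" by (auto simp: k_def)
    qed
    have gneg: "g x < 0" if "x \<in> D" "x \<in> ball p (2 * r)" for x
      using DU[of x] that RU by (auto simp: subset_iff)
    note near = square_norm_diff_ball(1)[OF r]
    \<comment> \<open>In this ball the frontier has \<open>g \<ge> 0\<close>, as its points lie
      outside the open set \<open>D\<close>; hence the one-sided condition
      \<open>- \<delta> < g\<close> defines an open neighbourhood of it.\<close>
    define Y where "Y = ball p r \<inter> g -` {- \<delta><..}"
    have contgr: "continuous_on (ball p r) g"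
      by (rule continuous_on_subset[OF Ck_on_imp_continuous_on[OF U(3)]]) (use RU r in auto)
    have Y: "open Y" "frontier D \<inter> ball p r \<subseteq> Y"
    proof -
      show "open Y" unfolding Y_def by (intro continuous_open_preimage contgr) auto
      show "frontier D \<inter> ball p r \<subseteq> Y"
      proof
        fix x assume x: "x \<in> frontier D \<inter> ball p r"
        then have "x \<notin> D" "x \<in> U" using D RU r by (auto simp: frontier_def interior_open)
        then have "0 \<le> g x" using DU by (simp add: not_less)
        with x \<delta>(1) show "x \<in> Y" by (simp add: Y_def)
      qed
    qed
    have kY: "k x = 0" if "x \<in> Y" for x
    proof -
      have "- g x / \<delta> \<le> 1" using that \<delta>(1) by (subst pos_divide_le_eq) (auto simp: Y_def)
      then have "?s x \<le> 0" by simp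
      with near[of x] that r show ?thesis by (simp add: k_def Y_def)
    qed
    \<comment> \<open>The only part of \<open>D\<close> where the cutoff differs from 1: deeper than
      \<open>2 * \<delta>\<close> the factor \<open>a\<close> vanishes together with its
      derivative.\<close>
    define S where "S = ball p (2 * r) \<inter> g -` {- (2 * \<delta>)<..<0}"
    define K where "K = 8 * M / r + 1 + 2 * \<eta> / \<delta>"
    have K: "0 \<le> K" using pos \<eta> \<delta>(1) by (simp add: K_def)
    have bound: "\<bar>G x \<bullet> f x\<bar> + (1 - k x) \<le> K * indicator S x" if x: "x \<in> D" for x
    proof -
      consider "x \<notin> ball p (2 * r)" | "x \<in> ball p (2 * r)" "g x \<le> - (2 * \<delta>)" | "x \<in> S"
        using gneg[OF x] by (fastforce simp: S_def)
      then show ?thesis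
      proof cases
        case 1
        then have "k x = 1" "G x = 0" by (simp_all add: k_def G_def)
        then show ?thesis using K by simp
      next
        case 2
        then have "2 \<le> - g x / \<delta>" using \<delta>(1) by (subst pos_le_divide_eq) auto
        then have "1 \<le> ?s x" by simp
        then have "k x = 1" "G x = 0" by (simp_all add: k_def G_def)
        then show ?thesis using K by simp
      next
        case 3
        have xb: "x \<in> ball p (2 * r)" using 3 by (simp add: S_def)
        have 1: "\<bar>?G\<theta> x \<bullet> f x\<bar> \<le> 8 * M / r"
          unfolding inner_minus_left abs_minus_cancel
          by (rule smoothstep_gradient_bound[OF xb r M(1)[OF x] M(2)])
        have "\<bar>grad g x \<bullet> f x\<bar> \<le> \<eta>"
          using \<delta>0(2)[OF x] 3 \<delta>(2) by (auto simp: S_def less_imp_le)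
        then have 2: "\<bar>?Ga x \<bullet> f x\<bar> \<le> (2 / \<delta>) * \<eta>"
          using smoothstep_bounds(3,4)[of "?s x"] \<delta>(1)
          by (simp only: inner_scaleR_left abs_mult) (intro mult_mono, auto simp: divide_right_mono)
        have "\<bar>G x \<bullet> f x\<bar> = \<bar>?a x * (?G\<theta> x \<bullet> f x) + ?\<theta> x * (?Ga x \<bullet> f x)\<bar>"
          using xb by (simp only: G_def if_True inner_minus_left inner_add_left inner_scaleR_left abs_minus_cancel)
        also have "\<dots> \<le> ?a x * \<bar>?G\<theta> x \<bullet> f x\<bar> + ?\<theta> x * \<bar>?Ga x \<bullet> f x\<bar>"
          by (rule order.trans[OF abs_triangle_ineq]) (use smoothstep_bounds(2) in \<open>simp only: abs_mult, simp\<close>)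
        also have "\<dots> \<le> 1 * (8 * M / r) + 1 * ((2 / \<delta>) * \<eta>)"
          by (intro add_mono mult_mono 1 2) (use smoothstep_bounds(1) in simp_all)
        finally have "\<bar>G x \<bullet> f x\<bar> \<le> 8 * M / r + 2 * \<eta> / \<delta>" by simp
        with 3 k01(1)[of x] show ?thesis by (simp add: K_def)
      qed
    qed
    have Sopen: "open S"
      unfolding S_def
      by (intro continuous_open_preimage continuous_on_subset[OF Ck_on_imp_continuous_on[OF U(3)]])
        (use RU in auto)
    have "(\<integral>\<^sup>+x\<in>D. ennreal (\<bar>G x \<bullet> f x\<bar> + (1 - k x)) \<partial>lborel) \<le> ennreal K * emeasure lborel S"
      by (rule cutoff_cost_le[OF bound]) (simp_all add: Sopen)
    \<comment> \<open>The strip has height \<open>2 * \<delta>\<close> and lies in a ball of radius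
      \<open>2 * r\<close>, which explains the doubled radius in the base area.\<close>
    also have "\<dots> \<le> ennreal K * ennreal ((0 - - (2 * \<delta>)) * (2 * (2 * r))\<^sup>2 / c)"
      unfolding S_def
      by (intro mult_left_mono emeasure_strip_le[where G = "grad g" and i = i] gd)
        (use RU Rc c r \<delta>(1) in \<open>auto simp: less_imp_le\<close>)
    also have "\<dots> = ennreal (K * (32 * \<delta> * r\<^sup>2 / c))"
      using K \<delta>(1) c by (subst ennreal_mult[symmetric]) (auto simp: power_mult_distrib)
    also have "\<dots> \<le> ennreal \<epsilon>"
    proof (rule ennreal_leI)
      have "K * (32 * \<delta> * r\<^sup>2) = \<delta> * (64 * r\<^sup>2 * (8 * M / r + 1)) / 2 + 64 * r\<^sup>2 * \<eta>"
        using \<delta>(1) by (simp add: K_def algebra_simps)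
      also have "\<dots> \<le> \<epsilon> * c / 2 + \<epsilon> * c / 4"
        by (intro add_mono divide_right_mono \<delta>(3)) (use r in \<open>simp_all add: \<eta>_def\<close>)
      also have "\<dots> \<le> \<epsilon> * c" using \<epsilon> c by simp
      finally show "K * (32 * \<delta> * r\<^sup>2 / c) \<le> \<epsilon>" using c by (simp add: divide_le_eq)
    qed
    finally have cost: "(\<integral>\<^sup>+x\<in>D. ennreal (\<bar>G x \<bullet> f x\<bar> + (1 - k x)) \<partial>lborel) \<le> ennreal \<epsilon>" .
    have "cutoff D f Y (ennreal \<epsilon>)"
      by (rule cutoffI[of D k G]) (rule dk k01 contG cost kY | assumption)+
    with Y show ?thesis by blast
  qed
  with r show ?thesis by blast
qed

text \<open>The cutoff of the singular part vanishes on an open set \<open>Y0\<close>. The rest of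
  the frontier is compact and has a normal at each of its points, so finitely many local cutoffs
  suffice, and they share half of \<open>\<epsilon>\<close> among them.\<close>

lemma cutoff_frontier:
  assumes D: "regular_domain D" and f: "continuous_on (closure D) f"
    and tan: "tangent_to_boundary f D" and \<epsilon>: "0 < \<epsilon>"
  shows "\<exists>Y. open Y \<and> frontier D \<subseteq> Y \<and> cutoff D f Y (ennreal \<epsilon>)"
proof -
  have D: "open D" "bounded D" "null_area {p \<in> frontier D. \<nexists>n. outward_normal D p n}"
    using D by (auto simp: regular_domain_def)
  have fD: "continuous_on D f" by (rule continuous_on_subset[OF f closure_subset])
  have "bounded (f ` closure D)"
    using D f by (intro compact_imp_bounded compact_continuous_image) auto
  then obtain M where "\<And>x. x \<in> closure D \<Longrightarrow> norm (f x) \<le> M" "0 < M"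
    unfolding bounded_pos by auto
  then have M: "\<And>x. x \<in> D \<Longrightarrow> norm (f x) \<le> M" "0 \<le> M"
    using closure_subset by (auto simp: less_imp_le)
  obtain Y0 where Y0: "open Y0" "{p \<in> frontier D. \<nexists>n. outward_normal D p n} \<subseteq> Y0"
      "cutoff D f Y0 (ennreal (\<epsilon> / 2))"
    using cutoff_null_area[OF D(1) fD M D(3), of "\<epsilon> / 2"] \<epsilon> by auto
  have "\<exists>r>0. \<forall>\<epsilon>>0. \<exists>Y. open Y \<and> frontier D \<inter> ball p r \<subseteq> Y \<and> cutoff D f Y (ennreal \<epsilon>)"
    if p: "p \<in> frontier D - Y0" for p
  proof -
    obtain n where n: "outward_normal D p n" using p Y0(2) by auto
    show ?thesis by (rule cutoff_outward_normal[OF D(1) f M tan n])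
  qed
  then obtain r where r: "\<And>p. p \<in> frontier D - Y0 \<Longrightarrow> 0 < r p"
    "\<And>p \<epsilon>. p \<in> frontier D - Y0 \<Longrightarrow> 0 < \<epsilon> \<Longrightarrow>
      \<exists>Y. open Y \<and> frontier D \<inter> ball p (r p) \<subseteq> Y \<and> cutoff D f Y (ennreal \<epsilon>)"
    by metis
  have "compact (frontier D - Y0)"
    using D(2) Y0(1) by (intro compact_diff compact_frontier_bounded)
  then obtain P where P: "P \<subseteq> frontier D - Y0" "finite P" "frontier D - Y0 \<subseteq> (\<Union>p\<in>P. ball p (r p))"
    by (rule compactE_image[where C = "frontier D - Y0" and f = "\<lambda>p. ball p (r p)"]) (use r(1) in auto)
  \<comment> \<open>The summand 1 allows the finite cover to be empty.\<close>
  define m where "m = real (card P) + 1"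
  have m: "0 < m" by (simp add: m_def add_nonneg_pos)
  define e where "e = \<epsilon> / 2 / m"
  have e: "0 < e" using \<epsilon> m by (simp add: e_def)
  obtain Y where Y: "\<And>p. p \<in> P \<Longrightarrow> open (Y p)" "\<And>p. p \<in> P \<Longrightarrow> frontier D \<inter> ball p (r p) \<subseteq> Y p"
      "\<And>p. p \<in> P \<Longrightarrow> cutoff D f (Y p) (ennreal e)"
    using r(2)[OF _ e] P(1) by (metis subsetD)
  have "cutoff D f (\<Union>p\<in>P. Y p) (\<Sum>p\<in>P. ennreal e)"
    by (rule cutoff_UN[OF D(1) fD P(2) Y(3)])
  then have "cutoff D f (Y0 \<union> (\<Union>p\<in>P. Y p)) (ennreal (\<epsilon> / 2) + (\<Sum>p\<in>P. ennreal e))"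
    by (rule cutoff_Un[OF D(1) fD Y0(3)])
  moreover have "ennreal (\<epsilon> / 2) + (\<Sum>p\<in>P. ennreal e) \<le> ennreal \<epsilon>"
  proof -
    have "real (card P) * e \<le> m * e" using e by (simp add: m_def algebra_simps)
    also have "\<dots> = \<epsilon> / 2" using m by (simp add: e_def)
    finally have "\<epsilon> / 2 + real (card P) * e \<le> \<epsilon>" by simp
    moreover have "(\<Sum>p\<in>P. ennreal e) = ennreal (real (card P) * e)"
      using e by (simp add: ennreal_mult ennreal_of_nat_eq_real_of_nat)
    ultimately show ?thesis using e \<epsilon>
      by (simp add: ennreal_plus[symmetric] ennreal_leI del: ennreal_plus)
  qed
  moreover have "frontier D \<subseteq> Y0 \<union> (\<Union>p\<in>P. Y p)" using P(3) Y(2) by blast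
  moreover have "open (Y0 \<union> (\<Union>p\<in>P. Y p))" using Y0(1) Y(1) by auto
  ultimately show ?thesis by (intro exI[of _ "Y0 \<union> (\<Union>p\<in>P. Y p)"]) (auto elim: cutoff_mono)
qed

lemma set_integrable_continuous_bounded:
  fixes h :: "real^3 \<Rightarrow> real"
  assumes "open D" "bounded D" "closure D \<subseteq> N" "continuous_on N h"
  shows "set_integrable lborel D h"
proof -
  have "set_integrable lborel (closure D) h"
    unfolding set_integrable_def
    using assms by (intro borel_integrable_compact continuous_on_subset[OF assms(4)]) auto
  then show ?thesis
    by (rule set_integrable_subset) (use assms(1) closure_subset in auto)
qed

text \<open>For a cutoff \<open>k\<close> near the frontier, \<open>k * f\<close> extended by zero
  is C1 with compact support, so its divergence integrates to zero. The integral of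
  \<open>divergence f\<close> thus equals that of
  \<open>(1 - k) * divergence f - G \<bullet> f\<close>, which is bounded by the cost of the cutoff
  times \<open>M + 1\<close>.\<close>

lemma tangent_divergence_theorem:
  assumes D: "regular_domain D" and N: "open N" "closure D \<subseteq> N" and f: "Ck_on 1 f N"
    and tan: "tangent_to_boundary f D"
  shows "set_integrable lborel D (divergence f)" "(LINT x:D|lborel. divergence f x) = 0"
proof -
  have oD: "open D" and bD: "bounded D"
    using D by (auto simp: regular_domain_def)
  have DN: "D \<subseteq> N" using N(2) closure_subset by blast
  define f' where "f' x = fderiv f x" for x
  have f': "(f has_derivative f' x) (at x)" if "x \<in> N" for x
    using Ck_on_has_derivative[OF f _ that] by (simp add: f'_def)
  have f'c: "continuous_on N (\<lambda>x. f' x v)" for v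
    using Ck_on_frechet_derivative[OF N(1), of 0 f v] f by (simp add: f'_def)
  have fN: "continuous_on N f" by (rule Ck_on_imp_continuous_on[OF f])
  have div: "divergence f x = (\<Sum>i\<in>UNIV. f' x (axis i 1) $ i)" for x
    by (simp add: divergence_def trace_def jacobian_def matrix_def f'_def)
  have divc: "continuous_on N (divergence f)"
    unfolding div[abs_def] by (intro continuous_intros f'c)
  show int: "set_integrable lborel D (divergence f)"
    by (rule set_integrable_continuous_bounded[OF oD bD N(2) divc])
  have "bounded (divergence f ` closure D)"
    using bD N by (intro compact_imp_bounded compact_continuous_image continuous_on_subset[OF divc]) auto
  then obtain M where "\<And>x. x \<in> closure D \<Longrightarrow> norm (divergence f x) \<le> M" and M0: "0 < M"
    unfolding bounded_pos by auto
  then have M: "\<bar>divergence f x\<bar> \<le> M" if "x \<in> D" for x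
    using subsetD[OF closure_subset that] by simp
  have "\<bar>LINT x:D|lborel. divergence f x\<bar> \<le> (M + 1) * \<epsilon>" if \<epsilon>: "0 < \<epsilon>" for \<epsilon>
  proof -
    obtain Y where Y: "open Y" "frontier D \<subseteq> Y" "cutoff D f Y (ennreal \<epsilon>)"
      using cutoff_frontier[OF D continuous_on_subset[OF fN N(2)] tan \<epsilon>] by blast
    obtain k G where kG: "\<And>x. x \<in> D \<Longrightarrow> (k has_derivative (\<lambda>h. G x \<bullet> h)) (at x)"
      "\<And>x. x \<in> D \<Longrightarrow> 0 \<le> k x" "\<And>x. x \<in> D \<Longrightarrow> k x \<le> 1" "continuous_on D G"
      "\<And>x. x \<in> D \<Longrightarrow> x \<in> Y \<Longrightarrow> k x = 0"
      "(\<integral>\<^sup>+x\<in>D. ennreal (\<bar>G x \<bullet> f x\<bar> + (1 - k x)) \<partial>lborel) \<le> ennreal \<epsilon>"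
      using Y(3) unfolding cutoff_def by auto
    have kc: "continuous_on D k"
      by (intro continuous_at_imp_continuous_on ballI has_derivative_continuous[OF kG(1)])
    \<comment> \<open>Because \<open>Y\<close> contains the frontier, this compact set lies inside
      \<open>D\<close>; it carries the support of \<open>k * f\<close>.\<close>
    define K where "K = closure D - Y"
    have K: "compact K" unfolding K_def using bD Y(1) by (intro compact_diff) auto
    have KD: "K \<subseteq> D" using Y(2) oD by (auto simp: K_def frontier_def interior_open)
    define h where "h i x = (if x \<in> D then k x * f x $ i else 0)" for i x
    define h' where "h' i x v = (if x \<in> D then k x * f' x v $ i + (G x \<bullet> v) * f x $ i else 0)" for i x v
    have hK: "h i x = 0" if "x \<notin> K" for i x
      using that kG(5)[of x] closure_subset[of D] by (auto simp: h_def K_def)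
    have hD: "(h i has_derivative h' i x) (at x)" if x: "x \<in> D" for i x
    proof (rule has_derivative_transform_within_open[OF _ oD x])
      show "((\<lambda>x. k x * f x $ i) has_derivative h' i x) (at x)"
        by (rule has_derivative_eq_rhs[OF has_derivative_mult[OF kG(1)[OF x]
              bounded_linear.has_derivative[OF bounded_linear_vec_nth f']]])
          (use x DN in \<open>auto simp: h'_def\<close>)
    qed (simp add: h_def)
    have h0: "(h i has_derivative (\<lambda>v. 0)) (at x)" if "x \<notin> K" for i x
      by (rule has_derivative_transform_within_open[OF has_derivative_const[of 0], where s = "- K"])
        (use that hK compact_imp_closed[OF K] in auto)
    have h'K: "h' i x = (\<lambda>v. 0)" if "x \<notin> K" for i x
      using has_derivative_unique[OF hD h0[OF that]] by (cases "x \<in> D") (auto simp: h'_def fun_eq_iff)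
    have h: "(h i has_derivative h' i x) (at x)" for i x
    proof (cases "x \<in> D")
      case False
      then have "x \<notin> K" using KD by auto
      with h0[of x i] h'K[of x i] show ?thesis by simp
    qed (rule hD)
    \<comment> \<open>Continuity is checked on the open sets \<open>D\<close> and
      \<open>- K\<close>, which together cover the space.\<close>
    have h'c: "continuous_on UNIV (\<lambda>x. h' i x v)" for i v
    proof -
      have "continuous_on D (\<lambda>x. k x * f' x v $ i + (G x \<bullet> v) * f x $ i)"
        by (intro continuous_intros kc kG(4) continuous_on_subset[OF fN DN] continuous_on_subset[OF f'c DN])
      then have "continuous_on D (\<lambda>x. h' i x v)"
        by (rule continuous_on_eq) (simp add: h'_def)
      moreover have "continuous_on (- K) (\<lambda>x. h' i x v)"
        by (rule continuous_on_eq[OF continuous_on_const[of _ 0]]) (use h'K in auto)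
      ultimately have "continuous_on (D \<union> - K) (\<lambda>x. h' i x v)"
        using oD compact_imp_closed[OF K] by (intro continuous_on_open_Un) auto
      then show ?thesis using KD by (simp add: Un_commute Compl_partition2 subset_UNIV sup.absorb_iff1
            le_sup_iff set_eq_iff subset_iff) (metis (no_types, lifting) UNIV_eq_I ComplI Un_iff subsetD)
    qed
    note h'0 = integral_directional_derivative_eq_0[OF h h'c K hK]
    have key: "(\<Sum>i\<in>UNIV. h' i x (axis i 1)) = indicator D x *\<^sub>R (k x * divergence f x + G x \<bullet> f x)" for x
    proof -
      have "G x \<bullet> f x = (\<Sum>i\<in>UNIV. G x $ i * f x $ i)" by (simp add: inner_vec_def)
      then show ?thesis
        by (cases "x \<in> D") (auto simp: h'_def div sum.distrib sum_distrib_left inner_axis)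
    qed
    have I1: "set_integrable lborel D (\<lambda>x. k x * divergence f x + G x \<bullet> f x)"
      unfolding set_integrable_def key[symmetric] by (intro Bochner_Integration.integrable_sum h'0(1))
    have I1': "(LINT x:D|lborel. k x * divergence f x + G x \<bullet> f x) = 0"
      unfolding set_lebesgue_integral_def key[symmetric]
      by (subst Bochner_Integration.integral_sum) (auto simp: h'0)
    have "(LINT x:D|lborel. divergence f x) =
        (LINT x:D|lborel. divergence f x) - (LINT x:D|lborel. k x * divergence f x + G x \<bullet> f x)"
      by (simp add: I1')
    also have "\<dots> = (LINT x:D|lborel. divergence f x - (k x * divergence f x + G x \<bullet> f x))"
      by (rule set_integral_diff(2)[OF int I1, symmetric])
    finally have eq: "(LINT x:D|lborel. divergence f x) =
       (LINT x|lborel. indicator D x *\<^sub>R (divergence f x - (k x * divergence f x + G x \<bullet> f x)))"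
      by (simp add: set_lebesgue_integral_def)
    let ?F = "\<lambda>x. indicator D x *\<^sub>R (divergence f x - (k x * divergence f x + G x \<bullet> f x))"
    have "integrable lborel ?F"
      using set_integral_diff(1)[OF int I1] by (simp add: set_integrable_def)
    then have "ennreal \<bar>integral\<^sup>L lborel ?F\<bar> \<le> (\<integral>\<^sup>+x. ennreal (norm (?F x)) \<partial>lborel)"
      using integral_norm_bound_ennreal by fastforce
    also have "\<dots> \<le> (\<integral>\<^sup>+x. ennreal (M + 1) * (ennreal (\<bar>G x \<bullet> f x\<bar> + (1 - k x)) * indicator D x) \<partial>lborel)"
    proof (rule nn_integral_mono)
      fix x
      show "ennreal (norm (?F x)) \<le> ennreal (M + 1) * (ennreal (\<bar>G x \<bullet> f x\<bar> + (1 - k x)) * indicator D x)"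
      proof (cases "x \<in> D")
        case True
        have "\<bar>divergence f x - (k x * divergence f x + G x \<bullet> f x)\<bar> \<le>
            (1 - k x) * \<bar>divergence f x\<bar> + \<bar>G x \<bullet> f x\<bar>"
        proof -
          have "divergence f x - (k x * divergence f x + G x \<bullet> f x) = (1 - k x) * divergence f x - G x \<bullet> f x"
            by (simp add: algebra_simps)
          then show ?thesis
            using kG(3)[OF True] abs_triangle_ineq4[of "(1 - k x) * divergence f x" "G x \<bullet> f x"]
            by (simp add: abs_mult)
        qed
        also have "\<dots> \<le> (1 - k x) * M + M * \<bar>G x \<bullet> f x\<bar> + (1 - k x) + \<bar>G x \<bullet> f x\<bar>"
        proof -
          have "(1 - k x) * \<bar>divergence f x\<bar> \<le> (1 - k x) * M"
            using kG(3)[OF True] M[OF True] by (intro mult_left_mono) auto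
          moreover have "0 \<le> M * \<bar>G x \<bullet> f x\<bar>" using M0 by simp
          ultimately show ?thesis using kG(3)[OF True] by linarith
        qed
        also have "\<dots> = (M + 1) * (\<bar>G x \<bullet> f x\<bar> + (1 - k x))" by (simp add: algebra_simps)
        finally show ?thesis
          using True M0 kG(3)[OF True] by (simp add: ennreal_mult[symmetric] ennreal_leI del: ennreal_plus)
      qed simp
    qed
    also have "\<dots> = ennreal (M + 1) * (\<integral>\<^sup>+x\<in>D. ennreal (\<bar>G x \<bullet> f x\<bar> + (1 - k x)) \<partial>lborel)"
      by (intro nn_integral_cmult borel_measurable_indicator_times oD continuous_intros kG(4) kc
          continuous_on_subset[OF fN DN])
    also have "\<dots> \<le> ennreal (M + 1) * ennreal \<epsilon>"
      by (intro mult_left_mono kG(6)) simp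
    also have "\<dots> = ennreal ((M + 1) * \<epsilon>)" using M0 \<epsilon> by (simp add: ennreal_mult)
    finally show ?thesis unfolding eq using M0 \<epsilon> by (simp add: ennreal_le_iff)
  qed
  note bound = this
  show "(LINT x:D|lborel. divergence f x) = 0"
  proof (rule ccontr)
    let ?L = "\<bar>LINT x:D|lborel. divergence f x\<bar>"
    assume "(LINT x:D|lborel. divergence f x) \<noteq> 0"
    then have L: "0 < ?L" by simp
    define m where "m = M + 1"
    have m: "0 < m" using M0 by (simp add: m_def)
    \<comment> \<open>The bound is applied to the accuracy for which it would be half of the
      integral itself.\<close>
    have "?L \<le> m * (?L / 2 / m)"
      using bound[of "?L / 2 / m"] L m by (simp add: m_def)
    also have "\<dots> = ?L / 2" using m by simp
    finally show False using L by simp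
  qed
qed

section \<open>Regular domains under diffeomorphisms\<close>

lemma image_closure_frontier:
  fixes f :: "'a::euclidean_space \<Rightarrow> 'a"
  assumes D: "open D" "bounded D" "closure D \<subseteq> A" and A: "open A" "continuous_on A f" "inj_on f A"
  shows "open (f ` D)" "bounded (f ` D)" "closure (f ` D) = f ` closure D"
    "frontier (f ` D) = f ` frontier D"
proof -
  have DA: "D \<subseteq> A" using D(3) closure_subset by blast
  show o: "open (f ` D)"
    using D(1) A(2,3) DA by (intro invariance_of_domain) (auto intro: continuous_on_subset inj_on_subset)
  have "compact (f ` closure D)"
    using D(2,3) A(2) by (intro compact_continuous_image continuous_on_subset[OF A(2)]) auto
  then have "closed (f ` closure D)" "bounded (f ` closure D)"
    by (auto intro: compact_imp_closed compact_imp_bounded)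
  then show "bounded (f ` D)" using closure_subset bounded_subset image_mono by metis
  have "closure (f ` D) \<subseteq> f ` closure D"
    by (rule closure_minimal) (use \<open>closed (f ` closure D)\<close> closure_subset in auto)
  moreover have "f ` closure D \<subseteq> closure (f ` D)"
    by (rule image_closure_subset[OF continuous_on_subset[OF A(2) D(3)] closed_closure closure_subset])
  ultimately show c: "closure (f ` D) = f ` closure D" by blast
  have "f ` closure D - f ` D = f ` (closure D - D)"
    using inj_on_image_set_diff[OF A(3), of "closure D" D] D(3) DA by auto
  then show "frontier (f ` D) = f ` frontier D"
    by (simp add: frontier_def interior_open o D(1) c)
qed

text \<open>The mean value inequality needs convexity, which \<open>K\<close> may lack. It is
  therefore applied in small balls, and compactness turns the local Lipschitz constants into a
  global one.\<close>

lemma C1_lipschitz_on_compact: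
  fixes f :: "'a::euclidean_space \<Rightarrow> 'b::real_normed_vector"
  assumes A: "open A" "Ck_on 1 f A" and K: "compact K" "K \<subseteq> A"
  obtains L where "L-lipschitz_on K f"
proof -
  \<comment> \<open>A one-point time set reduces the time-dependent notion to the local Lipschitz
    property of \<open>f\<close> alone.\<close>
  have "local_lipschitz {0::real} K (\<lambda>t. f)"
  proof (rule local_lipschitzI)
    fix t :: real and x assume x: "x \<in> K"
    obtain u where u: "0 < u" "cball x u \<subseteq> A" using A(1) K(2) x open_contains_cball by blast
    have "continuous_on (cball x u) (\<lambda>y. \<Sum>b\<in>Basis. norm (fderiv f y b))"
      using A(2) by (intro continuous_intros) (auto intro: continuous_on_subset[OF _ u(2)])
    then have "bounded ((\<lambda>y. \<Sum>b\<in>Basis. norm (fderiv f y b)) ` cball x u)"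
      by (intro compact_imp_bounded compact_continuous_image) auto
    then obtain L where L: "0 < L"
      "\<And>y. y \<in> cball x u \<Longrightarrow> \<bar>\<Sum>b\<in>Basis. norm (fderiv f y b)\<bar> \<le> L"
      unfolding bounded_pos by (auto simp: real_norm_def)
    have "norm (f y - f z) \<le> L * norm (y - z)" if yz: "y \<in> cball x u" "z \<in> cball x u" for y z
    proof (rule differentiable_bound[OF convex_cball _ _ yz])
      fix w assume w: "w \<in> cball x u"
      have d: "(f has_derivative fderiv f w) (at w)"
        using Ck_on_has_derivative[OF A(2), of w] u(2) w by auto
      then show "(f has_derivative fderiv f w) (at w within cball x u)"
        by (rule has_derivative_at_withinI)
      show "onorm (fderiv f w) \<le> L"
      proof (rule onorm_bound)
        fix h
        note linear_euclidean_expansion[OF has_derivative_linear[OF d], of h]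
        then have "norm (fderiv f w h) \<le> (\<Sum>b\<in>Basis. \<bar>h \<bullet> b\<bar> * norm (fderiv f w b))"
          using norm_sum[of "\<lambda>b. (h \<bullet> b) *\<^sub>R fderiv f w b" Basis] by simp
        also have "\<dots> \<le> (\<Sum>b\<in>Basis. norm h * norm (fderiv f w b))"
          by (intro sum_mono mult_right_mono) (auto simp: Basis_le_norm)
        also have "\<dots> = (\<Sum>b\<in>Basis. norm (fderiv f w b)) * norm h"
          by (simp add: sum_distrib_left mult.commute)
        also have "\<dots> \<le> L * norm h"
          using L(2)[OF w] by (intro mult_right_mono) auto
        finally show "norm (fderiv f w h) \<le> L * norm h" .
      qed (use L in simp)
    qed
    then have "L-lipschitz_on (cball x u) f"
      using L(1) by (intro lipschitz_onI) (auto simp: dist_norm)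
    then show "\<exists>u>0. \<exists>L. \<forall>t\<in>cball t u \<inter> {0}. L-lipschitz_on (cball x u \<inter> K) f"
      using u(1) lipschitz_on_subset[OF _ Int_lower1] by (intro exI[of _ u] conjI exI[of _ L]) auto
  qed
  then obtain L where "\<And>t. t \<in> {0::real} \<Longrightarrow> L-lipschitz_on K f"
    by (rule local_lipschitz_compact_implies_lipschitz[OF _ K(1)]) auto
  then show ?thesis using that by blast
qed

text \<open>The images of covering balls lie in balls of proportional radius, so the sum of squared
  radii grows by a fixed factor only.\<close>

lemma null_area_lipschitz_image:
  assumes "null_area K" and lip: "L-lipschitz_on K f"
  shows "null_area (f ` K)"
  unfolding null_area_def
proof (intro allI impI)
  fix \<epsilon> :: real assume \<epsilon>: "0 < \<epsilon>"
  define M where "M = L + 1"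
  have M: "0 < M" using lipschitz_on_nonneg[OF lip] by (simp add: M_def)
  have lip: "dist (f x) (f y) \<le> M * dist x y" if "x \<in> K" "y \<in> K" for x y
    using lipschitz_onD[OF lip that] by (simp add: M_def distrib_right add_increasing2)
  obtain C :: "((real^3) \<times> real) set" where C: "finite C" "\<forall>(p, r)\<in>C. r > 0"
      "K \<subseteq> (\<Union>(p, r)\<in>C. ball p r)" "(\<Sum>(p, r)\<in>C. r\<^sup>2) < \<epsilon> / (2 * M)\<^sup>2"
    using assms(1)[unfolded null_area_def, rule_format, of "\<epsilon> / (2 * M)\<^sup>2"] \<epsilon> M by auto
  \<comment> \<open>The centre of a covering ball may lie off \<open>K\<close>, where the Lipschitz
    bound says nothing. Each ball that meets \<open>K\<close> is recentred at a point of
    \<open>K\<close>, at the price of doubling its radius.\<close>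
  define C' where "C' = {i \<in> C. ball (fst i) (snd i) \<inter> K \<noteq> {}}"
  have "\<forall>i\<in>C'. \<exists>q. q \<in> ball (fst i) (snd i) \<inter> K" by (auto simp: C'_def)
  then obtain q where q: "\<And>i. i \<in> C' \<Longrightarrow> q i \<in> ball (fst i) (snd i) \<inter> K" by metis
  define F where "F i = (f (q i), 2 * M * snd i)" for i
  have fin: "finite C'" using C(1) by (simp add: C'_def)
  show "\<exists>C. finite C \<and> (\<forall>(p, r)\<in>C. r > 0) \<and> f ` K \<subseteq> (\<Union>(p, r)\<in>C. ball p r) \<and> (\<Sum>(p, r)\<in>C. r\<^sup>2) < \<epsilon>"
  proof (intro exI[of _ "F ` C'"] conjI)
    show "\<forall>(p, r)\<in>F ` C'. r > 0" using C(2) M by (auto simp: F_def C'_def)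
    show "f ` K \<subseteq> (\<Union>(p, r)\<in>F ` C'. ball p r)"
    proof clarify
      fix x assume x: "x \<in> K"
      obtain i where i: "i \<in> C" "x \<in> ball (fst i) (snd i)" using C(3) x by fastforce
      then have iC': "i \<in> C'" using x by (auto simp: C'_def)
      have "dist (q i) x < 2 * snd i"
        using q[OF iC'] i(2) dist_triangle_half_r[of "fst i" "q i" "2 * snd i" x] by simp
      then have "M * dist (q i) x < M * (2 * snd i)" using M by simp
      then have "dist (f (q i)) (f x) < 2 * M * snd i"
        using lip[of "q i" x] q[OF iC'] x by (simp add: mult.assoc mult.left_commute)
      then show "f x \<in> (\<Union>(p, r)\<in>F ` C'. ball p r)"
        using iC' by (auto simp: F_def intro!: bexI[of _ i])
    qed
    \<comment> \<open>The new cover is a set, so coinciding balls merge and only an inequality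
      holds.\<close>
    have "(\<Sum>(p, r)\<in>F ` C'. r\<^sup>2) \<le> (\<Sum>i\<in>C'. (2 * M)\<^sup>2 * (snd i)\<^sup>2)"
    proof -
      have "(\<Sum>(p, r)\<in>F ` C'. r\<^sup>2) \<le> (\<Sum>i\<in>C'. ((\<lambda>(p, r). r\<^sup>2) \<circ> F) i)"
        by (rule sum_image_le[OF fin]) (auto simp: case_prod_beta)
      then show ?thesis by (simp add: F_def power_mult_distrib)
    qed
    also have "\<dots> \<le> (\<Sum>i\<in>C. (2 * M)\<^sup>2 * (snd i)\<^sup>2)"
      by (rule sum_mono2[OF C(1)]) (auto simp: C'_def)
    also have "\<dots> = (2 * M)\<^sup>2 * (\<Sum>(p, r)\<in>C. r\<^sup>2)"
      by (simp add: sum_distrib_left case_prod_beta)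
    also have "\<dots> < \<epsilon>"
    proof -
      have "0 < (2 * M)\<^sup>2" using M by simp
      with C(4) show ?thesis by (simp only: pos_less_divide_eq mult.commute)
    qed
    finally show "(\<Sum>(p, r)\<in>F ` C'. r\<^sup>2) < \<epsilon>" .
  qed (use fin in auto)
qed

lemma null_area_mono: "null_area A \<Longrightarrow> B \<subseteq> A \<Longrightarrow> null_area B"
  unfolding null_area_def by (meson order_trans)

section \<open>Jacobians and normals under a change of coordinates\<close>

lemma jacobian_eqI:
  fixes f :: "real^'n \<Rightarrow> real^'m"
  assumes "(f has_derivative (\<lambda>h. F *v h)) (at x)"
  shows "jacobian f (at x) = F"
  by (simp add: jacobian_def frechet_derivative_at[OF assms, symmetric])

lemma grad_eqI:
  assumes "(g has_derivative (\<lambda>h. G \<bullet> h)) (at x)"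
  shows "grad g x = G"
  by (simp add: grad_def frechet_derivative_at[OF assms, symmetric] vec_eq_iff inner_axis)

lemma jacobian_has_derivative:
  fixes f :: "real^'n \<Rightarrow> real^'m"
  shows "f differentiable (at x) \<Longrightarrow> (f has_derivative (\<lambda>h. jacobian f (at x) *v h)) (at x)"
  by (simp add: jacobian_works[symmetric])

lemma det_jacobian_nonzero:
  fixes f g :: "real^'n \<Rightarrow> real^'n"
  assumes "open A" "x \<in> A" "\<And>y. y \<in> A \<Longrightarrow> g (f y) = y"
    and f: "f differentiable (at x)" and g: "g differentiable (at (f x))"
  shows "det (jacobian f (at x)) \<noteq> 0" "det (jacobian g (at (f x))) \<noteq> 0"
proof -
  let ?F = "jacobian f (at x)" and ?G = "jacobian g (at (f x))"
  have "((\<lambda>y. g (f y)) has_derivative (\<lambda>h. ?G *v (?F *v h))) (at x)"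
    by (rule has_derivative_compose[OF jacobian_has_derivative[OF f] jacobian_has_derivative[OF g]])
  moreover have "((\<lambda>y. g (f y)) has_derivative (\<lambda>h. h)) (at x)"
    by (rule has_derivative_transform_within_open[OF has_derivative_ident assms(1,2)]) (simp add: assms(3))
  ultimately have "(\<lambda>h. ?G *v (?F *v h)) = (\<lambda>h. h)" by (rule has_derivative_unique)
  then have "(?G ** ?F) *v h = mat 1 *v h" for h by (metis matrix_vector_mul_assoc matrix_vector_mul_lid)
  then have "?G ** ?F = mat 1" by (simp add: matrix_eq)
  then have "det ?G * det ?F = 1" by (metis det_mul det_I)
  then show "det ?F \<noteq> 0" "det ?G \<noteq> 0" by auto
qed

lemma inner_matrix_vector: "n \<bullet> (A *v h) = (transpose A *v n) \<bullet> (h :: real^'n)"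
  by (simp add: dot_lmul_matrix[symmetric])

text \<open>If \<open>g\<close> defines the image locally, then the composition of \<open>g\<close>
  with \<open>f\<close> defines \<open>S\<close>. Its gradient is the transposed Jacobian applied to
  \<open>grad g\<close>, nonzero by invertibility, and injectivity ensures that no other part of
  \<open>S\<close> is mapped there. Normals thus pull back by the transpose, dual to vectors pushed
  forward by the Jacobian.\<close>

lemma outward_normal_pullback:
  fixes f :: "real^3 \<Rightarrow> real^3"
  assumes A: "open A" "Ck_on 1 f A" "inj_on f A" and det: "\<And>y. y \<in> A \<Longrightarrow> det (jacobian f (at y)) \<noteq> 0"
    and S: "S \<subseteq> A" "x \<in> A" and n: "outward_normal (f ` S) (f x) n"
  shows "outward_normal S x (transpose (jacobian f (at x)) *v n)"
proof -
  obtain U g where U: "open U" "f x \<in> U" "Ck_on 1 g U" "\<And>x. x \<in> U \<Longrightarrow> grad g x \<noteq> 0"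
      "f ` S \<inter> U = {x\<in>U. g x < 0}" "g (f x) = 0" "n = grad g (f x)"
    using n unfolding outward_normal_def by auto
  define X where "X = A \<inter> f -` U"
  have X: "open X" "x \<in> X" "X \<subseteq> A"
    unfolding X_def using continuous_open_preimage[OF Ck_on_imp_continuous_on[OF A(2)] A(1) U(1)] U(2) S(2)
    by auto
  have gf: "((\<lambda>y. g (f y)) has_derivative (\<lambda>h. (transpose (jacobian f (at y)) *v grad g (f y)) \<bullet> h)) (at y)"
    if y: "y \<in> X" for y
  proof -
    have "f differentiable (at y)" "g differentiable (at (f y))"
      using Ck_on_differentiable[OF A(2)] Ck_on_differentiable[OF U(3)] y by (auto simp: X_def)
    from has_derivative_compose[OF jacobian_has_derivative[OF this(1)] grad_has_derivative[OF this(2)]]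
    show ?thesis by (simp add: inner_matrix_vector)
  qed
  have grad: "grad (\<lambda>y. g (f y)) y = transpose (jacobian f (at y)) *v grad g (f y)" if "y \<in> X" for y
    by (rule grad_eqI[OF gf[OF that]])
  have "transpose (jacobian f (at y)) *v grad g (f y) \<noteq> 0" if y: "y \<in> X" for y
  proof -
    have "invertible (transpose (jacobian f (at y)))"
      using det[of y] y X(3) by (simp add: invertible_det_nz det_transpose subset_iff)
    then have "\<forall>v. transpose (jacobian f (at y)) *v v = 0 \<longrightarrow> v = 0"
      unfolding matrix_left_invertible_ker[symmetric] invertible_def by blast
    with U(4)[of "f y"] y show ?thesis by (auto simp: X_def)
  qed
  moreover have "S \<inter> X = {y \<in> X. g (f y) < 0}"
  proof -
    have "y \<in> S \<longleftrightarrow> g (f y) < 0" if y: "y \<in> X" for y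
    proof -
      have "y \<in> S \<longleftrightarrow> f y \<in> f ` S"
        using inj_on_image_mem_iff[OF A(3) _ S(1)] y X(3) by (metis subsetD)
      also have "\<dots> \<longleftrightarrow> f y \<in> f ` S \<inter> U" using y by (simp add: X_def)
      also have "\<dots> \<longleftrightarrow> g (f y) < 0" unfolding U(5) using y by (simp add: X_def)
      finally show ?thesis .
    qed
    then show ?thesis by blast
  qed
  moreover have "Ck_on 1 (\<lambda>y. g (f y)) X"
    by (rule Ck_on_compose[OF X(1) U(1) Ck_on_subset[OF A(2) X(3)] U(3)]) (auto simp: X_def)
  ultimately show ?thesis
    unfolding outward_normal_def using X U(6,7)
    by (intro exI[of _ X] exI[of _ "\<lambda>y. g (f y)"]) (auto simp: grad)
qed

text \<open>A normal at a frontier point of \<open>D\<close> becomes one of the image by pulling it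
  back along the inverse \<open>g\<close>. Hence singular points of the image come from singular
  points of \<open>D\<close>, and their area stays zero because \<open>f\<close> is Lipschitz on the
  compact frontier.\<close>

lemma regular_domain_image:
  assumes D: "regular_domain D" "closure D \<subseteq> A" and A: "open A" "Ck_on 1 f A"
    and g: "open (f ` A)" "Ck_on 1 g (f ` A)" "\<And>x. x \<in> A \<Longrightarrow> g (f x) = x"
  shows "regular_domain (f ` D)"
proof -
  have inj: "inj_on f A" using g(3) by (metis inj_on_inverseI)
  have D': "open D" "bounded D" using D(1) by (auto simp: regular_domain_def)
  have DA: "D \<subseteq> A" using D(2) closure_subset by blast
  note im = image_closure_frontier[OF D' D(2) A(1) Ck_on_imp_continuous_on[OF A(2)] inj]
  let ?K = "{p \<in> frontier D. \<nexists>n. outward_normal D p n}"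
  have "{p \<in> frontier (f ` D). \<nexists>n. outward_normal (f ` D) p n} \<subseteq> f ` ?K"
  proof clarify
    fix p assume p: "p \<in> frontier (f ` D)" "\<nexists>n. outward_normal (f ` D) p n"
    then obtain x where x: "x \<in> frontier D" "p = f x" using im(4) by auto
    have xA: "x \<in> A" using x(1) D(2) by (auto simp: frontier_def)
    have "\<nexists>n. outward_normal D x n"
    proof
      assume "\<exists>n. outward_normal D x n"
      then obtain n where n: "outward_normal D x n" by blast
      have gfD: "g ` (f ` D) = D" using g(3) DA by (force simp: image_image)
      have "outward_normal (f ` D) (f x) (transpose (jacobian g (at (f x))) *v n)"
      proof (rule outward_normal_pullback[OF g(1,2)])
        show "inj_on g (f ` A)" using g(3) by (auto intro!: inj_onI)
        show "det (jacobian g (at y)) \<noteq> 0" if "y \<in> f ` A" for y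
          using that det_jacobian_nonzero(2)[where A = A and f = f and g = g, OF A(1) _ g(3)] Ck_on_differentiable[OF A(2)]
            Ck_on_differentiable[OF g(2)] by auto
        show "outward_normal (g ` f ` D) (g (f x)) n" using n xA by (simp add: gfD g(3))
      qed (use DA xA in auto)
      with p(2) x(2) show False by blast
    qed
    with x show "p \<in> f ` ?K" by blast
  qed
  moreover have "null_area (f ` ?K)"
  proof -
    obtain L where "L-lipschitz_on (frontier D) f"
      by (rule C1_lipschitz_on_compact[OF A(1,2) compact_frontier_bounded[OF D'(2)]])
        (use D(2) in \<open>auto simp: frontier_def\<close>)
    then have "L-lipschitz_on ?K f" by (rule lipschitz_on_subset) auto
    then show ?thesis using null_area_lipschitz_image D(1) by (auto simp: regular_domain_def)
  qed
  ultimately show ?thesis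
    using im(1,2) null_area_mono by (auto simp: regular_domain_def)
qed

section \<open>Kinematics of a motion\<close>

lemma slice_space:
  assumes "(case_prod f has_derivative f') (at (t, x))"
  shows "(f t has_derivative (\<lambda>h. f' (0, h))) (at x)"
proof -
  have "((\<lambda>y. (t, y)) has_derivative (\<lambda>h. (0, h))) (at x)"
    by (auto intro!: derivative_eq_intros)
  from has_derivative_compose[OF this assms] show ?thesis by simp
qed

lemma slice_curve:
  assumes f: "(case_prod f has_derivative f') (at (t, c t))" and c: "(c has_vector_derivative c') (at t)"
  shows "((\<lambda>s. f s (c s)) has_vector_derivative f' (1, c')) (at t)"
proof -
  have "((\<lambda>s. (s, c s)) has_derivative (\<lambda>r. (r, r *\<^sub>R c'))) (at t)"
    using c unfolding has_vector_derivative_def by (auto intro!: derivative_eq_intros)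
  from has_derivative_compose[OF this f] have "((\<lambda>s. f s (c s)) has_derivative (\<lambda>r. f' (r, r *\<^sub>R c'))) (at t)"
    by simp
  moreover have "f' (r, r *\<^sub>R c') = r *\<^sub>R f' (1, c')" for r
    using linear_scale[OF has_derivative_linear[OF f], of r "(1, c')"] by simp
  ultimately show ?thesis by (simp add: has_vector_derivative_def)
qed

lemma slice_time:
  assumes "(case_prod f has_derivative f') (at (t, x))"
  shows "((\<lambda>s. f s x) has_vector_derivative f' (1, 0)) (at t)"
  using slice_curve[of f f' t "\<lambda>s. x" 0] assms by simp

lemma jacobian_slice:
  fixes f :: "real \<Rightarrow> real^3 \<Rightarrow> real^3"
  assumes "(case_prod f has_derivative f') (at (t, x))"
  shows "jacobian (f t) (at x) *v h = f' (0, h)" "f t differentiable (at x)"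
proof -
  have d: "(f t has_derivative (\<lambda>h. f' (0, h))) (at x)" by (rule slice_space[OF assms])
  then show "f t differentiable (at x)" by (rule differentiableI)
  then have "(\<lambda>h. jacobian (f t) (at x) *v h) = (\<lambda>h. f' (0, h))"
    using has_derivative_unique[OF jacobian_has_derivative d] by blast
  then show "jacobian (f t) (at x) *v h = f' (0, h)" by (rule fun_cong)
qed

lemma time_deriv_slice:
  assumes "(case_prod f has_derivative f') (at (t, x))"
  shows "time_deriv f t x = f' (1, 0)"
  unfolding time_deriv_def by (rule vector_derivative_at[OF slice_time[OF assms]])

lemma joint_derivative_split:
  fixes f :: "real \<Rightarrow> real^3 \<Rightarrow> real^3"
  assumes "(case_prod f has_derivative f') (at (t, x))"
  shows "f' (1, h) = time_deriv f t x + jacobian (f t) (at x) *v h"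
proof -
  have "f' (1, h) = f' ((1, 0) + (0, h))" by simp
  also have "\<dots> = f' (1, 0) + f' (0, h)"
    by (rule linear_add[OF has_derivative_linear[OF assms]])
  finally show ?thesis by (simp add: time_deriv_slice[OF assms] jacobian_slice[OF assms])
qed

lemma Ck_on_slice:
  fixes f :: "real \<Rightarrow> real^3 \<Rightarrow> 'b::real_normed_vector"
  assumes f: "Ck_on k (case_prod f) R" "open R" and S: "open S" "\<And>x. x \<in> S \<Longrightarrow> (t, x) \<in> R"
  shows "Ck_on k (f t) S"
proof -
  have "Ck_on k (\<lambda>x::real^3. (t, x)) S"
    by (intro Ck_on_Pair Ck_on_const Ck_on_bounded_linear_fun bounded_linear_ident S)
  from Ck_on_compose[OF S(1) f(2) this f(1)] S(2) show ?thesis by auto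
qed

lemma matrix_column_entry: "A $ i $ j = (A *v axis j 1) $ i" for A :: "real^'n^'m"
  by (simp add: matrix_vector_mul_component inner_axis)

text \<open>Jacobi's formula for \<open>A' = L A\<close>, checked by expanding the determinant. The
  hypothesis is stated on vectors \<open>A s *v h\<close> since that is how the derivatives of the
  deformation gradient arise.\<close>

lemma det_has_real_derivative:
  fixes A :: "real \<Rightarrow> real^3^3"
  assumes "\<And>h. ((\<lambda>s. A s *v h) has_vector_derivative L *v (A t *v h)) (at t within S)"
  shows "((\<lambda>s. det (A s)) has_real_derivative trace L * det (A t)) (at t within S)"
proof -
  have e: "((\<lambda>s. A s $ i $ j) has_real_derivative (\<Sum>k\<in>UNIV. L $ i $ k * A t $ k $ j)) (at t within S)" for i j
  proof -
    have "((\<lambda>s. (A s *v axis j 1) $ i) has_vector_derivative (L *v (A t *v axis j 1)) $ i) (at t within S)"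
      by (rule bounded_linear.has_vector_derivative[OF bounded_linear_vec_nth assms])
    moreover have "(L *v (A t *v axis j 1)) $ i = (\<Sum>k\<in>UNIV. L $ i $ k * A t $ k $ j)"
      by (simp add: matrix_vector_mul_component[of L] inner_vec_def matrix_column_entry[of "A t"])
    ultimately show ?thesis
      by (simp add: matrix_column_entry[of "A _", symmetric] has_real_derivative_iff_has_vector_derivative)
  qed
  show ?thesis
    unfolding det_3
    by (rule derivative_eq_intros e refl)+
      (simp add: sum_3 trace_def, algebra)
qed

lemma continuous_on_matrix_vector_mult [continuous_intros]:
  fixes A :: "'a::topological_space \<Rightarrow> real^'n^'m"
  assumes "continuous_on S A" "continuous_on S v"
  shows "continuous_on S (\<lambda>z. A z *v v z)"
  unfolding matrix_vector_mult_def by (intro continuous_intros assms)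

lemma continuous_on_det [continuous_intros]:
  fixes A :: "'a::topological_space \<Rightarrow> real^3^3"
  assumes "continuous_on S A"
  shows "continuous_on S (\<lambda>z. det (A z))"
  unfolding det_3 by (intro continuous_intros assms)

text \<open>Kinematics only, without forces or density. The locale can therefore be interpreted a
  second time, for the same velocity field with the initial positions as reference
  coordinates.\<close>

locale flow =
  fixes T :: "real set" and N :: "(real^3) set" and \<phi> u :: "real \<Rightarrow> real^3 \<Rightarrow> real^3"
  assumes motion: "motion T N \<phi>" and velocity: "velocity_of_motion T N \<phi> u"
    and u_smooth: "Ck_on 2 (case_prod u) (eulerian_region T N \<phi>)"
begin

definition R :: "(real \<times> (real^3)) set" where "R = eulerian_region T N \<phi>"

definition F :: "real \<Rightarrow> real^3 \<Rightarrow> real^3^3" where "F t X = jacobian (\<phi> t) (at X)"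

definition A :: "real \<Rightarrow> real^3 \<Rightarrow> real^3^3" where "A t x = jacobian (u t) (at x)"

lemma opens: "open T" "open N" "open (T \<times> N)" "is_interval T"
  using motion by (auto simp: motion_def intro: open_Times)

lemma phi_smooth: "Ck_on 2 (case_prod \<phi>) (T \<times> N)"
  using motion by (simp add: motion_def)

lemma inj: "t \<in> T \<Longrightarrow> inj_on (\<phi> t) N"
  and open_image: "t \<in> T \<Longrightarrow> open (\<phi> t ` N)"
  and inv_smooth: "t \<in> T \<Longrightarrow> Ck_on 2 (inv_into N (\<phi> t)) (\<phi> t ` N)"
  using motion by (auto simp: motion_def)

lemma in_R: "t \<in> T \<Longrightarrow> X \<in> N \<Longrightarrow> (t, \<phi> t X) \<in> R"
  by (auto simp: R_def eulerian_region_def)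

lemma R_iff: "(t, x) \<in> R \<longleftrightarrow> t \<in> T \<and> x \<in> \<phi> t ` N"
  by (auto simp: R_def eulerian_region_def)

lemma lagrange_smooth: "Ck_on 2 (\<lambda>(t, X). (t, \<phi> t X)) (T \<times> N)"
  using phi_smooth unfolding case_prod_beta
  by (intro Ck_on_Pair[OF opens(3) Ck_on_bounded_linear_fun[OF opens(3) bounded_linear_fst]])

lemma inj_lagrange: "inj_on (\<lambda>(t, X). (t, \<phi> t X)) (T \<times> N)"
  using inj by (auto simp: inj_on_def)

lemma image_lagrange: "(\<lambda>(t, X). (t, \<phi> t X)) ` (T \<times> N) = R"
  by (auto simp: R_def eulerian_region_def)

lemma open_R: "open R"
  using invariance_of_domain[OF Ck_on_imp_continuous_on[OF lagrange_smooth] opens(3) inj_lagrange]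
  by (simp add: image_lagrange)

lemmas u_C2 = u_smooth[folded R_def]

lemma u_deriv:
  "(t, x) \<in> R \<Longrightarrow> (case_prod u has_derivative fderiv (case_prod u) (t, x)) (at (t, x))"
  using Ck_on_has_derivative[OF u_smooth] by (simp add: R_def)

lemma phi_deriv:
  "t \<in> T \<Longrightarrow> X \<in> N \<Longrightarrow>
    (case_prod \<phi> has_derivative fderiv (case_prod \<phi>) (t, X)) (at (t, X))"
  using Ck_on_has_derivative[OF phi_smooth] by simp

lemma phi_differentiable: "t \<in> T \<Longrightarrow> X \<in> N \<Longrightarrow> \<phi> t differentiable (at X)"
  using jacobian_slice(2)[OF phi_deriv] .

lemma phi_has_derivative: "t \<in> T \<Longrightarrow> X \<in> N \<Longrightarrow> (\<phi> t has_derivative (\<lambda>h. F t X *v h)) (at X)"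
  unfolding F_def by (intro jacobian_has_derivative phi_differentiable)

lemma u_has_derivative: "(t, x) \<in> R \<Longrightarrow> (u t has_derivative (\<lambda>h. A t x *v h)) (at x)"
  unfolding A_def by (intro jacobian_has_derivative jacobian_slice(2)[OF u_deriv])

lemma det_F_nonzero:
  assumes "t \<in> T" "X \<in> N"
  shows "det (F t X) \<noteq> 0"
  unfolding F_def
  by (rule det_jacobian_nonzero(1)[where g = "inv_into N (\<phi> t)" and A = N])
    (use assms opens inj phi_differentiable Ck_on_differentiable[OF inv_smooth] in auto)

lemma F_eq: "t \<in> T \<Longrightarrow> X \<in> N \<Longrightarrow> F t X *v h = fderiv (case_prod \<phi>) (t, X) (0, h)"
  unfolding F_def by (rule jacobian_slice(1)[OF phi_deriv])

lemma A_eq: "(t, x) \<in> R \<Longrightarrow> A t x *v h = fderiv (case_prod u) (t, x) (0, h)"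
  unfolding A_def by (rule jacobian_slice(1)[OF u_deriv])

lemma phi_velocity:
  assumes "t \<in> T" "X \<in> N"
  shows "((\<lambda>s. \<phi> s X) has_vector_derivative u t (\<phi> t X)) (at t)"
    "fderiv (case_prod \<phi>) (t, X) (1, 0) = u t (\<phi> t X)"
proof -
  show eq: "fderiv (case_prod \<phi>) (t, X) (1, 0) = u t (\<phi> t X)"
    using velocity assms time_deriv_slice[OF phi_deriv[OF assms]] by (simp add: velocity_of_motion_def)
  show "((\<lambda>s. \<phi> s X) has_vector_derivative u t (\<phi> t X)) (at t)"
    using slice_time[OF phi_deriv[OF assms]] by (simp add: eq)
qed

lemma along_motion:
  fixes f :: "real \<Rightarrow> real^3 \<Rightarrow> real^3"
  assumes "t \<in> T" "X \<in> N" "case_prod f differentiable (at (t, \<phi> t X))"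
  shows "((\<lambda>s. f s (\<phi> s X)) has_vector_derivative
    (time_deriv f t (\<phi> t X) + jacobian (f t) (at (\<phi> t X)) *v u t (\<phi> t X))) (at t)"
proof -
  have d: "(case_prod f has_derivative fderiv (case_prod f) (t, \<phi> t X)) (at (t, \<phi> t X))"
    using assms(3) frechet_derivative_works by blast
  show ?thesis
    using slice_curve[where c = "\<lambda>s. \<phi> s X", OF d phi_velocity(1)[OF assms(1,2)]]
    by (simp add: joint_derivative_split[OF d])
qed

text \<open>The order of the time derivative and the Lagrangian derivative of the C2 motion is
  exchanged; the time derivative of \<open>\<phi>\<close> is \<open>u\<close> along the motion, and
  the chain rule yields \<open>A F\<close>.\<close>

lemma F_time_derivative:
  assumes t: "t \<in> T" and X: "X \<in> N"
  shows "((\<lambda>s. F s X *v h) has_vector_derivative A t (\<phi> t X) *v (F t X *v h)) (at t)"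
proof -
  let ?D = "\<lambda>f z v. fderiv f z v"
  have tX: "(t, X) \<in> T \<times> N" using t X by simp
  note Ck_on_has_derivative[OF C2_on_fderiv[OF opens(3) phi_smooth, of "(0, h)"] _ tX]
  then
  have d: "(case_prod (\<lambda>s Y. ?D (case_prod \<phi>) (s, Y) (0, h)) has_derivative
      ?D (\<lambda>z. ?D (case_prod \<phi>) z (0, h)) (t, X)) (at (t, X))"
    by (simp add: case_prod_beta' cond_case_prod_eta)
  have "((\<lambda>s. ?D (case_prod \<phi>) (s, X) (0, h)) has_vector_derivative
      ?D (\<lambda>z. ?D (case_prod \<phi>) z (0, h)) (t, X) (1, 0)) (at t)"
    by (rule slice_time[OF d])
  then have 1: "((\<lambda>s. F s X *v h) has_vector_derivative
      ?D (\<lambda>z. ?D (case_prod \<phi>) z (0, h)) (t, X) (1, 0)) (at t)"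
    by (rule has_vector_derivative_transform_within_open[OF _ opens(1) t]) (simp add: F_eq X)
  have "?D (\<lambda>z. ?D (case_prod \<phi>) z (0, h)) (t, X) (1, 0) =
      ?D (\<lambda>z. ?D (case_prod \<phi>) z (1, 0)) (t, X) (0, h)"
    by (rule frechet_derivative_symmetric[OF opens(3) tX phi_smooth])
  also have "\<dots> = ?D (\<lambda>z. u (fst z) (\<phi> (fst z) (snd z))) (t, X) (0, h)"
    by (subst frechet_derivative_cong_open[OF opens(3) tX]) (auto simp: phi_velocity)
  also have "\<dots> = A t (\<phi> t X) *v (F t X *v h)"
  proof -
    have "Ck_on 2 (\<lambda>z. case_prod u ((\<lambda>(t, X). (t, \<phi> t X)) z)) (T \<times> N)"
      by (rule Ck_on_compose[OF opens(3) open_R lagrange_smooth])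
        (use u_smooth image_lagrange in \<open>auto simp: R_def\<close>)
    then have "Ck_on 2 (case_prod (\<lambda>s Y. u s (\<phi> s Y))) (T \<times> N)"
      by (simp add: case_prod_beta')
    from Ck_on_has_derivative[OF this _ tX]
    have dd: "(case_prod (\<lambda>s Y. u s (\<phi> s Y)) has_derivative
        ?D (\<lambda>z. u (fst z) (\<phi> (fst z) (snd z))) (t, X)) (at (t, X))"
      by (simp add: case_prod_beta')
    have "((\<lambda>Y. u t (\<phi> t Y)) has_derivative (\<lambda>h. A t (\<phi> t X) *v (F t X *v h))) (at X)"
      by (rule has_derivative_compose[OF phi_has_derivative[OF t X] u_has_derivative[OF in_R[OF t X]]])
    from fun_cong[OF has_derivative_unique[OF slice_space[OF dd] this], of h] show ?thesis .
  qed
  finally show ?thesis using 1 by simp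
qed

text \<open>Euler's expansion formula: Jacobi's formula applied to \<open>F' = A F\<close>, where
  the trace of \<open>A\<close> is the divergence of the velocity.\<close>

lemma det_F_time_derivative:
  assumes "t \<in> T" "X \<in> N"
  shows "((\<lambda>s. det (F s X)) has_real_derivative divergence (u t) (\<phi> t X) * det (F t X)) (at t)"
  using det_has_real_derivative[OF F_time_derivative[OF assms]]
  by (simp add: divergence_def A_def)

lemma continuous_F: "continuous_on (T \<times> N) (\<lambda>z. F (fst z) (snd z))"
proof -
  have "continuous_on (T \<times> N) (\<lambda>z. \<chi> i j. fderiv (case_prod \<phi>) z (0, axis j 1) $ i)"
    by (intro continuous_intros Ck_on_imp_continuous_on[OF C2_on_fderiv[OF opens(3) phi_smooth]])
  then show ?thesis
    by (rule continuous_on_eq)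
      (auto simp: vec_eq_iff F_eq[symmetric] matrix_column_entry[of "F _ _", symmetric])
qed

lemma continuous_A: "continuous_on R (\<lambda>z. A (fst z) (snd z))"
proof -
  have "continuous_on R (\<lambda>z. \<chi> i j. fderiv (case_prod u) z (0, axis j 1) $ i)"
    by (intro continuous_intros Ck_on_imp_continuous_on[OF C2_on_fderiv[OF open_R u_C2]])
  then show ?thesis
    by (rule continuous_on_eq)
      (auto simp: vec_eq_iff A_eq[symmetric] matrix_column_entry[of "A _ _", symmetric])
qed

end

section \<open>Divergence-free fields frozen into the motion\<close>

text \<open>Helmholtz's equation for a compressible flow. Along a trajectory it says that
  \<open>det F *\<^sub>R w\<close> satisfies the same linear equation \<open>y' = A y\<close> as
  \<open>F *v h\<close> for a fixed vector \<open>h\<close>.\<close>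

definition frozen_in :: "(real \<Rightarrow> real^3 \<Rightarrow> real^3) \<Rightarrow> (real \<Rightarrow> real^3 \<Rightarrow> real^3) \<Rightarrow> real \<Rightarrow> real^3 \<Rightarrow> bool" where
  "frozen_in u w t x \<longleftrightarrow>
     time_deriv w t x + jacobian (w t) (at x) *v u t x + divergence (u t) x *\<^sub>R w t x =
     jacobian (u t) (at x) *v w t x"

lemma trace_eq_sum: "trace A = (\<Sum>k\<in>UNIV. (A *v axis k 1) $ k)" for A :: "real^'n^'n"
  by (simp add: trace_def matrix_column_entry)

lemma material_deriv_eq:
  assumes "v t differentiable (at x)"
  shows "material_deriv u v t x = time_deriv v t x + jacobian (v t) (at x) *v u t x"
proof -
  have g: "grad (\<lambda>y. v t y $ i) x = jacobian (v t) (at x) $ i" for i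
    by (simp add: grad_def frechet_derivative_nth[OF assms] jacobian_def matrix_def vec_eq_iff)
  show ?thesis
    unfolding material_deriv_def g by (simp add: vec_eq_iff matrix_vector_mul_component inner_commute)
qed

lemma grad_half_square:
  fixes v :: "real^3 \<Rightarrow> real^3"
  assumes "v differentiable (at x)"
  shows "((\<lambda>y. (norm (v y))\<^sup>2 / 2) has_derivative (\<lambda>h. (transpose (jacobian v (at x)) *v v x) \<bullet> h)) (at x)"
proof -
  have v: "(v has_derivative (\<lambda>h. jacobian v (at x) *v h)) (at x)"
    by (rule jacobian_has_derivative[OF assms])
  have "((\<lambda>y. (1 / 2) * (v y \<bullet> v y)) has_derivative
      (\<lambda>h. (1 / 2) * (v x \<bullet> (jacobian v (at x) *v h) + (jacobian v (at x) *v h) \<bullet> v x))) (at x)"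
    by (intro has_derivative_mult_right has_derivative_inner v)
  then show ?thesis
    by (simp only: inner_matrix_vector[symmetric]) (simp add: power2_norm_eq_inner inner_commute)
qed

text \<open>The transposed Jacobian applied to \<open>u\<close> is the gradient of half the squared
  speed, so it cancels against the kinetic term under the gradient.\<close>

lemma momentum_equation_euler:
  assumes u: "u t differentiable (at x)" and H: "H t differentiable (at x)"
    and m: "momentum_equation H u t x"
  shows "time_deriv u t x + jacobian (u t) (at x) *v u t x + grad (H t) x = 0"
proof -
  have "((\<lambda>y. H t y - (norm (u t y))\<^sup>2 / 2) has_derivative
      (\<lambda>h. (grad (H t) x - transpose (jacobian (u t) (at x)) *v u t x) \<bullet> h)) (at x)"
    using has_derivative_diff[OF grad_has_derivative[OF H] grad_half_square[OF u]]
    by (simp add: inner_diff_left)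
  note g = grad_eqI[OF this]
  from m show ?thesis
    unfolding momentum_equation_def material_deriv_eq[where v = u and t = t, OF u] g
    by (simp add: algebra_simps del: transpose_matrix_vector)
qed

lemma curl_components:
  "curl v x $ 1 = (jacobian v (at x) *v axis 2 1) $ 3 - (jacobian v (at x) *v axis 3 1) $ 2"
  "curl v x $ 2 = (jacobian v (at x) *v axis 3 1) $ 1 - (jacobian v (at x) *v axis 1 1) $ 3"
  "curl v x $ 3 = (jacobian v (at x) *v axis 1 1) $ 2 - (jacobian v (at x) *v axis 2 1) $ 1"
  by (simp_all add: curl_def Let_def matrix_column_entry)

section \<open>The vorticity as a frozen-in field\<close>

context flow
begin

definition \<omega> :: "real \<Rightarrow> real^3 \<Rightarrow> real^3" where "\<omega> t = curl (u t)"

text \<open>The spatial partial derivatives of the velocity components, kept as functions on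
  space-time so that \<open>D2\<close> can differentiate them in time as well as in space.\<close>

definition D1 :: "3 \<Rightarrow> 3 \<Rightarrow> real \<times> (real^3) \<Rightarrow> real" where
  "D1 i j z = fderiv (case_prod u) z (0, axis j 1) $ i"

definition D2 :: "3 \<Rightarrow> 3 \<Rightarrow> real \<times> (real^3) \<Rightarrow> real \<times> (real^3) \<Rightarrow> real" where
  "D2 i j z v = fderiv (D1 i j) z v"

lemma D1_smooth: "Ck_on 1 (D1 i j) R"
  unfolding D1_def[abs_def]
  by (intro Ck_on_nth open_R C2_on_fderiv u_C2)

lemma D1_has_derivative: "z \<in> R \<Longrightarrow> (D1 i j has_derivative D2 i j z) (at z)"
  using Ck_on_has_derivative[OF D1_smooth, of z i j] by (simp add: D2_def[abs_def])

lemma u_derivative_differentiable: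
  "z \<in> R \<Longrightarrow> (\<lambda>z. fderiv (case_prod u) z v) differentiable (at z)"
  by (rule Ck_on_differentiable[OF C2_on_fderiv[OF open_R u_C2]]) simp_all

lemma D2_eq:
  assumes "z \<in> R"
  shows "D2 i j z v = fderiv (\<lambda>z. fderiv (case_prod u) z v) z (0, axis j 1) $ i"
proof -
  have "D2 i j z v = fderiv (\<lambda>z. fderiv (case_prod u) z (0, axis j 1)) z v $ i"
    unfolding D2_def D1_def[abs_def]
    by (rule frechet_derivative_nth[OF u_derivative_differentiable[OF assms]])
  also have "\<dots> = fderiv (\<lambda>z. fderiv (case_prod u) z v) z (0, axis j 1) $ i"
    using frechet_derivative_symmetric[OF open_R assms, of "case_prod u"] u_smooth by (simp add: R_def)
  finally show ?thesis .
qed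

lemma D2_symmetric:
  assumes "z \<in> R"
  shows "D2 i j z (0, axis k 1) = D2 i k z (0, axis j 1)"
proof -
  have "D2 i j z (0, axis k 1) = fderiv (D1 i k) z (0, axis j 1)"
    unfolding D2_eq[OF assms] D1_def[abs_def]
    by (rule frechet_derivative_nth[OF u_derivative_differentiable[OF assms], symmetric])
  then show ?thesis by (simp add: D2_def)
qed

lemma A_column: "z \<in> R \<Longrightarrow> A (fst z) (snd z) $ i $ j = D1 i j z"
  by (cases z) (simp add: D1_def A_eq[symmetric] matrix_column_entry)

lemma omega_components:
  assumes "z \<in> R"
  shows "case_prod \<omega> z $ 1 = D1 3 2 z - D1 2 3 z"
    "case_prod \<omega> z $ 2 = D1 1 3 z - D1 3 1 z"
    "case_prod \<omega> z $ 3 = D1 2 1 z - D1 1 2 z"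
  using A_column[OF assms]
  by (simp_all add: case_prod_beta \<omega>_def curl_components matrix_column_entry[symmetric] A_def)

lemma omega_has_derivative:
  assumes "z \<in> R"
  defines "w' \<equiv> \<lambda>v. vector [D2 3 2 z v - D2 2 3 z v, D2 1 3 z v - D2 3 1 z v, D2 2 1 z v - D2 1 2 z v] :: real^3"
  shows "(case_prod \<omega> has_derivative w') (at z)"
proof (rule has_derivative_transform_within_open[OF _ open_R assms(1)])
  let ?w = "\<lambda>z. vector [D1 3 2 z - D1 2 3 z, D1 1 3 z - D1 3 1 z, D1 2 1 z - D1 1 2 z] :: real^3"
  have "((\<lambda>z. \<chi> i. ?w z $ i) has_derivative (\<lambda>v. \<chi> i. w' v $ i)) (at z)"
  proof (rule has_derivative_vec_lambda)
    show "((\<lambda>z. ?w z $ i) has_derivative (\<lambda>v. w' v $ i)) (at z)" for i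
      unfolding w'_def using exhaust_3[of i] D1_has_derivative[OF assms(1)]
      by (elim disjE) (auto intro!: has_derivative_diff)
  qed
  then show "(?w has_derivative w') (at z)" by simp
  show "?w z = case_prod \<omega> z" if "z \<in> R" for z
    using omega_components[OF that] by (simp add: vec_eq_iff forall_3)
qed

lemma omega_smooth: "Ck_on 1 (case_prod \<omega>) R"
proof -
  have eq: "case_prod \<omega> z = (D1 3 2 z - D1 2 3 z) *\<^sub>R axis 1 1 +
      (D1 1 3 z - D1 3 1 z) *\<^sub>R axis 2 1 + (D1 2 1 z - D1 1 2 z) *\<^sub>R axis 3 1" if "z \<in> R" for z
    using omega_components[OF that] by (simp add: vec_eq_iff forall_3 axis_def)
  show ?thesis
    by (rule Ck_on_cong[OF open_R eq, THEN iffD2], assumption)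
      (intro Ck_on_add Ck_on_scaleR Ck_on_diff Ck_on_const D1_smooth open_R)
qed

lemma divergence_omega:
  assumes "(t, x) \<in> R"
  shows "divergence (\<omega> t) x = 0"
  using jacobian_slice(1)[OF omega_has_derivative[OF assms]] D2_symmetric[OF assms]
  by (simp add: divergence_def trace_eq_sum sum_3)

text \<open>The vorticity equation is the curl of Euler's equation, which needs symmetric second
  derivatives of \<open>H\<close>, although \<open>H\<close> is only assumed C1. Euler's equation
  itself supplies the missing derivative: it expresses \<open>grad H\<close> through first
  derivatives of the C2 field \<open>u\<close>.\<close>

lemma frozen_omega:
  assumes t: "t \<in> T" and S: "open S" "S \<subseteq> \<phi> t ` N" and x: "x \<in> S"
    and H: "Ck_on 1 H S"
    and euler: "\<And>y. y \<in> S \<Longrightarrow> time_deriv u t y + A t y *v u t y + grad H y = 0"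
  shows "frozen_in u \<omega> t x"
proof -
  have inR: "(t, y) \<in> R" if "y \<in> S" for y using that S(2) t by (auto simp: R_iff)
  note xR = inR[OF x]
  \<comment> \<open>The \<open>i\<close>-th component of minus the acceleration, in the form that
    Euler's equation gives to the \<open>i\<close>-th partial derivative of \<open>H\<close>; it is
    visibly C1.\<close>
  define g where "g i y = - (fderiv (case_prod u) (t, y) (1, 0) $ i
      + (\<Sum>j\<in>UNIV. D1 i j (t, y) * u t y $ j))" for i y
  have gradH: "fderiv H y (axis i 1) = g i y" if y: "y \<in> S" for i y
  proof -
    have "grad H y $ i = - (time_deriv u t y $ i + (A t y *v u t y) $ i)"
      using arg_cong[OF euler[OF y], of "\<lambda>v. v $ i"] by simp
    moreover have "(A t y *v u t y) $ i = (\<Sum>j\<in>UNIV. D1 i j (t, y) * u t y $ j)"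
      using A_column[OF inR[OF y]] by (simp add: matrix_vector_mult_def)
    ultimately show ?thesis
      by (simp add: grad_def g_def time_deriv_slice[OF u_deriv[OF inR[OF y]]])
  qed
  have slice: "Ck_on 1 (\<lambda>y. f (t, y)) S" if "Ck_on 1 f R" for f :: "real \<times> (real^3) \<Rightarrow> real"
    using Ck_on_slice[where f = "\<lambda>t y. f (t, y)" and k = 1, OF _ open_R S(1) inR] that
    by (simp add: case_prod_beta' del: One_nat_def)
  have gsm: "Ck_on 1 (g i) S" for i
  proof -
    have "Ck_on 1 (\<lambda>z. fderiv (case_prod u) z (1, 0) $ i) R"
      by (intro Ck_on_nth open_R C2_on_fderiv u_C2)
    moreover have "Ck_on 1 (\<lambda>z. case_prod u z $ j) R" for j
      by (intro Ck_on_nth open_R Ck_on_le[OF u_C2]) simp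
    note slice[OF this]
    ultimately show ?thesis
      unfolding g_def[abs_def]
      by (intro Ck_on_minus Ck_on_add Ck_on_sum Ck_on_mult S(1) slice D1_smooth) simp_all
  qed
  have "Ck_on 2 H S"
    unfolding numeral_2_eq_2
  proof (rule Ck_on_SucI[OF S(1) Ck_on_has_derivative[OF H]])
    fix e :: "real^3" assume "e \<in> Basis"
    then obtain i where "e = axis i 1" by (auto simp: Basis_vec_def)
    then show "Ck_on (Suc 0) (\<lambda>x. fderiv H x e) S"
      using gsm[of i] gradH by (subst Ck_on_cong[OF S(1), of _ "g i"]) auto
  qed simp_all
  note H2 = frechet_derivative_symmetric_real[OF S(1) x this]
  have "fderiv (\<lambda>y. fderiv H y (axis i 1)) x = fderiv (g i) x" for i
    by (rule frechet_derivative_cong_open[OF S(1) x gradH])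
  then have sym: "fderiv (g i) x (axis k 1) = fderiv (g k) x (axis i 1)" for i k
    using H2[of "axis i 1" "axis k 1"] by simp
  let ?e = "\<lambda>k. (0, axis k 1) :: real \<times> (real^3)"
  have dg: "fderiv (g i) x (axis k 1) = - (D2 i k (t, x) (1, 0)
      + (\<Sum>j\<in>UNIV. D2 i j (t, x) (?e k) * u t x $ j + D1 i j (t, x) * D1 j k (t, x)))" for i k
  proof -
    have 1: "((\<lambda>y. fderiv (case_prod u) (t, y) (1, 0) $ i) has_derivative
      (\<lambda>h. fderiv (\<lambda>z. fderiv (case_prod u) z (1, 0)) (t, x) (0, h) $ i)) (at x)"
      using slice_space[where f = "\<lambda>t y. fderiv (case_prod u) (t, y) (1, 0)"]
        u_derivative_differentiable[OF xR, of "(1, 0)"]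
      by (intro bounded_linear.has_derivative[OF bounded_linear_vec_nth])
        (simp add: case_prod_beta' frechet_derivative_works)
    have 2: "((\<lambda>y. D1 i j (t, y)) has_derivative (\<lambda>h. D2 i j (t, x) (0, h))) (at x)" for j
      using slice_space[where f = "\<lambda>t y. D1 i j (t, y)"] D1_has_derivative[OF xR, of i j]
      by (simp add: case_prod_beta')
    have 3: "((\<lambda>y. u t y $ j) has_derivative (\<lambda>h. (A t x *v h) $ j)) (at x)" for j
      by (rule bounded_linear.has_derivative[OF bounded_linear_vec_nth u_has_derivative[OF xR]])
    have "(g i has_derivative (\<lambda>h. - (fderiv (\<lambda>z. fderiv (case_prod u) z (1, 0)) (t, x) (0, h) $ i
        + (\<Sum>j\<in>UNIV. D1 i j (t, x) * (A t x *v h) $ j + D2 i j (t, x) (0, h) * u t x $ j)))) (at x)"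
      unfolding g_def[abs_def]
      by (intro has_derivative_minus has_derivative_add has_derivative_sum has_derivative_mult 1 2 3)
    from frechet_derivative_at[OF this, symmetric] show ?thesis
      using A_column[OF xR] by (simp add: D2_eq[OF xR, of i k "(1, 0)"] matrix_column_entry[symmetric] add.commute)
  qed
  \<comment> \<open>For the index pairs (3,2), (1,3) and (2,1) these identities are the three
    components of the curl of Euler's equation. What remains is to reorder mixed derivatives of
    \<open>u\<close> by \<open>D2_symmetric\<close>.\<close>
  note eq = sym[unfolded dg sum_3]
  have td: "time_deriv \<omega> t x = vector [D2 3 2 (t, x) (1, 0) - D2 2 3 (t, x) (1, 0),
      D2 1 3 (t, x) (1, 0) - D2 3 1 (t, x) (1, 0), D2 2 1 (t, x) (1, 0) - D2 1 2 (t, x) (1, 0)]"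
    by (rule time_deriv_slice[OF omega_has_derivative[OF xR]])
  have jac: "jacobian (\<omega> t) (at x) *v u t x = (\<Sum>k\<in>UNIV. u t x $ k *\<^sub>R
      vector [D2 3 2 (t, x) (?e k) - D2 2 3 (t, x) (?e k), D2 1 3 (t, x) (?e k) - D2 3 1 (t, x) (?e k),
        D2 2 1 (t, x) (?e k) - D2 1 2 (t, x) (?e k)])"
  proof -
    have "jacobian (\<omega> t) (at x) *v u t x = (\<Sum>k\<in>UNIV. u t x $ k *\<^sub>R (jacobian (\<omega> t) (at x) *v axis k 1))"
      by (rule linear_component_expansion) simp
    then show ?thesis by (simp add: jacobian_slice(1)[OF omega_has_derivative[OF xR]])
  qed
  have div: "divergence (u t) x = D1 1 1 (t, x) + D1 2 2 (t, x) + D1 3 3 (t, x)"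
    using A_column[OF xR] by (simp add: divergence_def trace_def sum_3 A_def)
  have A\<omega>: "(A t x *v \<omega> t x) $ i = D1 i 1 (t, x) * (D1 3 2 (t, x) - D1 2 3 (t, x))
     + D1 i 2 (t, x) * (D1 1 3 (t, x) - D1 3 1 (t, x)) + D1 i 3 (t, x) * (D1 2 1 (t, x) - D1 1 2 (t, x))" for i
    using A_column[OF xR] omega_components[OF xR] by (simp add: matrix_vector_mult_def sum_3)
  note sy = D2_symmetric[OF xR]
  have om: "\<omega> t x $ 1 = D1 3 2 (t, x) - D1 2 3 (t, x)" "\<omega> t x $ 2 = D1 1 3 (t, x) - D1 3 1 (t, x)"
    "\<omega> t x $ 3 = D1 2 1 (t, x) - D1 1 2 (t, x)"
    using omega_components[OF xR] by simp_all
  let ?L = "time_deriv \<omega> t x + jacobian (\<omega> t) (at x) *v u t x + divergence (u t) x *\<^sub>R \<omega> t x"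
  show ?thesis
    unfolding frozen_in_def A_def[symmetric] vec_eq_iff forall_3
  proof (intro conjI)
    show "?L $ 1 = (A t x *v \<omega> t x) $ 1"
      using eq[of 3 2] sy[of 3 1 2] sy[of 3 2 3] sy[of 2 3 1] sy[of 2 3 2] sy[of 3 1 1] sy[of 2 1 1]
      by (simp add: td jac div A\<omega> om sum_3 algebra_simps)
    show "?L $ 2 = (A t x *v \<omega> t x) $ 2"
      using eq[of 1 3] sy[of 1 2 3] sy[of 1 1 3] sy[of 3 1 2] sy[of 3 1 3]
      by (simp add: td jac div A\<omega> om sum_3 algebra_simps)
    show "?L $ 3 = (A t x *v \<omega> t x) $ 3"
      using eq[of 2 1] sy[of 2 1 3] sy[of 2 1 2] sy[of 1 2 3] sy[of 1 1 2]
      by (simp add: td jac div A\<omega> om sum_3 algebra_simps)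
  qed
qed

end

section \<open>The columns of \<open>F / det F\<close> as frozen-in, divergence-free fields\<close>

context flow
begin

definition E :: "3 \<Rightarrow> real \<Rightarrow> real^3 \<Rightarrow> real^3" where "E i = E_field N \<phi> i"

lemma E_at:
  assumes "t \<in> T" "X \<in> N"
  shows "E i t (\<phi> t X) = (1 / det (F t X)) *\<^sub>R (F t X *v axis i 1)"
proof -
  have "column i (c *\<^sub>R M) = c *\<^sub>R (M *v axis i 1)" for c and M :: "real^3^3"
    by (simp add: column_def vec_eq_iff matrix_column_entry[of M])
  then show ?thesis
    using inv_into_f_f[OF inj[OF assms(1)] assms(2)]
    by (simp add: E_def E_field_def deformation_gradient_def F_def Let_def)
qed

definition P :: "real^3 \<Rightarrow> real \<times> (real^3) \<Rightarrow> real^3" where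
  "P h z = fderiv (case_prod \<phi>) z (0, h)"

lemma P_smooth: "Ck_on 1 (P h) (T \<times> N)"
  unfolding P_def[abs_def]
  by (rule C2_on_fderiv[OF opens(3) phi_smooth])

lemma P_eq: "z \<in> T \<times> N \<Longrightarrow> P h z = F (fst z) (snd z) *v h"
  by (cases z) (simp add: P_def F_eq)

lemma P_symmetric:
  assumes "z \<in> T \<times> N"
  shows "fderiv (P h) z (0, k) = fderiv (P k) z (0, h)"
  unfolding P_def[abs_def] by (rule frechet_derivative_symmetric[OF opens(3) assms phi_smooth])

lemma det_F_smooth: "Ck_on 1 (\<lambda>z. det (F (fst z) (snd z))) (T \<times> N)"
proof -
  have "det (F (fst z) (snd z)) = det (\<chi> i j. P (axis j 1) z $ i)" if "z \<in> T \<times> N" for z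
    by (rule arg_cong[where f = det])
      (simp add: vec_eq_iff P_eq[OF that] matrix_column_entry[of "F _ _", symmetric])
  then show ?thesis
    by (rule Ck_on_cong[OF opens(3), THEN iffD2])
      (auto simp: det_3 simp del: One_nat_def
        intro!: Ck_on_add Ck_on_diff Ck_on_mult Ck_on_nth P_smooth opens(3))
qed

lemma E_lagrange_smooth: "Ck_on 1 (\<lambda>z. E i (fst z) (\<phi> (fst z) (snd z))) (T \<times> N)"
proof (rule Ck_on_cong[OF opens(3), THEN iffD2])
  show "E i (fst z) (\<phi> (fst z) (snd z)) = inverse (det (F (fst z) (snd z))) *\<^sub>R P (axis i 1) z"
    if "z \<in> T \<times> N" for z
    using that E_at[of "fst z" "snd z" i] by (auto simp: P_eq inverse_eq_divide)
  show "Ck_on 1 (\<lambda>z. inverse (det (F (fst z) (snd z))) *\<^sub>R P (axis i 1) z) (T \<times> N)"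
    by (intro Ck_on_scaleR C1_on_inverse det_F_smooth P_smooth opens(3)) (auto simp: det_F_nonzero)
qed

text \<open>The motion provides smooth inverses only at each fixed time. Joint differentiability
  comes from the inverse function theorem for \<open>(t, X) \<mapsto> (t, \<phi> t X)\<close>, whose
  derivative is block triangular with the invertible block \<open>F\<close>.\<close>

lemma E_differentiable:
  assumes t: "t \<in> T" and X: "X \<in> N"
  shows "case_prod (E i) differentiable (at (t, \<phi> t X))"
proof -
  let ?\<Psi> = "\<lambda>(t, X). (t, \<phi> t X)"
  let ?g = "inv_into (T \<times> N) ?\<Psi>"
  have tX: "(t, X) \<in> T \<times> N" using t X by simp
  let ?\<Psi>' = "fderiv ?\<Psi> (t, X)"
  have d: "(?\<Psi> has_derivative ?\<Psi>') (at (t, X))"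
    by (rule Ck_on_has_derivative[OF lagrange_smooth _ tX]) simp
  have "((\<lambda>z. (fst z, case_prod \<phi> z)) has_derivative
      (\<lambda>v. (fst v, fderiv (case_prod \<phi>) (t, X) v))) (at (t, X))"
    by (intro has_derivative_Pair has_derivative_fst has_derivative_ident phi_deriv[OF t X])
  then have d2: "(?\<Psi> has_derivative
      (\<lambda>v. (fst v, fderiv (case_prod \<phi>) (t, X) v))) (at (t, X))"
    by (simp add: case_prod_beta')
  have \<Psi>': "?\<Psi>' v = (fst v, fderiv (case_prod \<phi>) (t, X) v)" for v
    by (rule fun_cong[OF has_derivative_unique[OF d d2]])
  have lin: "linear (fderiv (case_prod \<phi>) (t, X))"
    by (rule has_derivative_linear[OF phi_deriv[OF t X]])
  have \<Psi>'2: "?\<Psi>' (r, h) = (r, r *\<^sub>R u t (\<phi> t X) + F t X *v h)" for r h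
  proof -
    have "fderiv (case_prod \<phi>) (t, X) (r, h)
        = fderiv (case_prod \<phi>) (t, X) (r *\<^sub>R (1, 0) + (0, h))" by simp
    also have "\<dots> = r *\<^sub>R u t (\<phi> t X) + F t X *v h"
      unfolding linear_add[OF lin] linear_scale[OF lin] phi_velocity(2)[OF t X] F_eq[OF t X] ..
    finally show ?thesis by (simp add: \<Psi>')
  qed
  obtain B where B: "F t X ** B = mat 1"
    using det_F_nonzero[OF t X] by (auto simp: invertible_det_nz[symmetric] invertible_def)
  \<comment> \<open>The inverse of the block triangular derivative: keep the time increment,
    subtract the displacement due to \<open>u\<close>, then apply the inverse \<open>B\<close> of
    \<open>F\<close>.\<close>
  define g' where "g' v = (fst v, B *v (snd v - fst v *\<^sub>R u t (\<phi> t X)))" for v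
  have "?\<Psi>' \<circ> g' = id"
    by (auto simp: fun_eq_iff g'_def \<Psi>'2 matrix_vector_mul_assoc B)
  then have "(?g has_derivative g') (at (?\<Psi> (t, X)))"
    by (intro has_derivative_inverse_strong[OF opens(3) tX Ck_on_imp_continuous_on[OF lagrange_smooth] _ d])
      (rule inv_into_f_f[OF inj_lagrange])
  then have g: "?g differentiable (at (t, \<phi> t X))"
    using differentiableI by auto
  have gt: "?g (t, \<phi> t X) = (t, X)"
    using inv_into_f_f[OF inj_lagrange tX] by simp
  have E: "(\<lambda>z. E i (fst z) (\<phi> (fst z) (snd z))) differentiable (at (?g (t, \<phi> t X)))"
    unfolding gt by (rule Ck_on_differentiable[OF E_lagrange_smooth _ tX]) simp
  have "(\<lambda>z. E i (fst (?g z)) (\<phi> (fst (?g z)) (snd (?g z)))) differentiable (at (t, \<phi> t X))"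
    using differentiable_chain_at[OF g E] by (simp add: o_def)
  moreover have "E i (fst (?g z)) (\<phi> (fst (?g z)) (snd (?g z))) = case_prod (E i) z" if "z \<in> R" for z
  proof -
    have "?\<Psi> (?g z) = z" using f_inv_into_f[of z ?\<Psi> "T \<times> N"] that by (simp add: image_lagrange)
    moreover obtain s Y where "?g z = (s, Y)" by (rule prod.exhaust)
    ultimately show ?thesis by auto
  qed
  ultimately show ?thesis
    unfolding differentiable_def
    by (elim exE) (rule exI, rule has_derivative_transform_within_open[OF _ open_R in_R[OF t X]])
qed

lemma E_times_det: "t \<in> T \<Longrightarrow> X \<in> N \<Longrightarrow> det (F t X) *\<^sub>R E i t (\<phi> t X) = F t X *v axis i 1"
  using E_at det_F_nonzero by simp

text \<open>Both sides of \<open>det F *\<^sub>R E i = F *v axis i 1\<close> are differentiated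
  along a trajectory, the left by the product rule and Euler's expansion formula, the right by
  \<open>F' = A F\<close>; the factor \<open>det F\<close> is then cancelled.\<close>

lemma frozen_E:
  assumes t: "t \<in> T" and X: "X \<in> N"
  shows "frozen_in u (E i) t (\<phi> t X)"
proof -
  let ?x = "\<phi> t X"
  have "((\<lambda>s. det (F s X) *\<^sub>R E i s (\<phi> s X)) has_vector_derivative
      det (F t X) *\<^sub>R (time_deriv (E i) t ?x + jacobian (E i t) (at ?x) *v u t ?x)
      + (divergence (u t) ?x * det (F t X)) *\<^sub>R E i t ?x) (at t)"
    by (rule has_vector_derivative_scaleR[OF det_F_time_derivative[OF t X]
          along_motion[OF t X E_differentiable[OF t X]]])
  then have "((\<lambda>s. F s X *v axis i 1) has_vector_derivative
      det (F t X) *\<^sub>R (time_deriv (E i) t ?x + jacobian (E i t) (at ?x) *v u t ?x)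
      + (divergence (u t) ?x * det (F t X)) *\<^sub>R E i t ?x) (at t)"
    by (rule has_vector_derivative_transform_within_open[OF _ opens(1) t]) (simp add: E_times_det X)
  from vector_derivative_unique_at[OF this F_time_derivative[OF t X]]
  have "det (F t X) *\<^sub>R (time_deriv (E i) t ?x + jacobian (E i t) (at ?x) *v u t ?x
      + divergence (u t) ?x *\<^sub>R E i t ?x) = A t ?x *v (F t X *v axis i 1)"
    by (simp add: scaleR_add_right mult.commute)
  also have "\<dots> = det (F t X) *\<^sub>R (A t ?x *v E i t ?x)"
    by (simp add: E_times_det[OF t X, of i, symmetric] matrix_vector_mult_scaleR)
  finally show ?thesis
    using det_F_nonzero[OF t X] by (simp add: frozen_in_def A_def)
qed

text \<open>Piola's identity: differentiating \<open>det F \<cdot> E\<^sub>i = F e\<^sub>i\<close> along the reference coordinates,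
  the derivative of the determinant cancels against the trace of \<open>\<partial>\<^sub>i F \<cdot> F\<inverse>\<close>.\<close>

lemma divergence_E:
  assumes t: "t \<in> T" and X: "X \<in> N"
  shows "divergence (E i t) (\<phi> t X) = 0"
proof -
  let ?x = "\<phi> t X"
  have tX: "(t, X) \<in> T \<times> N" using t X by simp
  define M where "M = jacobian (\<lambda>Y. F t Y *v axis i 1) (at X)"
  have Fd: "((\<lambda>Y. F t Y *v h) has_derivative (\<lambda>k. fderiv (P h) (t, X) (0, k))) (at X)" for h
  proof -
    have "((\<lambda>Y. P h (t, Y)) has_derivative (\<lambda>k. fderiv (P h) (t, X) (0, k))) (at X)"
      using slice_space[where f = "\<lambda>t Y. P h (t, Y)"] Ck_on_has_derivative[OF P_smooth _ tX]
      by (simp add: case_prod_beta')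
    then show ?thesis
      by (rule has_derivative_transform_within_open[OF _ opens(2) X]) (simp add: P_eq t)
  qed
  have M: "((\<lambda>Y. F t Y *v axis i 1) has_derivative (\<lambda>k. M *v k)) (at X)"
    unfolding M_def by (rule jacobian_has_derivative[OF differentiableI[OF Fd]])
  \<comment> \<open>\<open>M\<close> is defined as the derivative of the \<open>i\<close>-th column
    of \<open>F\<close> in all directions; by symmetry of second derivatives it is also the
    derivative of the whole matrix \<open>F\<close> in direction \<open>i\<close>.\<close>
  have MP: "M *v h = fderiv (P h) (t, X) (0, axis i 1)" for h
    using fun_cong[OF has_derivative_unique[OF M Fd], of h] P_symmetric[OF tX] by simp
  obtain B where B: "F t X ** B = mat 1" "B ** F t X = mat 1"
    using det_F_nonzero[OF t X] by (auto simp: invertible_det_nz[symmetric] invertible_def)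
  define j where "j Y = det (F t Y)" for Y
  have "(\<lambda>z. det (F (fst z) (snd z))) differentiable (at (t, X))"
    by (rule Ck_on_differentiable[OF det_F_smooth _ tX]) simp
  then obtain j0 where "((\<lambda>z. det (F (fst z) (snd z))) has_derivative j0) (at (t, X))"
    by (auto simp: differentiable_def)
  then have j: "(j has_derivative (\<lambda>h. j0 (0, h))) (at X)"
    using slice_space[where f = "\<lambda>t Y. det (F t Y)"] by (simp add: case_prod_beta' j_def[abs_def])
  define l where "l h = j0 (0, h)" for h
  have j: "(j has_derivative l) (at X)" using j by (simp add: l_def[abs_def])
  have linl: "linear l" by (rule has_derivative_linear[OF j])
  \<comment> \<open>On the line in direction \<open>i\<close>, \<open>F\<close> has derivative
    \<open>M = (M ** B) ** F\<close>, so Jacobi's formula applies with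
    \<open>L = M ** B\<close>.\<close>
  have li: "l (axis i 1) = trace (M ** B) * det (F t X)"
  proof -
    have "((\<lambda>s. F t (X + s *\<^sub>R axis i 1) *v h) has_vector_derivative (M ** B) *v (F t (X + 0 *\<^sub>R axis i 1) *v h)) (at 0)" for h
    proof -
      have line: "((\<lambda>s. X + s *\<^sub>R axis i 1) has_derivative (\<lambda>r. r *\<^sub>R axis i 1)) (at 0)"
        by (auto intro!: derivative_eq_intros)
      have "((\<lambda>s. F t (X + s *\<^sub>R axis i 1) *v h) has_derivative
          (\<lambda>r. fderiv (P h) (t, X) (0, r *\<^sub>R axis i 1))) (at 0)"
        using has_derivative_compose[OF line] Fd[of h] by simp
      moreover have "fderiv (P h) (t, X) (0, r *\<^sub>R axis i 1) = r *\<^sub>R (M *v h)" for r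
        using linear_scale[OF has_derivative_linear[OF Fd[of h]], of r "axis i 1"] by (simp add: MP)
      ultimately show ?thesis
        by (simp add: has_vector_derivative_def matrix_vector_mul_assoc matrix_mul_assoc[symmetric] B)
    qed
    from det_has_real_derivative[OF this]
    have "((\<lambda>s. j (X + s *\<^sub>R axis i 1)) has_real_derivative trace (M ** B) * det (F t X)) (at 0)"
      by (simp add: j_def)
    moreover have "((\<lambda>s. j (X + s *\<^sub>R axis i 1)) has_real_derivative l (axis i 1)) (at 0)"
      using has_real_derivative_along[of j X 0 "axis i 1"] j frechet_derivative_at[OF j, symmetric]
      by (simp add: differentiableI)
    ultimately show ?thesis by (rule DERIV_unique[symmetric])
  qed
  let ?J = "det (F t X)" and ?G = "jacobian (E i t) (at ?x)"
  have dE: "E i t differentiable (at ?x)"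
    using E_differentiable[OF t X, of i] jacobian_slice(2)[of "E i"] unfolding differentiable_def by blast
  have "((\<lambda>Y. E i t (\<phi> t Y)) has_derivative (\<lambda>h. ?G *v (F t X *v h))) (at X)"
    by (rule has_derivative_compose[OF phi_has_derivative[OF t X] jacobian_has_derivative[OF dE]])
  from has_derivative_scaleR[OF j this]
  have "((\<lambda>Y. j Y *\<^sub>R E i t (\<phi> t Y)) has_derivative (\<lambda>h. ?J *\<^sub>R (?G *v (F t X *v h)) + l h *\<^sub>R E i t ?x)) (at X)"
    by (simp add: j_def)
  then have "((\<lambda>Y. F t Y *v axis i 1) has_derivative (\<lambda>h. ?J *\<^sub>R (?G *v (F t X *v h)) + l h *\<^sub>R E i t ?x)) (at X)"
    by (rule has_derivative_transform_within_open[OF _ opens(2) X]) (simp add: j_def E_times_det t)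
  from has_derivative_unique[OF this M]
  have Meq: "M *v h = ?J *\<^sub>R (?G *v (F t X *v h)) + l h *\<^sub>R E i t ?x" for h
    by (simp add: fun_eq_iff)
  \<comment> \<open>Inserting \<open>h = B *v axis k 1\<close> in \<open>Meq\<close> and summing the
    \<open>k\<close>-th components produces \<open>?J\<close> times the divergence. The term left
    over is \<open>l (B *v E)\<close>, which is \<open>l (axis i 1) / ?J\<close>, that is
    \<open>trace (M ** B)\<close> again.\<close>
  have "trace (M ** B) = (\<Sum>k\<in>UNIV. (M *v (B *v axis k 1)) $ k)"
    by (simp add: trace_eq_sum matrix_vector_mul_assoc)
  also have "\<dots> = (\<Sum>k\<in>UNIV. ?J * (?G *v axis k 1) $ k + l (B *v axis k 1) * E i t ?x $ k)"
    unfolding Meq by (simp add: matrix_vector_mul_assoc matrix_mul_assoc[symmetric] B)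
  also have "\<dots> = ?J * divergence (E i t) ?x + (\<Sum>k\<in>UNIV. l (B *v axis k 1) * E i t ?x $ k)"
    by (simp add: sum.distrib sum_distrib_left divergence_def trace_eq_sum)
  also have "(\<Sum>k\<in>UNIV. l (B *v axis k 1) * E i t ?x $ k) = l (B *v E i t ?x)"
  proof -
    have "linear (\<lambda>v. l (B *v v))"
      using linear_compose[OF matrix_vector_mul_linear linl] by (simp add: o_def)
    from linear_component_expansion[OF this, of "E i t ?x"] show ?thesis by (simp add: mult.commute)
  qed
  also have "B *v E i t ?x = (1 / ?J) *\<^sub>R axis i 1"
    by (simp add: E_at[OF t X] matrix_vector_mult_scaleR matrix_vector_mul_assoc B)
  also have "l ((1 / ?J) *\<^sub>R axis i 1) = trace (M ** B)"
    using det_F_nonzero[OF t X] by (simp add: linear_scale[OF linl] li)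
  finally show ?thesis using det_F_nonzero[OF t X] by simp
qed

text \<open>At a fixed time the inverse of the motion is C2, so the field is C1 in space. At time 0
  this is the regularity that the divergence theorem requires of \<open>w 0\<close>.\<close>

lemma E_slice_smooth:
  assumes t: "t \<in> T"
  shows "Ck_on 1 (E i t) (\<phi> t ` N)"
proof -
  have "Ck_on 1 (case_prod (\<lambda>t Y. E i t (\<phi> t Y))) (T \<times> N)"
    using E_lagrange_smooth[of i] by (simp only: case_prod_beta')
  from Ck_on_slice[OF this opens(3,2)] t have N: "Ck_on 1 (\<lambda>Y. E i t (\<phi> t Y)) N"
    by blast
  have "Ck_on 1 (\<lambda>x. E i t (\<phi> t (inv_into N (\<phi> t) x))) (\<phi> t ` N)"
    by (rule Ck_on_compose[OF open_image[OF t] opens(2) Ck_on_le[OF inv_smooth[OF t]] N])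
      (auto intro: inv_into_into)
  then show ?thesis
    by (rule Ck_on_cong[OF open_image[OF t], THEN iffD1, rotated]) (simp add: f_inv_into_f)
qed

end

section \<open>The helicity conservation law\<close>

lemma divergence_eqI:
  assumes "(f has_derivative f') (at x)"
  shows "divergence f x = (\<Sum>k\<in>UNIV. f' (axis k 1) $ k)"
  by (simp add: divergence_def trace_def jacobian_def matrix_def frechet_derivative_at[OF assms, symmetric])

lemma divergence_scaleR:
  assumes f: "f differentiable (at x)" and v: "v differentiable (at x)"
  shows "divergence (\<lambda>y. f y *\<^sub>R v y) x = grad f x \<bullet> v x + f x * divergence v x"
proof -
  note d = has_derivative_scaleR[OF grad_has_derivative[OF f] jacobian_has_derivative[OF v]]
  have "(\<Sum>k\<in>UNIV. (grad f x \<bullet> axis k 1) * v x $ k) = grad f x \<bullet> v x"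
    by (simp add: inner_axis) (simp add: inner_vec_def)
  then show ?thesis
    unfolding divergence_eqI[OF d] divergence_eqI[OF jacobian_has_derivative[OF v]]
    by (simp add: sum.distrib sum_distrib_left[symmetric])
qed

context flow
begin

lemma momentum_equation_velocity:
  assumes R: "(t, x) \<in> R" and m: "momentum_equation H u t x"
  shows "time_deriv u t x = - (A t x *v u t x) - transpose (A t x) *v u t x
    - grad (\<lambda>y. H t y - (norm (u t y))\<^sup>2 / 2) x"
  using m unfolding momentum_equation_def A_def
    material_deriv_eq[where v = u and t = t, OF jacobian_slice(2)[OF u_deriv[OF R]]]
  by (simp add: eq_neg_iff_add_eq_0 algebra_simps del: transpose_matrix_vector)

text \<open>Both factors of \<open>u \<bullet> w\<close> are differentiated in time and replaced by
  means of the momentum equation and \<open>frozen_in\<close>; the flux is expanded using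
  \<open>div w = 0\<close>. No second derivative occurs, so joint differentiability of
  \<open>w\<close> at the point suffices.\<close>

lemma helicity_law:
  assumes R: "(t, x) \<in> R" and H: "H t differentiable (at x)" and m: "momentum_equation H u t x"
    and w: "case_prod w differentiable (at (t, x))"
    and fr: "frozen_in u w t x" and div: "divergence (w t) x = 0"
  shows "helicity_conservation_law H u w t x"
proof -
  let ?A = "A t x" and ?B = "jacobian (w t) (at x)"
  let ?q = "\<lambda>y. H t y - (norm (u t y))\<^sup>2 / 2"
  obtain w' where w': "(case_prod w has_derivative w') (at (t, x))" using w by (auto simp: differentiable_def)
  note wd = jacobian_slice(2)[OF w'] and ud = jacobian_slice(2)[OF u_deriv[OF R]]
  have qd: "?q differentiable (at x)"
    using differentiableI[OF has_derivative_diff[OF grad_has_derivative[OF H] grad_half_square[OF ud]]] .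
  have uw: "((\<lambda>y. u t y \<bullet> w t y) has_derivative (\<lambda>h. u t x \<bullet> (?B *v h) + (?A *v h) \<bullet> w t x)) (at x)"
    by (rule has_derivative_inner[OF u_has_derivative[OF R] jacobian_has_derivative[OF wd]])
  have grad_uw: "grad (\<lambda>y. u t y \<bullet> w t y) x \<bullet> h = u t x \<bullet> (?B *v h) + (?A *v h) \<bullet> w t x" for h
    using fun_cong[OF has_derivative_unique[OF grad_has_derivative[OF differentiableI[OF uw]] uw], of h] .
  have ut: "((\<lambda>s. u s x) has_vector_derivative time_deriv u t x) (at t)"
    using slice_time[OF u_deriv[OF R]] by (simp add: time_deriv_slice[OF u_deriv[OF R]])
  have wt: "((\<lambda>s. w s x) has_vector_derivative time_deriv w t x) (at t)"
    using slice_time[OF w'] by (simp add: time_deriv_slice[OF w'])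
  have uwt: "((\<lambda>s. u s x \<bullet> w s x) has_vector_derivative
      u t x \<bullet> time_deriv w t x + time_deriv u t x \<bullet> w t x) (at t)"
    by (rule bounded_bilinear.has_vector_derivative[OF bounded_bilinear_inner ut wt])
  note mom = momentum_equation_velocity[OF R m]
  have frz: "time_deriv w t x = ?A *v w t x - ?B *v u t x - divergence (u t) x *\<^sub>R w t x"
    using fr unfolding frozen_in_def A_def by (simp add: algebra_simps)
  let ?flux = "\<lambda>y. (u t y \<bullet> w t y) *\<^sub>R u t y + ?q y *\<^sub>R w t y"
  have d1: "(\<lambda>y. (u t y \<bullet> w t y) *\<^sub>R u t y) differentiable (at x)"
    and d2: "(\<lambda>y. ?q y *\<^sub>R w t y) differentiable (at x)"
    by (intro differentiable_scaleR differentiableI[OF uw] ud qd wd)+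
  have "divergence ?flux x = divergence (\<lambda>y. (u t y \<bullet> w t y) *\<^sub>R u t y) x + divergence (\<lambda>y. ?q y *\<^sub>R w t y) x"
    using divergence_eqI[OF has_derivative_add[OF jacobian_has_derivative[OF d1] jacobian_has_derivative[OF d2]]]
      divergence_eqI[OF jacobian_has_derivative[OF d1]] divergence_eqI[OF jacobian_has_derivative[OF d2]]
    by (simp add: sum.distrib)
  also have "\<dots> = (u t x \<bullet> (?B *v u t x) + (?A *v u t x) \<bullet> w t x)
      + (u t x \<bullet> w t x) * divergence (u t) x + grad ?q x \<bullet> w t x"
    by (simp add: divergence_scaleR differentiableI[OF uw] ud qd wd grad_uw div)
  finally have dv: "divergence ?flux x = \<dots>" .
  \<comment> \<open>Convection, compression and \<open>grad ?q\<close> cancel pairwise; what is left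
    is the adjoint identity between \<open>u \<bullet> (A *v w)\<close> and
    \<open>(transpose A *v u) \<bullet> w\<close>.\<close>
  have "u t x \<bullet> time_deriv w t x + time_deriv u t x \<bullet> w t x + divergence ?flux x = 0"
    unfolding dv mom frz
    by (simp only: inner_diff_left inner_diff_right inner_minus_left inner_scaleR_right
        inner_matrix_vector[symmetric]) (simp add: inner_matrix_vector[symmetric] inner_commute algebra_simps)
  moreover have "time_deriv (\<lambda>s y. u s y \<bullet> w s y) t x = u t x \<bullet> time_deriv w t x + time_deriv u t x \<bullet> w t x"
    unfolding time_deriv_def by (rule vector_derivative_at[OF uwt[unfolded time_deriv_def]])
  moreover have "(\<lambda>s. u s x \<bullet> w s x) differentiable (at t)"
    using uwt unfolding has_vector_derivative_def by (rule differentiableI)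
  moreover have "?flux differentiable (at x)"
    by (rule differentiable_add[OF d1 d2])
  ultimately show ?thesis
    by (simp add: helicity_conservation_law_def Let_def)
qed

end

section \<open>Transport of frozen-in fields\<close>

text \<open>Gronwall's argument for \<open>n = y \<bullet> y\<close>, whose derivative is at most
  \<open>2 * C * n\<close> in modulus. The factor \<open>exp (- 2 * C * s)\<close> carries the zero
  forward in time from \<open>c\<close>, and \<open>exp (2 * C * s)\<close> carries it
  backward.\<close>

lemma linear_ode_zero:
  fixes y :: "real \<Rightarrow> real^'n" and M :: "real \<Rightarrow> real^'n^'n"
  assumes y: "\<And>s. s \<in> {a..b} \<Longrightarrow> (y has_vector_derivative M s *v y s) (at s)"
    and M: "continuous_on {a..b} M" and c: "c \<in> {a..b}" "y c = 0" and t: "t \<in> {a..b}"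
  shows "y t = 0"
proof -
  \<comment> \<open>The sum of the norms of the rows is a convenient continuous bound for the
    operator norm.\<close>
  have "continuous_on {a..b} (\<lambda>s. \<Sum>i\<in>UNIV. norm (M s $ i))" by (intro continuous_intros M)
  then have "bounded ((\<lambda>s. \<Sum>i\<in>UNIV. norm (M s $ i)) ` {a..b})"
    by (intro compact_imp_bounded compact_continuous_image) auto
  then obtain C where "\<forall>s\<in>{a..b}. \<bar>\<Sum>i\<in>UNIV. norm (M s $ i)\<bar> \<le> C"
    unfolding bounded_iff by auto
  then have C: "(\<Sum>i\<in>UNIV. norm (M s $ i)) \<le> C" if "s \<in> {a..b}" for s using that by fastforce
  define n where "n s = y s \<bullet> y s" for s
  have n: "(n has_real_derivative 2 * (y s \<bullet> (M s *v y s))) (at s)" if "s \<in> {a..b}" for s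
    using bounded_bilinear.has_vector_derivative[OF bounded_bilinear_inner y[OF that] y[OF that]]
    by (simp add: n_def[abs_def] has_real_derivative_iff_has_vector_derivative inner_commute)
  have le: "\<bar>y s \<bullet> (M s *v y s)\<bar> \<le> C * n s" if s: "s \<in> {a..b}" for s
  proof -
    have "norm (M s *v y s) \<le> (\<Sum>i\<in>UNIV. \<bar>(M s *v y s) $ i\<bar>)" by (rule norm_le_l1_cart)
    also have "\<dots> \<le> (\<Sum>i\<in>UNIV. norm (M s $ i) * norm (y s))"
      by (intro sum_mono) (simp add: matrix_vector_mul_component Cauchy_Schwarz_ineq2)
    also have "\<dots> \<le> C * norm (y s)"
      using C[OF s] by (simp add: sum_distrib_right[symmetric] mult_right_mono)
    finally have "norm (y s) * norm (M s *v y s) \<le> norm (y s) * (C * norm (y s))"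
      by (intro mult_left_mono) auto
    also have "\<dots> = C * n s" by (simp add: n_def dot_square_norm power2_eq_square)
    finally show ?thesis using Cauchy_Schwarz_ineq2[of "y s" "M s *v y s"] by linarith
  qed
  have "n t \<le> 0"
  proof (cases "c \<le> t")
    case True
    have "n t * exp (- 2 * C * t) \<le> n c * exp (- 2 * C * c)"
    proof (rule DERIV_nonpos_imp_nonincreasing[OF True])
      fix s assume "c \<le> s" "s \<le> t"
      then have s: "s \<in> {a..b}" using c t by auto
      have "((\<lambda>s. n s * exp (- 2 * C * s)) has_real_derivative
          (2 * (y s \<bullet> (M s *v y s)) - 2 * C * n s) * exp (- 2 * C * s)) (at s)"
        by (rule derivative_eq_intros n[OF s] refl)+ (simp add: algebra_simps)
      moreover have "(2 * (y s \<bullet> (M s *v y s)) - 2 * C * n s) * exp (- 2 * C * s) \<le> 0"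
        using le[OF s] by (intro mult_nonpos_nonneg) auto
      ultimately show "\<exists>d. ((\<lambda>s. n s * exp (- 2 * C * s)) has_real_derivative d) (at s) \<and> d \<le> 0" by blast
    qed
    then show ?thesis using c(2) by (simp add: n_def mult_le_0_iff)
  next
    case False
    then have tc: "t \<le> c" by simp
    have "n t * exp (2 * C * t) \<le> n c * exp (2 * C * c)"
    proof (rule DERIV_nonneg_imp_nondecreasing[OF tc])
      fix s assume "t \<le> s" "s \<le> c"
      then have s: "s \<in> {a..b}" using c t by auto
      have "((\<lambda>s. n s * exp (2 * C * s)) has_real_derivative
          (2 * (y s \<bullet> (M s *v y s)) + 2 * C * n s) * exp (2 * C * s)) (at s)"
        by (rule derivative_eq_intros n[OF s] refl)+ (simp add: algebra_simps)
      moreover have "0 \<le> (2 * (y s \<bullet> (M s *v y s)) + 2 * C * n s) * exp (2 * C * s)"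
        using le[OF s] by (intro mult_nonneg_nonneg) auto
      ultimately show "\<exists>d. ((\<lambda>s. n s * exp (2 * C * s)) has_real_derivative d) (at s) \<and> 0 \<le> d" by blast
    qed
    then show ?thesis using c(2) by (simp add: n_def mult_le_0_iff)
  qed
  then show ?thesis
    using inner_gt_zero_iff[of "y t"] by (auto simp: n_def not_less[symmetric])
qed

section \<open>Integrals over material domains\<close>

text \<open>Differentiation under the integral sign: by the mean value theorem the difference
  quotients are bounded by \<open>M\<close> on the bounded set \<open>D\<close>, so dominated
  convergence gives the integral of \<open>g s\<close>, which is zero.\<close>

lemma set_integral_constant_in_time:
  fixes P g :: "real \<Rightarrow> real^3 \<Rightarrow> real"
  assumes D: "open D" "bounded D"
    and P: "\<And>s x. s \<in> {a..b} \<Longrightarrow> x \<in> D \<Longrightarrow> ((\<lambda>s. P s x) has_real_derivative g s x) (at s)"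
    and M: "\<And>s x. s \<in> {a..b} \<Longrightarrow> x \<in> D \<Longrightarrow> \<bar>g s x\<bar> \<le> M"
    and int: "\<And>s. s \<in> {a..b} \<Longrightarrow> set_integrable lborel D (P s)"
    and g: "\<And>s. s \<in> {a..b} \<Longrightarrow> continuous_on D (g s)"
    and zero: "\<And>s. s \<in> {a..b} \<Longrightarrow> (LINT x:D|lborel. g s x) = 0"
    and s: "s \<in> {a..b}" "s' \<in> {a..b}"
  shows "(LINT x:D|lborel. P s x) = (LINT x:D|lborel. P s' x)"
proof -
  let ?I = "\<lambda>s. LINT x:D|lborel. P s x"
  have "(?I has_real_derivative 0) (at s within {a..b})" if s: "s \<in> {a..b}" for s
    unfolding has_field_derivative_iff tendsto_at_iff_sequentially
  proof (intro allI impI)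
    fix X :: "nat \<Rightarrow> real" assume X: "\<forall>i. X i \<in> {a..b} - {s}" and Xs: "X \<longlonglongrightarrow> s"
    define q where "q i x = indicator D x *\<^sub>R ((P (X i) x - P s x) / (X i - s))" for i x
    have intq: "integral\<^sup>L lborel (q i) = (?I (X i) - ?I s) / (X i - s)"
      and q_meas: "q i \<in> borel_measurable lborel" for i
    proof -
      have Xi: "X i \<in> {a..b}" using X by auto
      have "q i = (\<lambda>x. (indicator D x *\<^sub>R P (X i) x - indicator D x *\<^sub>R P s x) / (X i - s))"
        by (auto simp: q_def fun_eq_iff indicator_def)
      moreover have "integrable lborel (\<lambda>x. indicator D x *\<^sub>R P (X i) x)" "integrable lborel (\<lambda>x. indicator D x *\<^sub>R P s x)"
        using int[OF Xi] int[OF s] by (simp_all add: set_integrable_def)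
      ultimately show "integral\<^sup>L lborel (q i) = (?I (X i) - ?I s) / (X i - s)"
        and "q i \<in> borel_measurable lborel"
        by (auto simp: set_lebesgue_integral_def)
    qed
    have "(\<lambda>i. integral\<^sup>L lborel (q i)) \<longlonglongrightarrow> (LINT x|lborel. indicator D x *\<^sub>R g s x)"
    proof (rule integral_dominated_convergence[where w = "\<lambda>x. M * indicator D x"])
      show "(\<lambda>x. indicator D x *\<^sub>R g s x) \<in> borel_measurable lborel"
        using borel_measurable_continuous_on_indicator[OF _ g[OF s]] D(1) by simp
      show "integrable lborel (\<lambda>x. M * indicator D x :: real)"
        by (intro integrable_mult_right integrable_real_indicator emeasure_bounded_finite D(2))
          (simp add: D(1))
      have "norm (q i x) \<le> M * indicator D x" for i x
      proof (cases "x \<in> D")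
        case True
        have "norm (P (X i) x - P s x) \<le> M * norm (X i - s)"
          by (rule field_differentiable_bound[of "{a..b}" "\<lambda>s. P s x" "\<lambda>s. g s x"])
            (use X s True P M in \<open>auto intro: has_field_derivative_at_within\<close>)
        then have "norm ((P (X i) x - P s x) / (X i - s)) \<le> M"
          using X by (simp add: divide_le_eq)
        with True show ?thesis by (simp add: q_def)
      qed (simp add: q_def)
      then show "AE x in lborel. norm (q i x) \<le> M * indicator D x" for i by simp
      have "(\<lambda>i. q i x) \<longlonglongrightarrow> indicator D x *\<^sub>R g s x" for x
      proof (cases "x \<in> D")
        case True
        have "((\<lambda>r. (P r x - P s x) / (r - s)) \<longlongrightarrow> g s x) (at s)"
          using P[OF s True] unfolding has_field_derivative_iff by simp
        moreover have "filterlim X (at s) sequentially"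
          using X Xs by (simp add: filterlim_at)
        ultimately show ?thesis
          using True filterlim_compose by (fastforce simp: q_def)
      qed (simp add: q_def)
      then show "AE x in lborel. (\<lambda>i. q i x) \<longlonglongrightarrow> indicator D x *\<^sub>R g s x" by simp
    qed (rule q_meas)
    then show "((\<lambda>y. (?I y - ?I s) / (y - s)) \<circ> X) \<longlonglongrightarrow> 0"
      using zero[OF s] by (simp add: intq o_def set_lebesgue_integral_def)
  qed
  then have "\<exists>c. \<forall>s\<in>{a..b}. ?I s = c"
    by (intro has_field_derivative_zero_constant) auto
  with s show ?thesis by metis
qed

text \<open>The change of variables is applied to functions with values in \<open>real^1\<close>,
  hence the detour through \<open>vec\<close>. Positivity of the determinant removes the absolute
  value.\<close>

lemma set_integral_change_of_variables:
  fixes f :: "real^3 \<Rightarrow> real^3" and h :: "real^3 \<Rightarrow> real"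
  assumes D: "open D" and f: "\<And>x. x \<in> D \<Longrightarrow> (f has_derivative (\<lambda>v. J x *v v)) (at x)"
    and inj: "inj_on f D" and det: "\<And>x. x \<in> D \<Longrightarrow> 0 < det (J x)"
    and h: "set_integrable lborel (f ` D) h" and Jh: "set_integrable lborel D (\<lambda>x. det (J x) * h (f x))"
  shows "(LINT y:f ` D|lborel. h y) = (LINT x:D|lborel. det (J x) * h (f x))"
proof -
  let ?h = "\<lambda>y. vec (h y) :: real^1"
  have "h absolutely_integrable_on (f ` D)"
    using h unfolding set_integrable_def
    by (subst integrable_completion) (auto dest: borel_measurable_integrable)
  then have abs: "?h absolutely_integrable_on (f ` D)"
    by (simp add: absolutely_integrable_on_1_iff)
  have "integral D (\<lambda>x. \<bar>det (matrix (\<lambda>v. J x *v v))\<bar> *\<^sub>R ?h (f x)) = integral (f ` D) ?h"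
    by (rule integral_change_of_variables[where g = f and f = ?h, OF _ _ inj, symmetric])
      (use D abs in \<open>auto intro: has_derivative_at_withinI[OF f]\<close>)
  then have "integral D (\<lambda>x. \<bar>det (J x)\<bar> * h (f x)) = integral (f ` D) h"
    by (simp add: integral_on_1_eq vec_eq_iff)
  moreover have "integral D (\<lambda>x. \<bar>det (J x)\<bar> * h (f x)) = integral D (\<lambda>x. det (J x) * h (f x))"
    by (rule Henstock_Kurzweil_Integration.integral_cong) (simp add: det less_imp_le)
  ultimately show ?thesis
    by (simp add: set_borel_integral_eq_integral(2)[OF h] set_borel_integral_eq_integral(2)[OF Jh])
qed

section \<open>Material domains\<close>

context flow
begin

lemma F_initial:
  assumes "\<And>X. X \<in> N \<Longrightarrow> \<phi> 0 X = X" "X \<in> N"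
  shows "F 0 X = mat 1"
proof -
  have "(\<phi> 0 has_derivative (\<lambda>h. mat 1 *v h)) (at X)"
    by (rule has_derivative_transform_within_open[OF _ opens(2) assms(2), of "\<lambda>x. x"])
      (simp_all add: assms(1))
  then show ?thesis unfolding F_def by (rule jacobian_eqI)
qed

lemma continuous_phi_time: "X \<in> N \<Longrightarrow> S \<subseteq> T \<Longrightarrow> continuous_on S (\<lambda>s. \<phi> s X)"
  using phi_velocity(1) by (intro continuous_at_imp_continuous_on ballI has_vector_derivative_continuous) blast

text \<open>The difference \<open>y\<close> of the two sides solves \<open>y' = A y\<close> along
  the trajectory of \<open>X\<close> and vanishes at time 0, where \<open>F\<close> is the identity;
  the factor \<open>det F\<close> absorbs the compression term of \<open>frozen_in\<close>.\<close>

lemma frozen_transport: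
  assumes id: "\<And>X. X \<in> N \<Longrightarrow> \<phi> 0 X = X" and X: "X \<in> N"
    and ab: "{a..b} \<subseteq> T" "0 \<in> {a..b}" "t \<in> {a..b}"
    and w: "\<And>s. s \<in> {a..b} \<Longrightarrow> case_prod w differentiable (at (s, \<phi> s X))"
    and fr: "\<And>s. s \<in> {a..b} \<Longrightarrow> frozen_in u w s (\<phi> s X)"
  shows "F t X *v w 0 X = det (F t X) *\<^sub>R w t (\<phi> t X)"
proof -
  define y where "y s = det (F s X) *\<^sub>R w s (\<phi> s X) - F s X *v w 0 X" for s
  have "y t = 0"
  proof (rule linear_ode_zero[of a b y "\<lambda>s. A s (\<phi> s X)" 0 t])
    fix s assume s: "s \<in> {a..b}"
    let ?x = "\<phi> s X"
    have sT: "s \<in> T" using s ab by auto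
    have "(y has_vector_derivative
      (det (F s X) *\<^sub>R (time_deriv w s ?x + jacobian (w s) (at ?x) *v u s ?x)
      + (divergence (u s) ?x * det (F s X)) *\<^sub>R w s ?x) - A s ?x *v (F s X *v w 0 X)) (at s)"
      unfolding y_def[abs_def]
      by (intro has_vector_derivative_diff has_vector_derivative_scaleR det_F_time_derivative
          along_motion F_time_derivative w s sT X)
    moreover have "det (F s X) *\<^sub>R (time_deriv w s ?x + jacobian (w s) (at ?x) *v u s ?x)
      + (divergence (u s) ?x * det (F s X)) *\<^sub>R w s ?x
      = det (F s X) *\<^sub>R (time_deriv w s ?x + jacobian (w s) (at ?x) *v u s ?x + divergence (u s) ?x *\<^sub>R w s ?x)"
      by (simp add: scaleR_add_right mult.commute)
    ultimately show "(y has_vector_derivative A s ?x *v y s) (at s)"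
      using fr[OF s] unfolding frozen_in_def A_def[symmetric]
      by (simp add: y_def matrix_vector_mult_diff_distrib matrix_vector_mult_scaleR)
  next
    have "continuous_on {a..b} (\<lambda>s. (s, \<phi> s X))"
      by (intro continuous_intros continuous_phi_time X ab)
    moreover have "(\<lambda>s. (s, \<phi> s X)) ` {a..b} \<subseteq> R"
      using in_R[OF _ X] ab by auto
    ultimately show "continuous_on {a..b} (\<lambda>s. A s (\<phi> s X))"
      using continuous_on_compose2[OF continuous_A] by fastforce
    show "y 0 = 0"
      by (simp add: y_def F_initial[OF id X] id X)
  qed (use ab in auto)
  then show ?thesis by (simp add: y_def)
qed

text \<open>The determinant is 1 at time 0, continuous in time and never zero, so the intermediate
  value theorem excludes a change of sign.\<close>

lemma det_F_positive:
  assumes id: "\<And>X. X \<in> N \<Longrightarrow> \<phi> 0 X = X" and X: "X \<in> N"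
    and ab: "{a..b} \<subseteq> T" "0 \<in> {a..b}" "t \<in> {a..b}"
  shows "0 < det (F t X)"
proof (rule ccontr)
  assume "\<not> 0 < det (F t X)"
  have "continuous_on {a..b} (\<lambda>s. det (F s X))"
    using det_F_time_derivative[OF _ X] ab
    by (intro continuous_at_imp_continuous_on ballI DERIV_isCont) blast
  then have "connected ((\<lambda>s. det (F s X)) ` {a..b})"
    by (rule connected_continuous_image) simp
  then have i: "is_interval ((\<lambda>s. det (F s X)) ` {a..b})"
    by (simp add: is_interval_connected_1)
  have "1 \<in> (\<lambda>s. det (F s X)) ` {a..b}"
    using ab F_initial[OF id X] by (intro image_eqI[of _ _ 0]) simp_all
  from mem_is_interval_1_I[OF i imageI[OF ab(3)] this, of 0] \<open>\<not> 0 < det (F t X)\<close>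
  obtain s where "s \<in> {a..b}" "det (F s X) = 0" by fastforce
  with det_F_nonzero[OF _ X, of s] ab show False by auto
qed

text \<open>The properties of \<open>w\<close> enter only in Eulerian form, so the vorticity and the
  columns of \<open>F / det F\<close> are treated alike. The equations are available for particles
  of \<open>D\<close>, while the layer \<open>N\<close> provides the bounds and continuity up to the
  boundary.\<close>

lemma material_domain:
  assumes id: "\<And>X. X \<in> N \<Longrightarrow> \<phi> 0 X = X"
    and I: "is_interval I" "0 \<in> I" "I \<subseteq> T" "t \<in> I" and B: "B \<subseteq> N"
    and D: "regular_domain D" "D \<subseteq> B" "closure D \<subseteq> N"
    and w: "\<And>t x. (t, x) \<in> R \<Longrightarrow> case_prod w differentiable (at (t, x))"
    and w_div: "\<And>t x. (t, x) \<in> R \<Longrightarrow> divergence (w t) x = 0"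
    and w0: "Ck_on 1 (w 0) N"
    and fr: "\<And>t X. t \<in> I \<Longrightarrow> X \<in> B \<Longrightarrow> frozen_in u w t (\<phi> t X)"
    and H: "\<And>t. t \<in> I \<Longrightarrow> Ck_on 1 (H t) (\<phi> t ` N)"
    and mom: "\<And>t X. t \<in> I \<Longrightarrow> X \<in> B \<Longrightarrow> momentum_equation H u t (\<phi> t X)"
    and tan: "tangent_to_boundary (w 0) D"
  shows "tangent_to_boundary (w t) (\<phi> t ` D)"
    "set_integrable lborel (\<phi> t ` D) (\<lambda>x. u t x \<bullet> w t x)"
    "helicity u w (\<lambda>s. \<phi> s ` D) t = helicity u w (\<lambda>s. \<phi> s ` D) 0"
proof -
  define a b where "a = min 0 t" and "b = max 0 t"
  have abI: "{a..b} \<subseteq> I"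
  proof
    fix s assume "s \<in> {a..b}"
    moreover have "a \<in> I" "b \<in> I" using I(2,4) by (auto simp: a_def b_def min_def max_def)
    ultimately show "s \<in> I" using mem_is_interval_1_I[OF I(1), of a b s] by simp
  qed
  have abT: "{a..b} \<subseteq> T" using abI I(3) by blast
  have zt: "0 \<in> {a..b}" "t \<in> {a..b}" by (auto simp: a_def b_def)
  have oD: "open D" "bounded D" using D(1) by (auto simp: regular_domain_def)
  have DN: "D \<subseteq> N" using D(3) closure_subset by blast
  have compD: "compact (closure D)" using oD(2) by simp
  have det_pos: "0 < det (F s X)" if "s \<in> {a..b}" "X \<in> N" for s X
    by (rule det_F_positive[OF id that(2) abT zt(1) that(1)])
  have transport: "F s X *v w 0 X = det (F s X) *\<^sub>R w s (\<phi> s X)" if s: "s \<in> {a..b}" and X: "X \<in> D" for s X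
  proof (rule frozen_transport[OF id _ abT zt(1) s])
    show "X \<in> N" using X DN by auto
    fix r assume "r \<in> {a..b}"
    then have r: "r \<in> T" "r \<in> I" using abT abI by auto
    show "case_prod w differentiable (at (r, \<phi> r X))"
      by (intro w in_R) (use r X DN in auto)
    show "frozen_in u w r (\<phi> r X)"
      by (rule fr) (use r X D(2) in auto)
  qed
  have phi_s: "Ck_on 2 (\<phi> s) N" if "s \<in> T" for s
    using Ck_on_slice[OF phi_smooth opens(3) opens(2)] that by blast
  have phi_cont: "continuous_on N (\<phi> s)" if "s \<in> T" for s
    by (rule Ck_on_imp_continuous_on[OF phi_s[OF that]])
  have u_s: "Ck_on 2 (u s) (\<phi> s ` N)" if "s \<in> T" for s
    using Ck_on_slice[OF u_C2 open_R open_image[OF that]] that R_iff by blast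
  have w_cont: "continuous_on (\<phi> s ` N) (w s)" if s: "s \<in> T" for s
  proof (intro continuous_at_imp_continuous_on ballI)
    fix x assume "x \<in> \<phi> s ` N"
    then have "(s, x) \<in> R" using s by (simp add: R_iff)
    from w[OF this] show "isCont (w s) x"
      using jacobian_slice(2) differentiable_imp_continuous_within unfolding differentiable_def by blast
  qed
  have F_cont: "continuous_on N (F s)" if "s \<in> T" for s
  proof -
    have "continuous_on N (\<lambda>X. (s, X))" by (intro continuous_intros)
    from continuous_on_compose2[OF continuous_F this] that show ?thesis by auto
  qed
  have w0_cont: "continuous_on N (w 0)" by (rule Ck_on_imp_continuous_on[OF w0])
  have im: "open (\<phi> s ` D)" "bounded (\<phi> s ` D)" "closure (\<phi> s ` D) = \<phi> s ` closure D"
      "frontier (\<phi> s ` D) = \<phi> s ` frontier D" if "s \<in> T" for s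
    using image_closure_frontier[OF oD D(3) opens(2) phi_cont[OF that] inj[OF that]] by simp_all
  have tT: "t \<in> T" using I by auto
  show "tangent_to_boundary (w t) (\<phi> t ` D)"
    unfolding tangent_to_boundary_def
  proof (intro ballI allI impI)
    fix p n assume p: "p \<in> frontier (\<phi> t ` D)" and n: "outward_normal (\<phi> t ` D) p n"
    then obtain X where X: "X \<in> frontier D" "p = \<phi> t X" using im(4)[OF tT] by auto
    have XC: "X \<in> closure D" and XN: "X \<in> N" using X(1) D(3) by (auto simp: frontier_def)
    have "outward_normal D X (transpose (jacobian (\<phi> t) (at X)) *v n)"
      by (rule outward_normal_pullback[OF opens(2) Ck_on_le[OF phi_s[OF tT]] inj[OF tT] _ DN XN])
        (use n X(2) det_F_nonzero[OF tT] in \<open>auto simp: F_def\<close>)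
    with tan X(1) have "w 0 X \<bullet> (transpose (F t X) *v n) = 0"
      unfolding tangent_to_boundary_def F_def by blast
    then have "n \<bullet> (F t X *v w 0 X) = 0" by (simp add: inner_matrix_vector inner_commute)
    moreover have "F t X *v w 0 X - det (F t X) *\<^sub>R w t (\<phi> t X) = 0"
    proof (rule continuous_constant_on_closure[OF _ _ XC])
      show "continuous_on (closure D) (\<lambda>X. F t X *v w 0 X - det (F t X) *\<^sub>R w t (\<phi> t X))"
        by (rule continuous_on_subset[OF _ D(3)])
          (intro continuous_intros F_cont w0_cont tT continuous_on_compose2[OF w_cont[OF tT] phi_cont[OF tT]] order_refl)
    qed (simp add: transport[OF zt(2)])
    ultimately show "w t p \<bullet> n = 0"
      using det_pos[OF zt(2) XN] X(2) by (simp add: inner_commute)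
  qed
  have uw_int: "set_integrable lborel (\<phi> s ` D) (\<lambda>x. u s x \<bullet> w s x)" if s: "s \<in> T" for s
  proof (rule set_integrable_continuous_bounded[OF im(1,2)[OF s]])
    show "closure (\<phi> s ` D) \<subseteq> \<phi> s ` N" using im(3)[OF s] D(3) by auto
    show "continuous_on (\<phi> s ` N) (\<lambda>x. u s x \<bullet> w s x)"
      by (intro continuous_intros w_cont[OF s] Ck_on_imp_continuous_on[OF u_s[OF s]])
  qed
  then show "set_integrable lborel (\<phi> t ` D) (\<lambda>x. u t x \<bullet> w t x)" using tT .
  \<comment> \<open>The helicity density pulled back to the initial domain. The factor
    \<open>det F\<close> from the change of variables is absorbed by the transport identity, so
    \<open>w\<close> is involved only at time 0.\<close>
  define P where "P s X = u s (\<phi> s X) \<bullet> (F s X *v w 0 X)" for s X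
  have P_int: "set_integrable lborel D (P s)" if s: "s \<in> T" for s
    unfolding P_def[abs_def]
    by (rule set_integrable_continuous_bounded[OF oD D(3)])
      (intro continuous_intros F_cont[OF s] w0_cont order_refl
        continuous_on_compose2[OF Ck_on_imp_continuous_on[OF u_s[OF s]] phi_cont[OF s]])
  have P_eq: "P s X = det (F s X) * (u s (\<phi> s X) \<bullet> w s (\<phi> s X))" if "s \<in> {a..b}" "X \<in> D" for s X
    by (simp add: P_def transport[OF that])
  have helicity_P: "helicity u w (\<lambda>s. \<phi> s ` D) s = (LINT X:D|lborel. P s X)" if s: "s \<in> {a..b}" for s
  proof -
    have sT: "s \<in> T" using s abT by auto
    have Jint: "set_integrable lborel D (\<lambda>X. det (F s X) * (u s (\<phi> s X) \<bullet> w s (\<phi> s X)))"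
      using P_int[OF sT] by (rule set_integrable_cong[OF refl refl, THEN iffD1, rotated]) (simp add: P_eq[OF s])
    have "(LINT x:\<phi> s ` D|lborel. u s x \<bullet> w s x) = (LINT X:D|lborel. det (F s X) * (u s (\<phi> s X) \<bullet> w s (\<phi> s X)))"
      by (rule set_integral_change_of_variables[OF oD(1) phi_has_derivative[OF sT] _ det_pos[OF s] uw_int[OF sT] Jint])
        (use DN inj[OF sT] inj_on_subset in auto)
    also have "\<dots> = (LINT X:D|lborel. P s X)"
      by (rule set_lebesgue_integral_cong) (use oD in \<open>auto simp: P_eq[OF s]\<close>)
    finally show ?thesis by (simp add: helicity_def)
  qed
  \<comment> \<open>The time derivative of \<open>P\<close> from kinematics alone. In this form it
    is continuous on all of \<open>T \<times> N\<close>, which bounds it uniformly up to the closure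
    of \<open>D\<close>.\<close>
  define g where "g s X = (time_deriv u s (\<phi> s X) + A s (\<phi> s X) *v u s (\<phi> s X)) \<bullet> (F s X *v w 0 X)
      + u s (\<phi> s X) \<bullet> (A s (\<phi> s X) *v (F s X *v w 0 X))" for s X
  have P_deriv: "((\<lambda>s. P s X) has_real_derivative g s X) (at s)" if s: "s \<in> T" and X: "X \<in> N" for s X
  proof -
    have "case_prod u differentiable (at (s, \<phi> s X))"
      using u_deriv[OF in_R[OF s X]] by (rule differentiableI)
    from bounded_bilinear.has_vector_derivative[OF bounded_bilinear_inner along_motion[OF s X this] F_time_derivative[OF s X]]
    show ?thesis
      by (simp add: P_def g_def A_def has_real_derivative_iff_has_vector_derivative add.commute)
  qed
  have g_cont: "continuous_on (T \<times> N) (\<lambda>z. g (fst z) (snd z))"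
  proof -
    have L: "continuous_on (T \<times> N) (\<lambda>z. (fst z, \<phi> (fst z) (snd z)))"
      using Ck_on_imp_continuous_on[OF lagrange_smooth] by (simp add: case_prod_beta')
    have comp: "continuous_on (T \<times> N) (\<lambda>z. f (fst z, \<phi> (fst z) (snd z)))" if "continuous_on R f"
      for f :: "real \<times> (real^3) \<Rightarrow> 'z::topological_space"
      by (rule continuous_on_compose2[OF that L]) (auto simp: in_R)
    have "continuous_on R (\<lambda>z. fderiv (case_prod u) z (1, 0))"
      by (rule Ck_on_imp_continuous_on[OF C2_on_fderiv[OF open_R u_C2]])
    then have "continuous_on R (\<lambda>z. time_deriv u (fst z) (snd z))"
      by (rule continuous_on_eq) (auto simp: time_deriv_slice[OF u_deriv])
    note comp[OF this] comp[OF continuous_A] comp[OF Ck_on_imp_continuous_on[OF u_C2]]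
    note c = this[simplified]
    have "continuous_on (T \<times> N) (\<lambda>z. w 0 (snd z))"
      by (rule continuous_on_compose2[OF w0_cont]) (auto intro: continuous_intros)
    note c this
    then show ?thesis
      unfolding g_def by (intro continuous_intros continuous_F)
  qed
  have "compact ({a..b} \<times> closure D)" using compD by (intro compact_Times) auto
  then have "bounded ((\<lambda>z. g (fst z) (snd z)) ` ({a..b} \<times> closure D))"
    using abT D(3) by (intro compact_imp_bounded compact_continuous_image continuous_on_subset[OF g_cont]) auto
  then obtain M where "\<forall>z\<in>{a..b} \<times> closure D. \<bar>g (fst z) (snd z)\<bar> \<le> M"
    unfolding bounded_iff by auto
  then have M: "\<bar>g s X\<bar> \<le> M" if "s \<in> {a..b}" "X \<in> D" for s X
    using that subsetD[OF closure_subset that(2)] by auto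
  have g_zero: "(LINT X:D|lborel. g s X) = 0" if s: "s \<in> {a..b}" for s
  proof -
    have sT: "s \<in> T" and sI: "s \<in> I" using s abT abI by auto
    let ?q = "\<lambda>x. H s x - (norm (u s x))\<^sup>2 / 2"
    let ?f = "\<lambda>X. ?q (\<phi> s X) *\<^sub>R w 0 X"
    have q: "Ck_on 1 ?q (\<phi> s ` N)"
    proof -
      have "Ck_on 1 (\<lambda>x. H s x - (1 / 2) * (u s x \<bullet> u s x)) (\<phi> s ` N)"
        by (intro Ck_on_diff Ck_on_mult Ck_on_inner Ck_on_const open_image[OF sT] H[OF sI]
            Ck_on_le[OF u_s[OF sT]]) simp_all
      then show ?thesis by (simp add: power2_norm_eq_inner)
    qed
    have q\<phi>: "Ck_on 1 (\<lambda>X. ?q (\<phi> s X)) N"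
      by (rule Ck_on_compose[OF opens(2) open_image[OF sT] Ck_on_le[OF phi_s[OF sT]] q]) auto
    have f: "Ck_on 1 ?f N"
      by (intro Ck_on_scaleR opens(2) q\<phi> w0)
    have "tangent_to_boundary ?f D"
      using tan by (simp add: tangent_to_boundary_def)
    from tangent_divergence_theorem(2)[OF D(1) opens(2) D(3) f this]
    have "(LINT X:D|lborel. divergence ?f X) = 0" .
    \<comment> \<open>The momentum equation replaces the acceleration by
      \<open>- transpose A *v u - grad ?q\<close>. Its first term cancels against
      \<open>u \<bullet> (A *v (F *v w 0))\<close>, and the second is a divergence because
      \<open>w 0\<close> is divergence-free.\<close>
    moreover have "g s X = - divergence ?f X" if X: "X \<in> D" for X
    proof -
      let ?x = "\<phi> s X"
      have XN: "X \<in> N" using X DN by auto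
      have xR: "(s, ?x) \<in> R" by (rule in_R[OF sT XN])
      have qd: "?q differentiable (at ?x)" by (rule Ck_on_differentiable[OF q]) (use XN in auto)
      have gq: "((\<lambda>X. ?q (\<phi> s X)) has_derivative (\<lambda>h. grad ?q ?x \<bullet> (F s X *v h))) (at X)"
        by (rule has_derivative_compose[OF phi_has_derivative[OF sT XN] grad_has_derivative[OF qd]])
      have "grad (\<lambda>X. ?q (\<phi> s X)) X \<bullet> w 0 X = grad ?q ?x \<bullet> (F s X *v w 0 X)"
        by (rule fun_cong[OF has_derivative_unique[OF grad_has_derivative[OF differentiableI[OF gq]] gq]])
      moreover have "divergence (w 0) X = 0"
        using w_div[of 0 X] I XN id[OF XN] in_R[of 0 X] by auto
      ultimately have dv: "divergence ?f X = grad ?q ?x \<bullet> (F s X *v w 0 X)"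
        using divergence_scaleR[OF Ck_on_differentiable[OF q\<phi> _ XN] Ck_on_differentiable[OF w0 _ XN]] by simp
      have "X \<in> B" using X D(2) by auto
      from momentum_equation_velocity[OF xR mom[OF sI this]]
      have "time_deriv u s ?x + A s ?x *v u s ?x = - (transpose (A s ?x) *v u s ?x) - grad ?q ?x"
        by (simp del: transpose_matrix_vector)
      then show ?thesis
        unfolding dv g_def
        by (simp add: inner_diff_left inner_matrix_vector[symmetric] del: transpose_matrix_vector)
    qed
    ultimately have "(LINT X:D|lborel. g s X) = (LINT X:D|lborel. - divergence ?f X)"
      by (intro set_lebesgue_integral_cong) (use oD in auto)
    then show ?thesis
      using \<open>(LINT X:D|lborel. divergence ?f X) = 0\<close> by (simp add: set_lebesgue_integral_def)
  qed
  have "(LINT X:D|lborel. P t X) = (LINT X:D|lborel. P 0 X)"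
  proof (rule set_integral_constant_in_time[OF oD _ M _ _ g_zero zt(2) zt(1)])
    fix s assume s: "s \<in> {a..b}"
    then have sT: "s \<in> T" using abT by auto
    show "((\<lambda>s. P s X) has_real_derivative g s X) (at s)" if "X \<in> D" for X
      using P_deriv[OF sT] that DN by auto
    show "set_integrable lborel D (P s)" by (rule P_int[OF sT])
    have "continuous_on D (\<lambda>X. (s, X))" by (intro continuous_intros)
    from continuous_on_compose2[OF g_cont this] sT DN show "continuous_on D (g s)" by auto
  qed
  then show "helicity u w (\<lambda>s. \<phi> s ` D) t = helicity u w (\<lambda>s. \<phi> s ` D) 0"
    by (simp only: helicity_P[OF zt(1)] helicity_P[OF zt(2)])
qed

end

section \<open>Reparametrisation by the initial position\<close>

context flow
begin

text \<open>The same motion labelled by positions at time 0; trajectories and the Eulerian velocity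
  are unchanged.\<close>

definition \<Phi> :: "real \<Rightarrow> real^3 \<Rightarrow> real^3" where "\<Phi> t x = \<phi> t (inv_into N (\<phi> 0) x)"

lemma Phi_image:
  assumes "0 \<in> T" "S \<subseteq> N"
  shows "\<Phi> t ` (\<phi> 0 ` S) = \<phi> t ` S"
proof -
  have "\<Phi> t (\<phi> 0 X) = \<phi> t X" if "X \<in> S" for X
    using inv_into_f_f[OF inj[OF assms(1)]] that assms(2) by (auto simp: \<Phi>_def)
  then show ?thesis by (simp add: image_image)
qed

lemma Phi_region:
  assumes "0 \<in> T" "S \<subseteq> N"
  shows "eulerian_region I (\<phi> 0 ` S) \<Phi> = eulerian_region I S \<phi>"
  unfolding eulerian_region_def by (simp add: Phi_image[OF assms])

text \<open>Smoothness is inherited by composing with the inverse of \<open>\<phi> 0\<close>, and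
  the inverse of \<open>\<Phi> t\<close> is \<open>\<phi> 0\<close> after the inverse of
  \<open>\<phi> t\<close>. The Eulerian region stays the same, so the hypotheses on \<open>u\<close>
  carry over.\<close>

lemma flow_Phi:
  assumes 0: "0 \<in> T"
  shows "flow T (\<phi> 0 ` N) \<Phi> u"
proof
  let ?N = "\<phi> 0 ` N" and ?i = "inv_into N (\<phi> 0)"
  note oN = open_image[OF 0]
  show "Ck_on 2 (case_prod u) (eulerian_region T ?N \<Phi>)"
    using u_smooth by (simp add: Phi_region[OF 0])
  show "velocity_of_motion T ?N \<Phi> u"
    using velocity inv_into_f_f[OF inj[OF 0]]
    by (auto simp: velocity_of_motion_def \<Phi>_def time_deriv_def)
  have o: "open (T \<times> ?N)" by (intro open_Times opens oN)
  have iN: "?i x \<in> N" if "x \<in> ?N" for x using that by (rule inv_into_into)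
  have "Ck_on 2 (\<lambda>z. ?i (snd z)) (T \<times> ?N)"
    by (rule Ck_on_compose[OF o oN Ck_on_bounded_linear_fun[OF o bounded_linear_snd] inv_smooth[OF 0]]) auto
  then have "Ck_on 2 (\<lambda>z. (fst z, ?i (snd z))) (T \<times> ?N)"
    by (intro Ck_on_Pair[OF o] Ck_on_bounded_linear_fun[OF o bounded_linear_fst])
  moreover have "(\<lambda>z. (fst z, ?i (snd z))) ` (T \<times> ?N) \<subseteq> T \<times> N"
    using iN by auto
  ultimately have "Ck_on 2 (\<lambda>z. case_prod \<phi> (fst z, ?i (snd z))) (T \<times> ?N)"
    by (rule Ck_on_compose[OF o opens(3) _ phi_smooth])
  then have smooth: "Ck_on 2 (\<lambda>(t, x). \<Phi> t x) (T \<times> ?N)"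
    by (simp add: case_prod_beta' \<Phi>_def)
  have Phi_inj: "inj_on (\<Phi> t) ?N" if t: "t \<in> T" for t
    using inj[OF t] inv_into_f_f[OF inj[OF 0]] by (auto simp: inj_on_def \<Phi>_def)
  have Phi_inv: "Ck_on 2 (inv_into ?N (\<Phi> t)) (\<Phi> t ` ?N)" if t: "t \<in> T" for t
  proof -
    have "Ck_on 2 (\<phi> 0) N"
      using Ck_on_slice[OF phi_smooth opens(3) opens(2)] 0 by blast
    from Ck_on_compose[OF open_image[OF t] opens(2) inv_smooth[OF t] this]
    have "Ck_on 2 (\<lambda>y. \<phi> 0 (inv_into N (\<phi> t) y)) (\<phi> t ` N)"
      using inv_into_into by (metis (no_types, lifting) image_subsetI)
    moreover have "inv_into ?N (\<Phi> t) y = \<phi> 0 (inv_into N (\<phi> t) y)" if y: "y \<in> \<phi> t ` N" for y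
    proof (rule inv_into_f_eq[OF Phi_inj[OF t]])
      have "inv_into N (\<phi> t) y \<in> N" using y by (rule inv_into_into)
      then show "\<phi> 0 (inv_into N (\<phi> t) y) \<in> ?N" "\<Phi> t (\<phi> 0 (inv_into N (\<phi> t) y)) = y"
        using inv_into_f_f[OF inj[OF 0]] f_inv_into_f[OF y] by (auto simp: \<Phi>_def)
    qed
    ultimately show ?thesis
      unfolding Phi_image[OF 0 order_refl] by (rule Ck_on_cong[OF open_image[OF t], THEN iffD2, rotated])
  qed
  show "motion T ?N \<Phi>"
    unfolding motion_def
  proof (intro conjI ballI opens oN smooth Phi_inj Phi_inv)
    show "open (\<Phi> t ` ?N)" if "t \<in> T" for t
      unfolding Phi_image[OF 0 order_refl] by (rule open_image[OF that])
  qed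
qed

lemma Phi_initial: "0 \<in> T \<Longrightarrow> x \<in> \<phi> 0 ` N \<Longrightarrow> \<Phi> 0 x = x"
  by (simp add: \<Phi>_def f_inv_into_f)

end

section \<open>The specific enthalpy\<close>

lemma Ck_on_divergence:
  assumes "open S" "Ck_on (Suc k) v S"
  shows "Ck_on k (divergence v) S"
  unfolding divergence_def[abs_def] trace_def jacobian_def matrix_def
  by (simp del: Ck_on.simps) (intro Ck_on_sum Ck_on_nth Ck_on_frechet_derivative assms)

text \<open>A count of derivatives: with \<open>r\<close> and \<open>W\<close> of class C3, both
  \<open>grad r\<close> and the derivatives of \<open>W\<close> along \<open>(r, grad r)\<close> are
  C2, and the divergence costs one more. The one-variable derivatives in the definition are first
  identified with derivatives of \<open>W\<close> in the pair.\<close>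

lemma variational_deriv_smooth:
  assumes S: "open S" and r: "Ck_on 3 r S" and W: "Ck_on 3 W ({0<..} \<times> UNIV)"
    and pos: "\<And>x. x \<in> S \<Longrightarrow> 0 < r x"
  shows "Ck_on 1 (variational_deriv W r) S"
proof -
  let ?Q = "{0<..} \<times> UNIV :: (real \<times> (real^3)) set"
  have oQ: "open ?Q" by (intro open_Times) auto
  have g2: "Ck_on 2 (grad r) S"
    using Ck_on_grad[OF S, of 2 r] r by (simp add: eval_nat_numeral)
  have r2: "Ck_on 2 r S" by (rule Ck_on_le[OF r]) simp
  have z: "Ck_on 2 (\<lambda>x. (r x, grad r x)) S" by (rule Ck_on_Pair[OF S r2 g2])
  have inQ: "(\<lambda>x. (r x, grad r x)) ` S \<subseteq> ?Q" using pos by auto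
  have DW: "Ck_on 2 (\<lambda>x. fderiv W (r x, grad r x) v) S" for v
    by (rule Ck_on_compose[OF S oQ z _ inQ]) (rule Ck_on_frechet_derivative[OF oQ], use W in \<open>simp add: eval_nat_numeral\<close>)
  have W': "(W has_derivative fderiv W (s, p)) (at (s, p))" if "0 < s" for s p
    by (rule Ck_on_has_derivative[OF W]) (use that in auto)
  have 1: "deriv (\<lambda>s. W (s, grad r x)) (r x) = fderiv W (r x, grad r x) (1, 0)" if "x \<in> S" for x
  proof -
    have "((\<lambda>s. W (s, grad r x)) has_vector_derivative fderiv W (r x, grad r x) (1, 0)) (at (r x))"
      using slice_time[where f = "\<lambda>s p. W (s, p)"] W'[OF pos[OF that]] by (simp add: case_prod_beta')
    then show ?thesis
      by (intro DERIV_imp_deriv) (simp add: has_real_derivative_iff_has_vector_derivative)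
  qed
  have 2: "grad (\<lambda>p. W (r x, p)) (grad r x) = (\<chi> i. fderiv W (r x, grad r x) (0, axis i 1))"
    if "x \<in> S" for x
  proof -
    have "((\<lambda>p. W (r x, p)) has_derivative (\<lambda>h. fderiv W (r x, grad r x) (0, h))) (at (grad r x))"
      using slice_space[where f = "\<lambda>s p. W (s, p)"] W'[OF pos[OF that]] by (simp add: case_prod_beta')
    from frechet_derivative_at[OF this, symmetric] show ?thesis by (simp add: grad_def)
  qed
  have "Ck_on 2 (\<lambda>x. grad (\<lambda>p. W (r x, p)) (grad r x)) S"
    by (rule Ck_on_cong[OF S 2, THEN iffD2], assumption) (intro Ck_on_vec_lambda S DW)
  then have "Ck_on 1 (divergence (\<lambda>x. grad (\<lambda>p. W (r x, p)) (grad r x))) S"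
    by (intro Ck_on_divergence S) (simp add: numeral_2_eq_2)
  moreover have "Ck_on 1 (\<lambda>x. deriv (\<lambda>s. W (s, grad r x)) (r x)) S"
    by (rule Ck_on_cong[OF S 1, THEN iffD2], assumption) (rule Ck_on_le[OF DW], simp)
  ultimately show ?thesis
    unfolding variational_deriv_def[abs_def] by (intro Ck_on_diff S)
qed

lemma (in flow) H_smooth:
  assumes t: "t \<in> T" and \<rho>: "Ck_on 3 (case_prod \<rho>) R" and V: "Ck_on 1 (case_prod V) R"
    and W: "Ck_on 3 W ({0<..} \<times> UNIV)" and pos: "\<And>t x. (t, x) \<in> R \<Longrightarrow> 0 < \<rho> t x"
  shows "Ck_on 1 (H_of W V \<rho> t) (\<phi> t ` N)"
proof -
  have x: "(t, x) \<in> R" if "x \<in> \<phi> t ` N" for x using that t by (simp add: R_iff)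
  note sl = Ck_on_slice[OF _ open_R open_image[OF t] x]
  have "Ck_on 1 (variational_deriv W (\<rho> t)) (\<phi> t ` N)"
    by (rule variational_deriv_smooth[OF open_image[OF t] sl[OF \<rho>] W pos[OF x]])
  then show ?thesis
    unfolding H_of_def[abs_def] by (intro Ck_on_add open_image t sl[OF V])
qed

theorem theorem7:
  fixes I T :: "real set" and B N :: "(real^3) set"
    and \<phi> u w :: "real \<Rightarrow> real^3 \<Rightarrow> real^3"
    and \<rho> V :: "real \<Rightarrow> real^3 \<Rightarrow> real"
    and W :: "real \<times> (real^3) \<Rightarrow> real"
  assumes "motion T N \<phi>"
    and "is_interval I" "0 \<in> I" "I \<subseteq> T"
    and "open B" "B \<subseteq> N"
    and "velocity_of_motion T N \<phi> u"
    and "Ck_on 2 (\<lambda>(t, x). u t x) (eulerian_region T N \<phi>)"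
    and "Ck_on 3 (\<lambda>(t, x). \<rho> t x) (eulerian_region T N \<phi>)"
    and "Ck_on 1 (\<lambda>(t, x). V t x) (eulerian_region T N \<phi>)"
    and "Ck_on 3 W ({0<..} \<times> UNIV)"
    and "\<And>t x. (t, x) \<in> eulerian_region T N \<phi> \<Longrightarrow> \<rho> t x > 0"
    and "\<And>t x. (t, x) \<in> eulerian_region I B \<phi> \<Longrightarrow> mass_equation \<rho> u t x"
    and "\<And>t x. (t, x) \<in> eulerian_region I B \<phi> \<Longrightarrow> momentum_equation (H_of W V \<rho>) u t x"
    and "w = (\<lambda>t. curl (u t)) \<or> (\<exists>i. w = E_field N \<phi> i)"
  shows "(\<forall>(t, x) \<in> eulerian_region I B \<phi>. helicity_conservation_law (H_of W V \<rho>) u w t x) \<and>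
    (\<forall>D. regular_domain D \<and> D \<subseteq> B \<and> closure D \<subseteq> N \<and> tangent_to_boundary (w 0) (\<phi> 0 ` D) \<longrightarrow>
      (\<forall>t\<in>I. tangent_to_boundary (w t) (\<phi> t ` D) \<and>
             set_integrable lborel (\<phi> t ` D) (\<lambda>x. u t x \<bullet> w t x) \<and>
             helicity u w (\<lambda>s. \<phi> s ` D) t = helicity u w (\<lambda>s. \<phi> s ` D) 0))"
proof -
  interpret flow T N \<phi> u
    by (rule flow.intro[OF assms(1,7,8)])
  let ?H = "H_of W V \<rho>"
  have zT: "0 \<in> T" using assms(3,4) by auto
  have inIB: "(t, \<phi> t X) \<in> eulerian_region I B \<phi>" if "t \<in> I" "X \<in> B" for t X
    using that by (auto simp: eulerian_region_def)
  have H: "Ck_on 1 (?H t) (\<phi> t ` N)" if "t \<in> T" for t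
    by (rule H_smooth[OF that assms(9-12)[folded R_def]])
  have mom: "momentum_equation ?H u t (\<phi> t X)" if "t \<in> I" "X \<in> B" for t X
    by (rule assms(14)[OF inIB[OF that]])
  \<comment> \<open>These facts are all that is used about \<open>w\<close> from here on. The
    analytic ones hold on the whole layer, whereas \<open>frozen_in\<close> is limited to
    \<open>I\<close> and \<open>B\<close> because for the vorticity it depends on the momentum
    equation.\<close>
  have w: "(\<forall>(t, x)\<in>R. case_prod w differentiable (at (t, x)) \<and> divergence (w t) x = 0) \<and>
      Ck_on 1 (w 0) (\<phi> 0 ` N) \<and> (\<forall>t\<in>I. \<forall>X\<in>B. frozen_in u w t (\<phi> t X))"
    using assms(15)
  proof
    assume "w = (\<lambda>t. curl (u t))"
    then have w: "w = \<omega>" by (simp add: \<omega>_def[abs_def])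
    \<comment> \<open>The open set is the image of \<open>B\<close>, where the momentum equation
      holds in a full neighbourhood and may therefore be differentiated in space.\<close>
    have "frozen_in u \<omega> t (\<phi> t X)" if t: "t \<in> I" and X: "X \<in> B" for t X
    proof (rule frozen_omega)
      have tT: "t \<in> T" using t assms(4) by auto
      show "t \<in> T" "\<phi> t ` B \<subseteq> \<phi> t ` N" "\<phi> t X \<in> \<phi> t ` B" using tT X assms(6) by auto
      have "continuous_on N (\<phi> t)"
        by (intro continuous_at_imp_continuous_on ballI has_derivative_continuous[OF phi_has_derivative[OF tT]])
      then show "open (\<phi> t ` B)"
        using assms(5,6) inj[OF tT] continuous_on_subset inj_on_subset by (intro invariance_of_domain) blast+
      show "Ck_on 1 (?H t) (\<phi> t ` B)"
        by (rule Ck_on_subset[OF H[OF tT]]) (use assms(6) in auto)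
      show "time_deriv u t y + A t y *v u t y + grad (?H t) y = 0" if y: "y \<in> \<phi> t ` B" for y
      proof -
        obtain Y where Y: "Y \<in> B" "y = \<phi> t Y" using y by auto
        then have YN: "Y \<in> N" using assms(6) by auto
        show ?thesis
          unfolding A_def Y(2)
          by (rule momentum_equation_euler[OF jacobian_slice(2)[OF u_deriv[OF in_R[OF tT YN]]]
                Ck_on_differentiable[OF H[OF tT]] mom[OF t Y(1)]]) (use YN in auto)
      qed
    qed
    moreover have "Ck_on 1 (\<omega> 0) (\<phi> 0 ` N)"
      using Ck_on_slice[OF omega_smooth open_R open_image[OF zT]] zT R_iff by blast
    ultimately show ?thesis
      using w differentiableI[OF omega_has_derivative] divergence_omega by (auto simp del: One_nat_def)
  next
    assume "\<exists>i. w = E_field N \<phi> i"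
    then obtain i where w: "w = E i" by (auto simp: E_def)
    have "case_prod (E i) differentiable (at (t, x)) \<and> divergence (E i t) x = 0" if "(t, x) \<in> R" for t x
      using that E_differentiable divergence_E by (auto simp: R_iff)
    moreover have "frozen_in u (E i) t (\<phi> t X)" if "t \<in> I" "X \<in> B" for t X
      by (rule frozen_E) (use that assms(4,6) in auto)
    ultimately show ?thesis
      using w E_slice_smooth[OF zT] by (auto simp del: One_nat_def)
  qed
  have law: "helicity_conservation_law ?H u w t x" if tx: "(t, x) \<in> eulerian_region I B \<phi>" for t x
  proof -
    obtain X where X: "t \<in> I" "X \<in> B" "x = \<phi> t X" using tx by (auto simp: eulerian_region_def)
    then have tT: "t \<in> T" and XN: "X \<in> N" using assms(4,6) by auto
    note xR = in_R[OF tT XN, folded X(3)]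
    show ?thesis
    proof (rule helicity_law[OF xR])
      show "?H t differentiable (at x)"
        by (rule Ck_on_differentiable[OF H[OF tT]]) (use X XN in auto)
    qed (use w xR X mom in auto)
  qed
  have "tangent_to_boundary (w t) (\<phi> t ` D) \<and>
      set_integrable lborel (\<phi> t ` D) (\<lambda>x. u t x \<bullet> w t x) \<and>
      helicity u w (\<lambda>s. \<phi> s ` D) t = helicity u w (\<lambda>s. \<phi> s ` D) 0"
    if D: "regular_domain D" "D \<subseteq> B" "closure D \<subseteq> N" and tan: "tangent_to_boundary (w 0) (\<phi> 0 ` D)"
      and t: "t \<in> I" for D t
  proof -
    \<comment> \<open>The fields \<open>w\<close> remain those of the original motion: columns of
      its own deformation gradient, not of that of \<open>\<Phi>\<close>. This is consistent because
      \<open>u\<close> and the Eulerian region coincide for both flows.\<close>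
    interpret \<Phi>: flow T "\<phi> 0 ` N" \<Phi> u by (rule flow_Phi[OF zT])
    have R: "\<Phi>.R = R" unfolding \<Phi>.R_def R_def by (rule Phi_region[OF zT order_refl])
    have DN: "D \<subseteq> N" using D(2) assms(6) by auto
    have phi0: "Ck_on 2 (\<phi> 0) N"
      using Ck_on_slice[OF phi_smooth opens(3) opens(2)] zT by blast
    have "closure (\<phi> 0 ` D) = \<phi> 0 ` closure D"
      by (rule image_closure_frontier(3)[OF _ _ D(3) opens(2) Ck_on_imp_continuous_on[OF phi0] inj[OF zT]])
        (use D(1) in \<open>auto simp: regular_domain_def\<close>)
    then have cl: "closure (\<phi> 0 ` D) \<subseteq> \<phi> 0 ` N" using D(3) by auto
    have reg: "regular_domain (\<phi> 0 ` D)"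
      by (rule regular_domain_image[OF D(1,3) opens(2) Ck_on_le[OF phi0] open_image[OF zT] Ck_on_le[OF inv_smooth[OF zT]]])
        (use inv_into_f_f[OF inj[OF zT]] in auto)
    have PhiX: "\<Phi> s (\<phi> 0 X) = \<phi> s X" if "X \<in> N" for s X
      using inv_into_f_f[OF inj[OF zT] that] by (simp add: \<Phi>_def)
    note res = \<Phi>.material_domain[where I = I and t = t and B = "\<phi> 0 ` B" and D = "\<phi> 0 ` D" and w = w and H = ?H]
    have frz: "frozen_in u w s (\<Phi> s X)" if "s \<in> I" "X \<in> \<phi> 0 ` B" for s X
      using that w assms(6) PhiX by (auto simp: subset_iff)
    have mom': "momentum_equation ?H u s (\<Phi> s X)" if "s \<in> I" "X \<in> \<phi> 0 ` B" for s X
      using that mom assms(6) PhiX by (auto simp: subset_iff)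
    have H': "Ck_on 1 (?H s) (\<Phi> s ` \<phi> 0 ` N)" if "s \<in> I" for s
      unfolding Phi_image[OF zT order_refl] using H that assms(4) by blast
    have wd: "case_prod w differentiable (at (s, x))" "divergence (w s) x = 0" if "(s, x) \<in> \<Phi>.R" for s x
      using w that unfolding R by auto
    have BN: "\<phi> 0 ` B \<subseteq> \<phi> 0 ` N" "\<phi> 0 ` D \<subseteq> \<phi> 0 ` B" using assms(6) D(2) by auto
    have w0: "Ck_on 1 (w 0) (\<phi> 0 ` N)" using w by blast
    note res = res[OF Phi_initial[OF zT] assms(2-4) t BN(1) reg BN(2) cl wd w0 frz H' mom' tan]
    show ?thesis
      using res unfolding Phi_image[OF zT DN] by blast
  qed
  with law show ?thesis by blast
qed

end
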